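(* Let $A>0$. If the infimum $E(A)$ is attained, i.e. if there exists a measurable set $\Omega\subset\mathbb{R}^3$ with $|\Omega|=A$ and $\mathcal{E}(\Omega)=E(A)$, then $A<7.5$.
   Context: For a measurable set $\Omega\subset\mathbb{R}^3$ let $|\Omega|$ denote its Lebesgue measure and $P(\Omega)$ its perimeter in the sense of De Giorgi ($P(\Omega)=+\infty$ if $\Omega$ is not of finite perimeter). Gamow's liquid drop energy is $$\mathcal{E}(\Omega)=P(\Omega)+D(\Omega),\qquad D(\Omega)=\frac12\iint_{\Omega\times\Omega}\frac{dx\,dy}{|x-y|}.$$ For $A>0$ set $$E(A)=\inf\{\mathcal{E}(\Omega):\ \Omega\subset\mathbb{R}^3\text{ measurable},\ |\Omega|=A\}.$$ *)

theory Defs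
  imports "HOL-Analysis.Analysis"
begin

definition divergence :: "(real^3 \<Rightarrow> real^3) \<Rightarrow> real^3 \<Rightarrow> real" where
  "divergence \<phi> x = (\<Sum>i\<in>UNIV. frechet_derivative \<phi> (at x) (axis i 1) $ i)"

definition C1_compact_support :: "(real^3 \<Rightarrow> real^3) \<Rightarrow> bool" where
  "C1_compact_support \<phi> \<longleftrightarrow>
     (\<forall>x. \<phi> differentiable (at x)) \<and>
     (\<forall>v. continuous_on UNIV (\<lambda>x. frechet_derivative \<phi> (at x) v)) \<and>
     compact (closure {x. \<phi> x \<noteq> 0})"

(* ennreal sends negative reals to 0; this does not affect the supremum, because the
   zero field is admissible. *)
definition perimeter :: "(real^3) set \<Rightarrow> ennreal" where
  "perimeter \<Omega> =
     (SUP \<phi>\<in>{\<phi>. C1_compact_support \<phi> \<and> (\<forall>x. norm (\<phi> x) \<le> 1)}.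
        ennreal (LINT x:\<Omega>|lebesgue. divergence \<phi> x))"

(* On the diagonal, a null set of the product, the integrand is 1 / 0 = 0. *)
definition coulomb_energy :: "(real^3) set \<Rightarrow> ennreal" where
  "coulomb_energy \<Omega> =
     (1/2) * (\<integral>\<^sup>+ z\<in>\<Omega> \<times> \<Omega>. ennreal (1 / norm (fst z - snd z)) \<partial>(lebesgue \<Otimes>\<^sub>M lebesgue))"

definition liquid_drop_energy :: "(real^3) set \<Rightarrow> ennreal" where
  "liquid_drop_energy \<Omega> = perimeter \<Omega> + coulomb_energy \<Omega>"

definition min_energy :: "real \<Rightarrow> ennreal" where
  "min_energy A =
     (INF \<Omega>\<in>{\<Omega>. \<Omega> \<in> sets lebesgue \<and> emeasure lebesgue \<Omega> = ennreal A}. liquid_drop_energy \<Omega>)"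

end

theory Submission imports Defs
begin

text \<open>
  Let \<open>\<Omega>\<close> be a minimizer of volume \<open>A\<close>, perimeter \<open>P\<close> and Coulomb energy \<open>D\<close>. For a unit vector \<open>\<nu>\<close> and
  \<open>l \<in> \<real>\<close> write \<open>V\<close> for the volume of the part of \<open>\<Omega>\<close> above the plane \<open>\<nu> \<bullet> x = l\<close>, \<open>I\<close> for the Coulomb
  interaction between the two parts, and \<open>b = - dV/dl\<close> for the area of the section. Cutting along the plane
  and moving the parts infinitely far apart shows \<open>I \<le> 2 b\<close>. Integrating over \<open>l\<close> and averaging over \<open>\<nu>\<close>
  turns the left-hand side into \<open>A\<^sup>2/4\<close>, because \<open>max 0 (\<nu> \<bullet> (x - y))\<close> averages to \<open>\<bar>x - y\<bar>/4\<close>, and the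
  right-hand side into \<open>2 A\<close>; hence \<open>A \<le> 8\<close>.

  The improvement comes from cuts with small \<open>V = x A\<close>. Discarding the upper part and dilating the lower part
  back to volume \<open>A\<close> costs at most \<open>(2 P + 5 D) x / 3\<close> before the perimeter gain of discarding is accounted for. For
  \<open>-1 < \<beta> \<le> 1\<close> the capillary isoperimetric inequality bounds the perimeter of the upper part outside the plane
  from below by its value \<open>p0 (k x\<^sup>2)\<^bsup>1/3\<^esup>\<close> for a truncated ball with contact parameter \<open>\<beta>\<close>, minus \<open>\<beta> b\<close>, where \<open>p0\<close> is
  the perimeter of the ball of volume \<open>A\<close> and \<open>k\<close> the volume fraction of the truncated ball. So \<open>I \<le> (1 + \<beta>) b\<close>
  as soon as \<open>\<Lambda>\<^sup>3 x \<le> (1 - x)\<^sup>3 k\<close>, if \<open>2 P + 5 D \<le> 3 \<Lambda> p0\<close>. Comparing \<open>\<Omega>\<close> with a shrunk copy of itself of volume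
  \<open>3 A/4\<close> and a distant ball of volume \<open>A/4\<close> gives \<open>\<Lambda> = 2.3342\<close> when \<open>A \<le> 8\<close>. Using \<open>\<beta> = 1 - m/8\<close> for
  \<open>m = 1, \<dots>, 15\<close> in the averaging argument lowers the bound from \<open>8\<close> to \<open>8 - 0.5077\<close>.
\<close>

section \<open>The Prekopa--Leindler and Brunn--Minkowski inequalities\<close>

text \<open>The perimeter is a supremum over test fields, so there is no boundary on which a section
  could be added or removed. Cuts are therefore made on fields: one field for the upper part and one
  for the lower part are glued by a steep ramp, and the area \<open>b\<close> is a lower limit of
  difference quotients of \<open>V\<close>, infinite values allowed. For the same reason the
  capillary inequality produces a field of large flux instead of bounding a perimeter. The values of
  that field are confined to a truncated ball, and the constraint
  \<open>- \<beta> \<le> \<nu> \<bullet> \<phi> x\<close> lowers the price of the glue from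
  \<open>2 b\<close> to \<open>(1 + \<beta>) b\<close>. Each of the fifteen parameters lowers the
  price 2 per unit of area by 1/8 wherever one of the two parts has relative volume below the
  threshold of that parameter. This happens at both ends, so the integral over \<open>l\<close> is
  at most \<open>2 A - A s / 4\<close> with \<open>s\<close> the sum of the thresholds, and
  comparison with the average \<open>A^2 / 4\<close> gives \<open>A \<le> 8 - s\<close>. The bound
  \<open>A \<le> 8\<close> has to come first, because \<open>\<Lambda>\<close> is computed from
  it.\<close>

lemma nn_integral_layer_cake:
  fixes f :: "'a \<Rightarrow> real"
  assumes "sigma_finite_measure M" and f[measurable]: "f \<in> borel_measurable M"
    and "\<And>x. x \<in> space M \<Longrightarrow> 0 \<le> f x"
  shows "(\<integral>\<^sup>+x. ennreal (f x) \<partial>M)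
    = (\<integral>\<^sup>+t\<in>{0<..}. emeasure M {x \<in> space M. t < f x} \<partial>lborel)"
proof -
  interpret M: sigma_finite_measure M by fact
  interpret pair_sigma_finite M "lborel :: real measure" ..
  have "(\<integral>\<^sup>+x. ennreal (f x) \<partial>M) = (\<integral>\<^sup>+x. (\<integral>\<^sup>+t. indicator {0<..<f x} t \<partial>lborel) \<partial>M)"
    using assms by (intro nn_integral_cong) simp
  also have "\<dots> = (\<integral>\<^sup>+x. (\<integral>\<^sup>+t. (if 0 < t \<and> t < f x then 1 else 0) \<partial>lborel) \<partial>M)"
    by (intro nn_integral_cong) (auto simp: indicator_def)
  also have "\<dots> = (\<integral>\<^sup>+t. (\<integral>\<^sup>+x. (if 0 < t \<and> t < f x then 1 else 0) \<partial>M) \<partial>lborel)"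
    by (rule Fubini'[symmetric]) measurable
  also have "\<dots> = (\<integral>\<^sup>+t\<in>{0<..}. emeasure M {x \<in> space M. t < f x} \<partial>lborel)"
  proof (intro nn_integral_cong)
    fix t :: real
    have "(\<integral>\<^sup>+x. (if 0 < t \<and> t < f x then 1 else 0) \<partial>M)
        = (\<integral>\<^sup>+x. indicator {x \<in> space M. t < f x} x * indicator {0<..} t \<partial>M)"
      by (intro nn_integral_cong) (auto simp: indicator_def)
    also have "\<dots> = emeasure M {x \<in> space M. t < f x} * indicator {0<..} t"
      by (subst nn_integral_multc) simp_all
    finally show "(\<integral>\<^sup>+x. (if 0 < t \<and> t < f x then 1 else 0) \<partial>M)
      = emeasure M {x \<in> space M. t < f x} * indicator {0<..} t" .
  qed
  finally show ?thesis .
qed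

text \<open>With \<open>a\<close> the maximum of \<open>A\<close> and \<open>b\<close> the minimum
  of \<open>B\<close>, the translates \<open>b + A\<close> and \<open>a + B\<close> both lie in
  \<open>C\<close> and meet at most in the point \<open>a + b\<close>.\<close>

lemma measure_sumset_compact_real:
  fixes A B :: "real set"
  assumes "compact A" "compact B" "A \<noteq> {}" "B \<noteq> {}" "C \<in> lmeasurable"
    and sub: "\<And>a b. a \<in> A \<Longrightarrow> b \<in> B \<Longrightarrow> a + b \<in> C"
  shows "measure lebesgue A + measure lebesgue B \<le> measure lebesgue C"
proof -
  obtain a where a: "a \<in> A" "\<And>x. x \<in> A \<Longrightarrow> x \<le> a"
    using compact_attains_sup[of A] assms by auto
  obtain b where b: "b \<in> B" "\<And>x. x \<in> B \<Longrightarrow> b \<le> x"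
    using compact_attains_inf[of B] assms by auto
  let ?A = "(+) b ` A" and ?B = "(+) a ` B"
  have m: "?A \<in> lmeasurable" "?B \<in> lmeasurable"
    using assms by (auto intro!: lmeasurable_compact compact_translation)
  have "?A \<inter> ?B \<subseteq> {a + b}" using a b by fastforce
  then have "negligible (?A \<inter> ?B)" using negligible_subset by blast
  then have "measure lebesgue ?A + measure lebesgue ?B = measure lebesgue (?A \<union> ?B)"
    using m by (simp add: measure_Un3 negligible_imp_measure0)
  moreover have "?A \<subseteq> C" "?B \<subseteq> C" using sub[OF _ b(1)] sub[OF a(1)] by (auto simp: add.commute)
  then have "measure lebesgue (?A \<union> ?B) \<le> measure lebesgue C"
    using m assms by (intro measure_mono_fmeasurable) auto
  ultimately show ?thesis by (simp add: measure_translation)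
qed

text \<open>Inner approximation by compact sets. A measurable superset \<open>C\<close> stands for
  the sumset, which need not be measurable.\<close>

lemma measure_sumset_real:
  fixes A B :: "real set"
  assumes "A \<in> lmeasurable" "B \<in> lmeasurable" "bounded A" "bounded B" "A \<noteq> {}" "B \<noteq> {}" "C \<in> lmeasurable"
    and sub: "\<And>a b. a \<in> A \<Longrightarrow> b \<in> B \<Longrightarrow> a + b \<in> C"
  shows "measure lebesgue A + measure lebesgue B \<le> measure lebesgue C"
proof -
  have inner: "\<exists>K. compact K \<and> K \<noteq> {} \<and> K \<subseteq> A \<and> measure lebesgue A \<le> measure lebesgue K + e"
    if A: "A \<in> lmeasurable" "bounded A" "A \<noteq> {}" "e > 0" for A :: "real set" and e
  proof -
    obtain K where K: "closed K" "K \<subseteq> A" "A - K \<in> lmeasurable" "emeasure lebesgue (A - K) < ennreal e"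
      using sets_lebesgue_inner_closed[of A e] A fmeasurableD by metis
    then have c: "compact K" using that bounded_subset compact_eq_bounded_closed by blast
    have "measure lebesgue (A - K) \<le> e"
      using K that by (simp add: emeasure_eq_measure2 ennreal_less_iff)
    then have le: "measure lebesgue A \<le> measure lebesgue K + e"
      using measurable_measure_Diff[OF that(1) _ K(2)] c by (simp add: lmeasurable_compact fmeasurableD)
    show ?thesis
    \<comment> \<open>An empty approximation is replaced by a point of \<open>A\<close>, since the
      compact case asks for nonempty sets.\<close>
    proof (cases "K = {}")
      case True
      then have "measure lebesgue A \<le> e" using le by simp
      moreover obtain x where "x \<in> A" using A by blast
      ultimately show ?thesis using that by (intro exI[of _ "{x}"]) auto
    qed (use K c le in auto)
  qed
  show ?thesis
  proof (rule field_le_epsilon)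
    fix e :: real assume "0 < e"
    with inner[of A "e/2"] inner[of B "e/2"] assms(1-6) obtain K L where
      "compact K" "K \<noteq> {}" "K \<subseteq> A" "measure lebesgue A \<le> measure lebesgue K + e/2"
      "compact L" "L \<noteq> {}" "L \<subseteq> B" "measure lebesgue B \<le> measure lebesgue L + e/2"
      by (metis half_gt_zero)
    moreover from this have "measure lebesgue K + measure lebesgue L \<le> measure lebesgue C"
      using assms by (intro measure_sumset_compact_real) auto
    ultimately show "measure lebesgue A + measure lebesgue B \<le> measure lebesgue C + e" by linarith
  qed
qed

text \<open>Stated as a property of a measure so that it can be passed on to products. The common
  bound \<open>C\<close> makes all three functions integrable over a finite measure. Since 0
  \<open>powr\<close> anything is 0, the pointwise hypothesis is void where \<open>f\<close> or
  \<open>g\<close> vanishes.\<close>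

definition prekopa_leindler :: "'a::real_vector measure \<Rightarrow> bool" where
  "prekopa_leindler M \<longleftrightarrow> (\<forall>l f g h C. 0 < l \<and> l < 1
     \<and> f \<in> borel_measurable M \<and> g \<in> borel_measurable M \<and> h \<in> borel_measurable M
     \<and> (\<forall>x. 0 \<le> f x \<and> f x \<le> C \<and> 0 \<le> g x \<and> g x \<le> C \<and> 0 \<le> h x \<and> h x \<le> C)
     \<and> (\<forall>x y. f x powr (1 - l) * g y powr l \<le> h ((1 - l) *\<^sub>R x + l *\<^sub>R y))
     \<longrightarrow> (\<integral>x. f x \<partial>M) powr (1 - l) * (\<integral>x. g x \<partial>M) powr l \<le> (\<integral>x. h x \<partial>M))"

text \<open>The inequality in the second variable, applied to the sections of \<open>f\<close> at
  \<open>x\<close> and of \<open>g\<close> at \<open>x'\<close>, is exactly the hypothesis of the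
  inequality in the first variable for the partial integrals.\<close>

lemma prekopa_leindler_prod:
  fixes M :: "'a::real_vector measure" and N :: "'b::real_vector measure"
  assumes "finite_measure M" "finite_measure N" "space M = UNIV" "space N = UNIV"
    and M: "prekopa_leindler M" and N: "prekopa_leindler N"
  shows "prekopa_leindler (M \<Otimes>\<^sub>M N)"
  unfolding prekopa_leindler_def
proof (intro allI impI, elim conjE)
  interpret M: finite_measure M by fact
  interpret N: finite_measure N by fact
  interpret P: pair_sigma_finite M N ..
  interpret MN: finite_measure "M \<Otimes>\<^sub>M N"
    using assms by (intro finite_measure_pair_measure)
  fix l C :: real and f g h :: "'a \<times> 'b \<Rightarrow> real"
  assume l: "0 < l" "l < 1" and f[measurable]: "f \<in> borel_measurable (M \<Otimes>\<^sub>M N)"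
    and g[measurable]: "g \<in> borel_measurable (M \<Otimes>\<^sub>M N)"
    and h[measurable]: "h \<in> borel_measurable (M \<Otimes>\<^sub>M N)"
    and b: "\<forall>x. 0 \<le> f x \<and> f x \<le> C \<and> 0 \<le> g x \<and> g x \<le> C \<and> 0 \<le> h x \<and> h x \<le> C"
    and le: "\<forall>x y. f x powr (1 - l) * g y powr l \<le> h ((1 - l) *\<^sub>R x + l *\<^sub>R y)"
  have sec[measurable]: "(\<lambda>y. u (x, y)) \<in> borel_measurable N"
    if "u \<in> borel_measurable (M \<Otimes>\<^sub>M N)" for u :: "'a \<times> 'b \<Rightarrow> real" and x
    using that measurable_Pair2[of u M N borel x] assms(3) by simp
  have int: "integrable (M \<Otimes>\<^sub>M N) u"
    if "u \<in> borel_measurable (M \<Otimes>\<^sub>M N)" "\<And>x. 0 \<le> u x \<and> u x \<le> C" for u :: "'a \<times> 'b \<Rightarrow> real"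
    using that by (intro MN.integrable_const_bound[where B=C]) auto
  have fub: "(\<integral>z. u z \<partial>(M \<Otimes>\<^sub>M N)) = (\<integral>x. (\<integral>y. u (x, y) \<partial>N) \<partial>M)"
    if "u \<in> borel_measurable (M \<Otimes>\<^sub>M N)" "\<And>x. 0 \<le> u x \<and> u x \<le> C" for u :: "'a \<times> 'b \<Rightarrow> real"
    using P.integral_fst'[OF int[OF that]] by simp
  have bound: "0 \<le> (\<integral>y. u (x, y) \<partial>N) \<and> (\<integral>y. u (x, y) \<partial>N) \<le> C * measure N UNIV"
    if "u \<in> borel_measurable (M \<Otimes>\<^sub>M N)" "\<And>x. 0 \<le> u x \<and> u x \<le> C" for u :: "'a \<times> 'b \<Rightarrow> real" and x
  proof
    show "0 \<le> (\<integral>y. u (x, y) \<partial>N)" using that by simp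
    have "(\<integral>y. u (x, y) \<partial>N) \<le> (\<integral>y. C \<partial>N)"
      using that sec[OF that(1)] order_trans[OF conjunct1[OF that(2)] conjunct2[OF that(2)]]
      by (intro integral_mono N.integrable_const_bound[where B=C]) auto
    then show "(\<integral>y. u (x, y) \<partial>N) \<le> C * measure N UNIV" using assms(4) by (simp add: mult.commute)
  qed
  have inner: "(\<integral>y. f (x, y) \<partial>N) powr (1 - l) * (\<integral>y. g (x', y) \<partial>N) powr l
      \<le> (\<integral>y. h ((1 - l) *\<^sub>R x + l *\<^sub>R x', y) \<partial>N)" for x x'
  proof -
    have "\<forall>y y'. f (x, y) powr (1 - l) * g (x', y') powr l
        \<le> h ((1 - l) *\<^sub>R x + l *\<^sub>R x', (1 - l) *\<^sub>R y + l *\<^sub>R y')"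
      using le by (metis add_Pair scaleR_Pair)
    then show ?thesis
      using N[unfolded prekopa_leindler_def, rule_format, of l "\<lambda>y. f (x, y)" "\<lambda>y. g (x', y)"
          "\<lambda>y. h ((1 - l) *\<^sub>R x + l *\<^sub>R x', y)" C] l b f g h by (simp add: sec)
  qed
  have "(\<integral>x. (\<integral>y. f (x, y) \<partial>N) \<partial>M) powr (1 - l) * (\<integral>x. (\<integral>y. g (x, y) \<partial>N) \<partial>M) powr l
      \<le> (\<integral>x. (\<integral>y. h (x, y) \<partial>N) \<partial>M)"
    using M[unfolded prekopa_leindler_def, rule_format, of l "\<lambda>x. \<integral>y. f (x, y) \<partial>N" "\<lambda>x. \<integral>y. g (x, y) \<partial>N"
          "\<lambda>x. \<integral>y. h (x, y) \<partial>N" "C * measure N UNIV"] l inner bound f g h b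
    by (simp add: N.borel_measurable_lebesgue_integral)
  moreover have "(\<integral>x. f x \<partial>(M \<Otimes>\<^sub>M N)) = (\<integral>x. (\<integral>y. f (x, y) \<partial>N) \<partial>M)"
    "(\<integral>x. g x \<partial>(M \<Otimes>\<^sub>M N)) = (\<integral>x. (\<integral>y. g (x, y) \<partial>N) \<partial>M)"
    "(\<integral>x. h x \<partial>(M \<Otimes>\<^sub>M N)) = (\<integral>x. (\<integral>y. h (x, y) \<partial>N) \<partial>M)"
    by (rule fub[OF f] fub[OF g] fub[OF h]; use b in blast)+
  ultimately show "(\<integral>x. f x \<partial>(M \<Otimes>\<^sub>M N)) powr (1 - l) * (\<integral>x. g x \<partial>(M \<Otimes>\<^sub>M N)) powr l \<le> (\<integral>x. h x \<partial>(M \<Otimes>\<^sub>M N))"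
    by simp
qed

lemma sets_scaleR_image:
  fixes A :: "'a::euclidean_space set"
  assumes [measurable]: "A \<in> sets borel" and "c \<noteq> 0"
  shows "(*\<^sub>R) c ` A \<in> sets borel"
proof -
  have "(*\<^sub>R) c ` A = (\<lambda>x. x /\<^sub>R c) -` A \<inter> space borel"
    using assms(2) by (auto simp: image_iff intro!: bexI[of _ "_ /\<^sub>R c"])
  also have "\<dots> \<in> sets borel" by measurable
  finally show ?thesis .
qed

text \<open>The hypothesis passes to superlevel sets as a sumset inclusion, so the one-dimensional
  sumset bound and the layer cake formula give an additive inequality. Convex combinations stay in
  the interval, which is why the truncated measure inherits the property.\<close>

lemma prekopa_leindler_real:
  fixes R :: real
  defines "M \<equiv> density lborel (indicator {-R..R})"
  shows "prekopa_leindler M"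
  unfolding prekopa_leindler_def
proof (intro allI impI, elim conjE)
  fix l C :: real and f g h :: "real \<Rightarrow> real"
  assume l: "0 < l" "l < 1" and "f \<in> borel_measurable M" "g \<in> borel_measurable M" "h \<in> borel_measurable M"
    and b: "\<forall>x. 0 \<le> f x \<and> f x \<le> C \<and> 0 \<le> g x \<and> g x \<le> C \<and> 0 \<le> h x \<and> h x \<le> C"
    and le: "\<forall>x y. f x powr (1 - l) * g y powr l \<le> h ((1 - l) *\<^sub>R x + l *\<^sub>R y)"
  then have f[measurable]: "f \<in> borel_measurable borel" and g[measurable]: "g \<in> borel_measurable borel"
    and h[measurable]: "h \<in> borel_measurable borel" by (simp_all add: M_def)
  define m where "m u t = measure lborel ({-R..R} \<inter> {x. t < u x})" for u :: "real \<Rightarrow> real" and t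
  have [simp]: "space M = UNIV" and sets[measurable_cong, simp]: "sets M = sets borel"
    by (simp_all add: M_def)
  have fin: "finite_measure M"
    by (rule finite_measureI) (simp add: M_def emeasure_density emeasure_lborel_Icc_eq)
  interpret M: finite_measure M by fact
  have em: "emeasure M {x. t < u x} = ennreal (m u t)" if [measurable]: "u \<in> borel_measurable borel" for u t
  proof -
    have "emeasure M {x. t < u x} = emeasure lborel ({-R..R} \<inter> {x. t < u x})"
      unfolding M_def by (subst emeasure_density) (auto simp: indicator_inter_arith[symmetric])
    moreover have "emeasure lborel ({-R..R} \<inter> {x. t < u x}) < \<infinity>"
      by (rule le_less_trans[OF emeasure_mono[of _ "{-R..R}"]]) (auto simp: emeasure_lborel_Icc_eq)
    ultimately show ?thesis unfolding m_def by (simp add: emeasure_eq_ennreal_measure)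
  qed
  have layer: "ennreal (\<integral>x. u x \<partial>M) = (\<integral>\<^sup>+t\<in>{0<..}. ennreal (m u t) \<partial>lborel)"
    if [measurable]: "u \<in> borel_measurable borel" and "\<And>x. 0 \<le> u x \<and> u x \<le> C" for u and C :: real
  proof -
    have "integrable M u" using that by (intro M.integrable_const_bound[where B=C]) auto
    then have "ennreal (\<integral>x. u x \<partial>M) = (\<integral>\<^sup>+x. ennreal (u x) \<partial>M)"
      using that by (simp add: nn_integral_eq_integral)
    also have "\<dots> = (\<integral>\<^sup>+t\<in>{0<..}. emeasure M {x \<in> space M. t < u x} \<partial>lborel)"
      using that by (intro nn_integral_layer_cake) (auto simp: M.sigma_finite_measure_axioms)
    finally show ?thesis by (simp add: em)
  qed
  show "(\<integral>x. f x \<partial>M) powr (1 - l) * (\<integral>x. g x \<partial>M) powr l \<le> (\<integral>x. h x \<partial>M)"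
  proof (cases "(\<integral>x. f x \<partial>M) = 0 \<or> (\<integral>x. g x \<partial>M) = 0")
    case True
    then show ?thesis using l b by auto
  next
    case False
    define sup where "sup u = Sup (u ` {-R..R})" for u :: "real \<Rightarrow> real"
    have le_sup: "u x \<le> sup u" if "\<forall>x. 0 \<le> u x \<and> u x \<le> C" "x \<in> {-R..R}" for u x
      unfolding sup_def using that by (intro cSup_upper bdd_aboveI2[of _ _ C]) auto
    have ex: "\<exists>x\<in>{-R..R}. t < u x" if "\<forall>x. 0 \<le> u x \<and> u x \<le> C" "t < sup u" "0 \<le> R" for u t
    proof -
      have "bdd_above (u ` {-R..R})" using that by (intro bdd_aboveI2[of _ _ C]) auto
      then show ?thesis using that less_cSup_iff[of "u ` {-R..R}" t] by (auto simp: sup_def)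
    qed
    have AE: "AE x in M. x \<in> {-R..R}"
      unfolding M_def by (subst AE_density) (auto simp: indicator_def)
    have pos: "0 < sup u" if u: "(\<integral>x. u x \<partial>M) \<noteq> 0" "\<forall>x. 0 \<le> u x \<and> u x \<le> C" for u
    proof (rule ccontr)
      assume "\<not> 0 < sup u"
      then have "u x = 0" if "x \<in> {-R..R}" for x using le_sup[of u x] u that by (meson not_less order_antisym order_trans)
      then have "AE x in M. u x = 0" using AE by auto
      then show False using u by (simp add: integral_eq_zero_AE)
    qed
    have R: "0 \<le> R"
    proof (rule ccontr)
      assume "\<not> 0 \<le> R"
      then have "AE x in M. f x = 0" using AE by auto
      then show False using False by (simp add: integral_eq_zero_AE)
    qed
    \<comment> \<open>Dividing by the suprema makes the level sets of \<open>f\<close> and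
      \<open>g\<close> at height \<open>t\<close> nonempty for the same \<open>t\<close>, namely
      those below 1, as the sumset bound requires.\<close>
    define F G S where "F = sup f" and "G = sup g" and "S = F powr (1 - l) * G powr l"
    have FG: "0 < F" "0 < G" using pos False b by (auto simp: F_def G_def)
    then have S: "0 < S" by (simp add: S_def)
    define f' g' h' where "f' x = f x / F" and "g' x = g x / G" and "h' x = h x / S" for x
    have [measurable]: "f' \<in> borel_measurable borel" "g' \<in> borel_measurable borel" "h' \<in> borel_measurable borel"
      by (simp_all add: f'_def[abs_def] g'_def[abs_def] h'_def[abs_def])
    have key: "(1 - l) * m f' t + l * m g' t \<le> m h' t" if t: "0 < t" for t
    proof (cases "t < 1")
      case True
      let ?A = "{-R..R} \<inter> {x. t < f' x}" and ?B = "{-R..R} \<inter> {x. t < g' x}" and ?C = "{-R..R} \<inter> {x. t < h' x}"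
      have ne: "?A \<noteq> {}" "?B \<noteq> {}"
        using ex[of f "t * F"] ex[of g "t * G"] b R FG True t
        by (auto simp: f'_def g'_def pos_less_divide_eq F_def[symmetric] G_def[symmetric])
      have lm: "?A \<in> lmeasurable" "?B \<in> lmeasurable" "?C \<in> lmeasurable"
        by (auto intro!: fmeasurable_Int_fmeasurable lmeasurable_interval(1)[of "-R" R, unfolded cbox_interval])
      have bdd: "bounded ((*\<^sub>R) c ` ({-R..R} \<inter> X))" for c :: real and X
        by (meson bounded_scaling Int_lower1 bounded_closed_interval bounded_subset)
      have lebesgue: "(*\<^sub>R) c ` ({-R..R} \<inter> {x. t < u x}) \<in> sets lebesgue"
        if [measurable]: "u \<in> borel_measurable borel" and "c \<noteq> 0" for c :: real and u :: "real \<Rightarrow> real"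
        using sets_scaleR_image[of "{-R..R} \<inter> {x. t < u x}" c] that(2) by simp
      have "measure lebesgue ((*\<^sub>R) (1 - l) ` ?A) + measure lebesgue ((*\<^sub>R) l ` ?B) \<le> measure lebesgue ?C"
      proof (rule measure_sumset_real)
        fix a c assume "a \<in> (*\<^sub>R) (1 - l) ` ?A" "c \<in> (*\<^sub>R) l ` ?B"
        then obtain x y where xy: "a = (1 - l) * x" "c = l * y" "x \<in> ?A" "y \<in> ?B"
          unfolding real_scaleR_def by blast
        have "convex {-R..R}" by simp
        then have "(1 - l) *\<^sub>R x + l *\<^sub>R y \<in> {-R..R}" using xy l by (intro convexD) auto
        moreover have "t < h' ((1 - l) *\<^sub>R x + l *\<^sub>R y)"
        proof -
          have "t * F < f x" "t * G < g y" using xy FG by (auto simp: f'_def g'_def pos_less_divide_eq)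
          moreover have "0 \<le> f x" "0 < t * F" "0 < t * G" using b t FG by auto
          ultimately have "(t * F) powr (1 - l) * (t * G) powr l < f x powr (1 - l) * g y powr l"
            using l by (intro mult_strict_mono powr_less_mono2) auto
          also have "(t * F) powr (1 - l) * (t * G) powr l = t * S"
          proof -
            have "t powr (1 - l) * t powr l = t" using t by (simp flip: powr_add)
            moreover have "(t * F) powr (1 - l) * (t * G) powr l = (t powr (1 - l) * t powr l) * S"
              using t FG by (simp add: powr_mult S_def)
            ultimately show ?thesis by simp
          qed
          also have "f x powr (1 - l) * g y powr l \<le> h ((1 - l) *\<^sub>R x + l *\<^sub>R y)" using le by blast
          finally show ?thesis using S by (simp add: h'_def pos_less_divide_eq)
        qed
        ultimately show "a + c \<in> ?C" using xy by simp
      next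
        show "(*\<^sub>R) (1 - l) ` ?A \<in> lmeasurable" "(*\<^sub>R) l ` ?B \<in> lmeasurable"
          using l by (intro bounded_set_imp_lmeasurable bdd lebesgue; simp)+
        show "bounded ((*\<^sub>R) (1 - l) ` ?A)" "bounded ((*\<^sub>R) l ` ?B)"
          by (rule bdd)+
      qed (use lm ne in auto)
      moreover have "measure lebesgue ((*\<^sub>R) r ` X) = \<bar>r\<bar> * measure lebesgue X" for r :: real and X :: "real set"
        using measure_lebesgue_affine[of r 0 X] by (simp add: image_def)
      ultimately show ?thesis using l by (simp add: m_def measure_completion)
    next
      case False
      have "f' x \<le> 1 \<and> g' x \<le> 1" if "x \<in> {-R..R}" for x
        using le_sup[of f x] le_sup[of g x] b FG that
        by (simp add: f'_def g'_def F_def[symmetric] G_def[symmetric])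
      then have "{-R..R} \<inter> {x. t < f' x} = {}" "{-R..R} \<inter> {x. t < g' x} = {}"
        using False by (fastforce simp del: atLeastAtMost_iff)+
      then show ?thesis by (simp add: m_def)
    qed
    have bd: "\<And>x. 0 \<le> f' x \<and> f' x \<le> C / F" "\<And>x. 0 \<le> g' x \<and> g' x \<le> C / G" "\<And>x. 0 \<le> h' x \<and> h' x \<le> C / S"
      using b FG S by (auto simp: f'_def g'_def h'_def divide_right_mono)
    have [measurable]: "m u \<in> borel_measurable borel" if [measurable]: "u \<in> borel_measurable borel" for u :: "real \<Rightarrow> real"
      unfolding m_def by measurable
    have "ennreal ((1 - l) * (\<integral>x. f' x \<partial>M) + l * (\<integral>x. g' x \<partial>M))
        = ennreal (1 - l) * ennreal (\<integral>x. f' x \<partial>M) + ennreal l * ennreal (\<integral>x. g' x \<partial>M)"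
      using l bd by (simp add: ennreal_plus ennreal_mult)
    also have "\<dots> = (\<integral>\<^sup>+t\<in>{0<..}. ennreal ((1 - l) * m f' t + l * m g' t) \<partial>lborel)"
      using l bd by (simp add: layer[of _ "C/F"] layer[of _ "C/G"] ennreal_plus ennreal_mult m_def distrib_right mult.assoc
         nn_integral_add nn_integral_cmult)
    also have "\<dots> \<le> (\<integral>\<^sup>+t\<in>{0<..}. ennreal (m h' t) \<partial>lborel)"
      using key by (intro nn_integral_mono) (auto simp: indicator_def intro!: ennreal_leI)
    also have "\<dots> = ennreal (\<integral>x. h' x \<partial>M)" using bd by (simp add: layer[of _ "C/S"])
    finally have "(1 - l) * (\<integral>x. f' x \<partial>M) + l * (\<integral>x. g' x \<partial>M) \<le> (\<integral>x. h' x \<partial>M)"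
      using bd by (subst (asm) ennreal_le_iff) (auto intro!: integral_nonneg)
    moreover have "0 < (\<integral>x. f' x \<partial>M)" "0 < (\<integral>x. g' x \<partial>M)"
      using False FG bd b by (auto simp: f'_def g'_def less_le intro!: divide_nonneg_pos)
    \<comment> \<open>The weighted inequality of arithmetic and geometric means turns the additive
      bound back into the multiplicative one.\<close>
    moreover from this have "(\<integral>x. f' x \<partial>M) powr (1 - l) * (\<integral>x. g' x \<partial>M) powr l \<le> (1 - l) * (\<integral>x. f' x \<partial>M) + l * (\<integral>x. g' x \<partial>M)"
      using l by (intro Youngs_inequality_0) auto
    ultimately have "S * ((\<integral>x. f' x \<partial>M) powr (1 - l) * (\<integral>x. g' x \<partial>M) powr l) \<le> S * (\<integral>x. h' x \<partial>M)"
      using S by (intro mult_left_mono) auto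
    then show ?thesis
      using S FG b by (simp add: f'_def g'_def h'_def powr_divide S_def)
  qed
qed

lemma prekopa_leindler_sets:
  assumes PL: "prekopa_leindler M" and "finite_measure M" "space M = UNIV"
    and [measurable]: "A \<in> sets M" "B \<in> sets M" "C \<in> sets M" and l: "0 < l" "l < 1"
    and sub: "\<And>a b. a \<in> A \<Longrightarrow> b \<in> B \<Longrightarrow> (1 - l) *\<^sub>R a + l *\<^sub>R b \<in> C"
  shows "measure M A powr (1 - l) * measure M B powr l \<le> measure M C"
proof -
  have "(\<integral>x. indicator A x \<partial>M) powr (1 - l) * (\<integral>x. indicator B x \<partial>M) powr l \<le> (\<integral>x. (indicator C x :: real) \<partial>M)"
    using l sub by (intro PL[unfolded prekopa_leindler_def, rule_format, of l _ _ _ 1]) (auto simp: indicator_def)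
  then show ?thesis using assms(3) by simp
qed

section \<open>The Brunn-Minkowski inequality in \<open>real^3\<close>\<close>

lemma borel_measurable_vector3[measurable]:
  "(\<lambda>(x, y, z). vector [x, y, z] :: real^3) \<in> borel_measurable borel" (is "?T \<in> _")
  proof (rule borel_measurable_continuous_onI)
    have "?T = (\<lambda>p. \<chi> i. if i = 1 then fst p else if i = 2 then fst (snd p) else snd (snd p))"
      by (auto simp: vec_eq_iff forall_3 split: prod.splits)
    moreover have "continuous_on (UNIV :: (real \<times> real \<times> real) set)
        (\<lambda>p. \<chi> i::3. if i = 1 then fst p else if i = 2 then fst (snd p) else snd (snd p))"
    proof (rule continuous_on_vec_lambda)
      fix i :: 3
      show "continuous_on (UNIV :: (real \<times> real \<times> real) set)
        (\<lambda>p. if i = 1 then fst p else if i = 2 then fst (snd p) else snd (snd p))"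
        by (cases "i = 1"; cases "i = 2") (auto intro!: continuous_intros)
    qed
    ultimately show "continuous_on UNIV ?T" by simp
  qed


text \<open>Links \<open>real^3\<close> with the threefold product, on which the tensorized
  inequality lives.\<close>

lemma lborel_vector3:
  "distr lborel borel (\<lambda>(x, y, z). vector [x, y, z] :: real^3) = (lborel :: (real^3) measure)"
proof (rule lborel_eqI[symmetric])
  let ?T = "\<lambda>(x, y, z). vector [x, y, z] :: real^3"
  fix l u :: "real^3" assume lu: "\<And>b. b \<in> Basis \<Longrightarrow> l \<bullet> b \<le> u \<bullet> b"
  then have le: "l $ i \<le> u $ i" for i using lu[of "axis i 1"] by (auto simp: inner_axis Basis_vec_def)
  have "?T -` box l u = box (l$1) (u$1) \<times> (box (l$2) (u$2) \<times> box (l$3) (u$3))"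
    by (auto simp: mem_box_cart forall_3)
  then have "emeasure (distr lborel borel ?T) (box l u)
      = emeasure (lborel \<Otimes>\<^sub>M (lborel \<Otimes>\<^sub>M lborel)) (box (l$1) (u$1) \<times> (box (l$2) (u$2) \<times> box (l$3) (u$3)))"
    by (simp add: emeasure_distr lborel_prod)
  also have "\<dots> = ennreal ((u$1 - l$1) * ((u$2 - l$2) * (u$3 - l$3)))"
    using le by (simp add: lborel.emeasure_pair_measure_Times lborel_pair.emeasure_pair_measure_Times emeasure_lborel_box_eq ennreal_mult)
  also have "\<dots> = (\<Prod>b\<in>Basis. (u - l) \<bullet> b)"
  proof -
    have "(\<Prod>b\<in>Basis. (u - l) \<bullet> b) = (\<Prod>i\<in>UNIV. (u - l) \<bullet> (axis i 1 :: real^3))"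
      by (subst prod.reindex[symmetric, of "\<lambda>i. axis i 1", unfolded o_def])
        (auto simp: inj_on_def axis_eq_axis Basis_vec_def intro!: prod.cong)
    moreover have "(\<Prod>i\<in>UNIV. (u - l) \<bullet> (axis i 1 :: real^3)) = (u$1 - l$1) * ((u$2 - l$2) * (u$3 - l$3))"
      unfolding UNIV_3 by (simp add: inner_axis)
    ultimately show ?thesis by simp
  qed
  finally show "emeasure (distr lborel borel ?T) (box l u) = (\<Prod>b\<in>Basis. (u - l) \<bullet> b)" .
qed simp

lemma measure_scaleR_image3:
  fixes X :: "(real^3) set"
  assumes "X \<in> sets borel" "0 < c"
  shows "measure lborel ((*\<^sub>R) c ` X) = c ^ 3 * measure lborel X"
  using measure_lebesgue_affine[of c 0 X] sets_scaleR_image[of X c] assms by (simp add: measure_completion)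

text \<open>With \<open>l = b / (a + b)\<close> the dilates \<open>A'\<close> of \<open>A\<close> by
  \<open>1 / (1 - l)\<close> and \<open>B'\<close> of \<open>B\<close> by \<open>1 / l\<close> both
  have volume \<open>(a + b) ^ 3\<close>, so the multiplicative inequality applied to them has the
  additive form.\<close>

lemma brunn_minkowski3:
  fixes A B C :: "(real^3) set"
  assumes [measurable]: "A \<in> sets borel" "B \<in> sets borel" "C \<in> sets borel"
    and bd: "bounded A" "bounded B" "bounded C"
    and pos: "0 < measure lborel A" "0 < measure lborel B"
    and sub: "\<And>a b. a \<in> A \<Longrightarrow> b \<in> B \<Longrightarrow> a + b \<in> C"
  shows "(root 3 (measure lborel A) + root 3 (measure lborel B)) ^ 3 \<le> measure lborel C"
proof -
  define a b l where "a = root 3 (measure lborel A)" and "b = root 3 (measure lborel B)" and "l = b / (a + b)"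
  have ab: "0 < a" "0 < b" using pos by (simp_all add: a_def b_def)
  then have l: "0 < l" "l < 1" "1 - l = a / (a + b)" by (simp_all add: l_def field_simps)
  let ?T = "\<lambda>(x, y, z). vector [x, y, z] :: real^3"
  note T = borel_measurable_vector3
  have lin: "?T (x + y) = ?T x + ?T y" "?T (c *\<^sub>R x) = c *\<^sub>R ?T x" for x y c
    by (auto simp: vec_eq_iff forall_3 split: prod.splits)
  define A' B' where "A' = (*\<^sub>R) (1 / (1 - l)) ` A" and "B' = (*\<^sub>R) (1 / l) ` B"
  have [measurable]: "A' \<in> sets borel" "B' \<in> sets borel"
    using l by (auto simp: A'_def B'_def intro!: sets_scaleR_image)
  have "bounded (A' \<union> B' \<union> C)" using bd by (simp add: A'_def B'_def bounded_scaling)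
  \<comment> \<open>The cube of half-width \<open>R\<close> contains all three sets, so truncating
    the measure does not change their volumes.\<close>
  then obtain R where R: "\<And>x. x \<in> A' \<union> B' \<union> C \<Longrightarrow> norm x \<le> R" by (auto simp: bounded_iff)
  define M where "M = density lborel (indicator {-R..R} :: real \<Rightarrow> ennreal)"
  have fin: "finite_measure M"
    by (rule finite_measureI) (simp add: M_def emeasure_density emeasure_lborel_Icc_eq)
  then have sf: "sigma_finite_measure M" by (rule finite_measure.axioms)
  have spM: "space M = UNIV" by (simp add: M_def)
  have times: "(\<lambda>(x, y). indicator X x * indicator Y y) = (indicator (X \<times> Y) :: _ \<Rightarrow> ennreal)"
    for X :: "'x set" and Y :: "'y set"
    by (auto simp: indicator_def)
  have M2: "M \<Otimes>\<^sub>M M = density (lborel :: (real \<times> real) measure) (indicator ({-R..R} \<times> {-R..R}))"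
    unfolding M_def by (subst pair_measure_density) (use sf in \<open>auto simp: M_def lborel_prod sigma_finite_lborel times\<close>)
  have fin2: "finite_measure (M \<Otimes>\<^sub>M M)" using fin by (intro finite_measure_pair_measure)
  have M3: "M \<Otimes>\<^sub>M (M \<Otimes>\<^sub>M M) = density (lborel :: (real \<times> real \<times> real) measure) (indicator ({-R..R} \<times> {-R..R} \<times> {-R..R}))"
    unfolding M2 unfolding M_def
    by (subst pair_measure_density)
      (use fin2[unfolded M2, THEN finite_measure.axioms(1)] in \<open>auto simp: lborel_prod sigma_finite_lborel times intro!: borel_measurable_indicator borel_Times\<close>)
  have PL2: "prekopa_leindler (M \<Otimes>\<^sub>M M)"
    using fin spM prekopa_leindler_real[of R] by (intro prekopa_leindler_prod) (auto simp: M_def)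
  have PL3: "prekopa_leindler (M \<Otimes>\<^sub>M (M \<Otimes>\<^sub>M M))"
    using fin fin2 spM PL2 prekopa_leindler_real[of R]
    by (intro prekopa_leindler_prod) (auto simp: M_def space_pair_measure)
  have fin3: "finite_measure (M \<Otimes>\<^sub>M (M \<Otimes>\<^sub>M M))" using fin fin2 by (intro finite_measure_pair_measure)
  have sets3: "sets (M \<Otimes>\<^sub>M (M \<Otimes>\<^sub>M M)) = sets borel" unfolding M3 by simp
  have meas: "measure (M \<Otimes>\<^sub>M (M \<Otimes>\<^sub>M M)) (?T -` X) = measure lborel X"
    if [measurable]: "X \<in> sets borel" and X: "X \<subseteq> A' \<union> B' \<union> C" for X
  proof -
    have [measurable]: "?T -` X \<in> sets borel" using measurable_sets[OF T that(1)] by simp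
    have ind: "indicator ({-R..R} \<times> {-R..R} \<times> {-R..R}) p * indicator (?T -` X) p
        = (indicator (?T -` X) p :: ennreal)" for p
    proof (cases "?T p \<in> X")
      case True
      then have "\<bar>?T p $ i\<bar> \<le> R" for i using R X component_le_norm_cart order_trans by blast
      from this[of 1] this[of 2] this[of 3] show ?thesis by (auto simp: indicator_def abs_le_iff split: prod.splits)
    qed simp
    have "emeasure (M \<Otimes>\<^sub>M (M \<Otimes>\<^sub>M M)) (?T -` X) = emeasure lborel (?T -` X)"
      unfolding M3 by (subst emeasure_density) (auto simp: ind intro!: borel_measurable_indicator borel_Times)
    also have "\<dots> = emeasure (distr lborel borel ?T) X" by (subst emeasure_distr) auto
    finally show ?thesis by (simp add: lborel_vector3 measure_def)
  qed
  have "((a + b) ^ 3) powr (1 - l) * ((a + b) ^ 3) powr l \<le> measure lborel C"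
  proof -
    have "measure (M \<Otimes>\<^sub>M (M \<Otimes>\<^sub>M M)) (?T -` A') powr (1 - l) * measure (M \<Otimes>\<^sub>M (M \<Otimes>\<^sub>M M)) (?T -` B') powr l
        \<le> measure (M \<Otimes>\<^sub>M (M \<Otimes>\<^sub>M M)) (?T -` C)"
    proof (rule prekopa_leindler_sets[OF PL3 fin3])
      show "space (M \<Otimes>\<^sub>M (M \<Otimes>\<^sub>M M)) = UNIV" by (simp add: space_pair_measure spM)
      show "?T -` A' \<in> sets (M \<Otimes>\<^sub>M (M \<Otimes>\<^sub>M M))" "?T -` B' \<in> sets (M \<Otimes>\<^sub>M (M \<Otimes>\<^sub>M M))" "?T -` C \<in> sets (M \<Otimes>\<^sub>M (M \<Otimes>\<^sub>M M))"
        unfolding sets3 using measurable_sets[OF T, of A'] measurable_sets[OF T, of B'] measurable_sets[OF T, of C] by simp_all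
    next
      fix x y assume "x \<in> ?T -` A'" "y \<in> ?T -` B'"
      then obtain p q where pq: "p \<in> A" "q \<in> B" "?T x = (1 / (1 - l)) *\<^sub>R p" "?T y = (1 / l) *\<^sub>R q"
        by (auto simp: A'_def B'_def simp del: scaleR_eq_0_iff)
      have "?T ((1 - l) *\<^sub>R x + l *\<^sub>R y) = p + q" unfolding lin pq using l(1,2) by simp
      then show "(1 - l) *\<^sub>R x + l *\<^sub>R y \<in> ?T -` C" using sub pq by simp
    qed (use l in auto)
    moreover have "measure lborel A' = (a + b) ^ 3"
      using l ab measure_scaleR_image3[of A "1 / (1 - l)"] pos by (simp add: A'_def a_def[symmetric] power_divide) (simp add: a_def)
    moreover have "measure lborel B' = (a + b) ^ 3"
      using l ab measure_scaleR_image3[of B "1 / l"] pos by (simp add: B'_def power_divide l_def) (simp add: b_def)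
    ultimately show ?thesis using meas[of A'] meas[of B'] meas[of C] by (simp add: le_supI1)
  qed
  then show ?thesis using ab by (simp add: a_def b_def flip: powr_add)
qed

section \<open>Fluxes of vector fields and the perimeter\<close>

text \<open>Regularity without compact support: the capillary fields constructed later equal
  \<open>\<nu>\<close> far away.\<close>

definition C1_field :: "(real^3 \<Rightarrow> real^3) \<Rightarrow> bool" where
  "C1_field \<phi> \<longleftrightarrow> (\<forall>x. \<phi> differentiable (at x)) \<and>
     (\<forall>v. continuous_on UNIV (\<lambda>x. frechet_derivative \<phi> (at x) v))"

text \<open>The divergence in terms of an explicitly given derivative.\<close>

definition trace_field :: "(real^3 \<Rightarrow> real^3 \<Rightarrow> real^3) \<Rightarrow> real^3 \<Rightarrow> real" where
  "trace_field D x = (\<Sum>i\<in>UNIV. D x (axis i 1) $ i)"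

lemma borel_measurable_vec_nth'[measurable (raw)]:
  fixes f :: "'a \<Rightarrow> real^'n"
  assumes [measurable]: "f \<in> borel_measurable M"
  shows "(\<lambda>x. f x $ i) \<in> borel_measurable M"
proof -
  have "(\<lambda>x. f x \<bullet> axis i 1) \<in> borel_measurable M" by measurable
  then show ?thesis by (simp add: inner_axis)
qed

lemma abs_mult_le_of_le_1:
  fixes a b :: real
  assumes "\<bar>a\<bar> \<le> 1" "\<bar>b\<bar> \<le> B"
  shows "\<bar>a * b\<bar> \<le> B"
  using mult_mono[OF assms] by (simp add: abs_mult)

lemma C1_fieldI:
  assumes "\<And>x. (\<phi> has_derivative D x) (at x)" "\<And>v. continuous_on UNIV (\<lambda>x. D x v)"
  shows "C1_field \<phi>" and "divergence \<phi> = trace_field D"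
proof -
  have "frechet_derivative \<phi> (at x) = D x" for x
    using frechet_derivative_at[OF assms(1)] by simp
  then show "C1_field \<phi>" "divergence \<phi> = trace_field D"
    using assms by (auto simp: C1_field_def divergence_def trace_field_def differentiable_def fun_eq_iff)
qed

lemma C1_fieldE:
  assumes "C1_field \<phi>"
  shows "\<exists>D. (\<forall>x. (\<phi> has_derivative D x) (at x)) \<and> (\<forall>v. continuous_on UNIV (\<lambda>x. D x v))
    \<and> divergence \<phi> = trace_field D"
  using assms by (intro exI[of _ "\<lambda>x. frechet_derivative \<phi> (at x)"])
    (auto simp: C1_field_def frechet_derivative_works divergence_def trace_field_def fun_eq_iff)

lemma C1_compact_support_iff:
  "C1_compact_support \<phi> \<longleftrightarrow> C1_field \<phi> \<and> (\<exists>R. \<forall>x. R < norm x \<longrightarrow> \<phi> x = 0)"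
proof -
  have "compact (closure {x. \<phi> x \<noteq> 0}) \<longleftrightarrow> (\<exists>R. \<forall>x. R < norm x \<longrightarrow> \<phi> x = 0)"
    by (auto simp: bounded_iff not_less) (metis not_less)+
  then show ?thesis by (auto simp: C1_compact_support_def C1_field_def)
qed

lemma C1_field_continuous: "C1_field \<phi> \<Longrightarrow> continuous_on UNIV \<phi>"
  by (auto simp: C1_field_def intro: differentiable_imp_continuous_on differentiable_at_imp_differentiable_on)

lemma C1_field_divergence_continuous: "C1_field \<phi> \<Longrightarrow> continuous_on UNIV (divergence \<phi>)"
  unfolding divergence_def[abs_def] C1_field_def by (intro continuous_intros) auto

lemma divergence_measurable: "C1_field \<phi> \<Longrightarrow> divergence \<phi> \<in> borel_measurable borel"
  using C1_field_divergence_continuous borel_measurable_continuous_onI by blast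

lemma divergence_outside_support:
  assumes "C1_field \<phi>" "\<And>x. R < norm x \<Longrightarrow> \<phi> x = 0" "R < norm x"
  shows "divergence \<phi> x = 0"
proof -
  have "((\<lambda>x. 0) has_derivative (\<lambda>h. 0)) (at x)" by simp
  moreover have "open {x::real^3. R < norm x}" by (intro open_Collect_less continuous_intros)
  ultimately have "(\<phi> has_derivative (\<lambda>h. 0)) (at x)"
    by (rule has_derivative_transform_within_open) (use assms in auto)
  then have "frechet_derivative \<phi> (at x) = (\<lambda>h. 0)" using frechet_derivative_at by metis
  then show ?thesis by (simp add: divergence_def)
qed

lemma C1_compact_support_bounds:
  assumes "C1_compact_support \<phi>"
  obtains R B where "0 < R" "\<And>x. R < norm x \<Longrightarrow> \<phi> x = 0" "\<And>x. R < norm x \<Longrightarrow> divergence \<phi> x = 0"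
    "\<And>x. \<bar>divergence \<phi> x\<bar> \<le> B"
proof -
  obtain R' where R': "\<And>x. R' < norm x \<Longrightarrow> \<phi> x = 0" and \<phi>: "C1_field \<phi>"
    using assms by (auto simp: C1_compact_support_iff)
  define R where "R = max R' 1"
  have R: "0 < R" "\<And>x. R < norm x \<Longrightarrow> \<phi> x = 0" using R' by (auto simp: R_def)
  then have 0: "divergence \<phi> x = 0" if "R < norm x" for x using divergence_outside_support[OF \<phi>] that by blast
  have "compact (divergence \<phi> ` cball 0 R)"
    using C1_field_divergence_continuous[OF \<phi>] by (intro compact_continuous_image) (auto intro: continuous_on_subset)
  then obtain B where "\<And>x. norm x \<le> R \<Longrightarrow> \<bar>divergence \<phi> x\<bar> \<le> B"
    by (force simp: compact_eq_bounded_closed bounded_iff)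
  then have "\<bar>divergence \<phi> x\<bar> \<le> max B 0" for x using 0[of x] by (cases "norm x \<le> R") (auto simp: le_max_iff_disj)
  with R 0 that show thesis by blast
qed

lemma lborel_integrable_indicator_cball:
  "integrable lborel (\<lambda>x. B * indicator (cball c r) (x::'a::euclidean_space) :: real)"
  using emeasure_lborel_cball_finite by (intro integrable_mult_right integrable_real_indicator) auto

lemma divergence_integrable:
  assumes "C1_compact_support \<phi>"
  shows "integrable lborel (divergence \<phi>)"
proof -
  obtain R B where *: "0 < R" "\<And>x. R < norm x \<Longrightarrow> divergence \<phi> x = 0" "\<And>x. \<bar>divergence \<phi> x\<bar> \<le> B"
    using C1_compact_support_bounds[OF assms] by metis
  have [measurable]: "divergence \<phi> \<in> borel_measurable borel"
    using assms by (simp add: divergence_measurable C1_compact_support_iff)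
  have le: "norm (divergence \<phi> x) \<le> norm (B * indicator (cball 0 R) x)" for x
    by (cases "norm x \<le> R") (use *(2)[of x] *(3)[of x] in auto)
  show ?thesis
    by (rule Bochner_Integration.integrable_bound[OF lborel_integrable_indicator_cball[of B 0 R]]) (use le in simp_all)
qed

lemma C1_field_scale:
  fixes \<eta> :: "real^3 \<Rightarrow> real" and g :: "real^3 \<Rightarrow> real^3"
  assumes \<eta>: "\<And>x. (\<eta> has_derivative (\<lambda>h. g x \<bullet> h)) (at x)" "continuous_on UNIV g" and "C1_field \<phi>"
  shows "C1_field (\<lambda>x. \<eta> x *\<^sub>R \<phi> x)"
    and "divergence (\<lambda>x. \<eta> x *\<^sub>R \<phi> x) x = \<eta> x * divergence \<phi> x + g x \<bullet> \<phi> x"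
proof -
  obtain D where D: "\<And>x. (\<phi> has_derivative D x) (at x)" "\<And>v. continuous_on UNIV (\<lambda>x. D x v)"
    "divergence \<phi> = trace_field D" using C1_fieldE[OF assms(3)] by metis
  define D' where "D' x h = \<eta> x *\<^sub>R D x h + (g x \<bullet> h) *\<^sub>R \<phi> x" for x h
  have c: "continuous_on UNIV \<eta>" "continuous_on UNIV \<phi>"
    using has_derivative_continuous_on[of UNIV \<eta> "\<lambda>x h. g x \<bullet> h"] \<eta>(1) C1_field_continuous[OF assms(3)] by auto
  have 1: "((\<lambda>x. \<eta> x *\<^sub>R \<phi> x) has_derivative D' x) (at x)" for x
    unfolding D'_def using \<eta>(1) D(1) by (auto intro!: derivative_eq_intros)
  have 2: "continuous_on UNIV (\<lambda>x. D' x v)" for v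
    unfolding D'_def using c D(2) \<eta>(2) by (intro continuous_intros) auto
  show "C1_field (\<lambda>x. \<eta> x *\<^sub>R \<phi> x)" by (rule C1_fieldI[OF 1 2])
  have "(\<Sum>i\<in>UNIV. (g x \<bullet> axis i 1) * \<phi> x $ i) = g x \<bullet> \<phi> x"
    by (simp add: inner_axis) (simp add: inner_vec_def)
  then show "divergence (\<lambda>x. \<eta> x *\<^sub>R \<phi> x) x = \<eta> x * divergence \<phi> x + g x \<bullet> \<phi> x"
    unfolding C1_fieldI(2)[OF 1 2] D(3) trace_field_def D'_def
    by (simp add: sum.distrib sum_distrib_left)
qed

lemma C1_field_add:
  assumes "C1_field \<phi>" "C1_field \<psi>"
  shows "C1_field (\<lambda>x. \<phi> x + \<psi> x)" "divergence (\<lambda>x. \<phi> x + \<psi> x) x = divergence \<phi> x + divergence \<psi> x"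
proof -
  obtain D where D: "\<And>x. (\<phi> has_derivative D x) (at x)" "\<And>v. continuous_on UNIV (\<lambda>x. D x v)"
    "divergence \<phi> = trace_field D" using C1_fieldE[OF assms(1)] by metis
  obtain E where E: "\<And>x. (\<psi> has_derivative E x) (at x)" "\<And>v. continuous_on UNIV (\<lambda>x. E x v)"
    "divergence \<psi> = trace_field E" using C1_fieldE[OF assms(2)] by metis
  have 1: "((\<lambda>x. \<phi> x + \<psi> x) has_derivative (\<lambda>h. D x h + E x h)) (at x)" for x
    by (intro derivative_intros D(1) E(1))
  have 2: "continuous_on UNIV (\<lambda>x. D x v + E x v)" for v by (intro continuous_intros D(2) E(2))
  show "C1_field (\<lambda>x. \<phi> x + \<psi> x)" by (rule C1_fieldI[OF 1 2])
  show "divergence (\<lambda>x. \<phi> x + \<psi> x) x = divergence \<phi> x + divergence \<psi> x"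
    unfolding C1_fieldI(2)[OF 1 2] D(3) E(3) by (simp add: trace_field_def sum.distrib)
qed

lemma C1_field_affine:
  assumes "C1_field \<phi>"
  shows "C1_field (\<lambda>x. \<phi> (c + t *\<^sub>R x))" "divergence (\<lambda>x. \<phi> (c + t *\<^sub>R x)) x = t * divergence \<phi> (c + t *\<^sub>R x)"
proof -
  obtain D where D: "\<And>x. (\<phi> has_derivative D x) (at x)" "\<And>v. continuous_on UNIV (\<lambda>x. D x v)"
    "divergence \<phi> = trace_field D" using C1_fieldE[OF assms(1)] by metis
  have "((\<lambda>x. \<phi> (c + t *\<^sub>R x)) has_derivative (\<lambda>h. D (c + t *\<^sub>R x) (t *\<^sub>R h))) (at x)" for x
    by (rule has_derivative_compose[of "\<lambda>x. c + t *\<^sub>R x" "\<lambda>h. t *\<^sub>R h", OF _ D(1)]) (auto intro!: derivative_eq_intros)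
  moreover have "D y (t *\<^sub>R h) = t *\<^sub>R D y h" for y h
    using D(1)[of y] by (simp add: has_derivative_def bounded_linear.linear linear_cmul)
  ultimately have 1: "((\<lambda>x. \<phi> (c + t *\<^sub>R x)) has_derivative (\<lambda>h. t *\<^sub>R D (c + t *\<^sub>R x) h)) (at x)" for x by simp
  have 2: "continuous_on UNIV (\<lambda>x. t *\<^sub>R D (c + t *\<^sub>R x) v)" for v
  proof -
    have "continuous_on UNIV (\<lambda>x. c + t *\<^sub>R x)" by (intro continuous_intros)
    then have "continuous_on UNIV (\<lambda>x. D (c + t *\<^sub>R x) v)" by (rule continuous_on_compose2[OF D(2)]) simp
    then show ?thesis by (intro continuous_intros)
  qed
  show "C1_field (\<lambda>x. \<phi> (c + t *\<^sub>R x))" by (rule C1_fieldI[OF 1 2])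
  show "divergence (\<lambda>x. \<phi> (c + t *\<^sub>R x)) x = t * divergence \<phi> (c + t *\<^sub>R x)"
    unfolding C1_fieldI(2)[OF 1 2] D(3) by (simp add: trace_field_def sum_distrib_left)
qed

lemma lborel_integral_affine:
  fixes f :: "'a::euclidean_space \<Rightarrow> real"
  assumes [measurable]: "f \<in> borel_measurable borel" and "t \<noteq> 0"
  shows "(\<integral>x. f x \<partial>lborel) = \<bar>t\<bar> ^ DIM('a) * (\<integral>x. f (c + t *\<^sub>R x) \<partial>lborel)"
  by (subst lborel_affine[OF assms(2), of c]) (simp add: integral_density integral_distr)

lemma lborel_nn_integral_affine:
  fixes f :: "'a::euclidean_space \<Rightarrow> ennreal"
  assumes [measurable]: "f \<in> borel_measurable borel" and "t \<noteq> 0"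
  shows "(\<integral>\<^sup>+x. f x \<partial>lborel) = ennreal (\<bar>t\<bar> ^ DIM('a)) * (\<integral>\<^sup>+x. f (c + t *\<^sub>R x) \<partial>lborel)"
  by (subst lborel_affine[OF assms(2), of c]) (simp add: nn_integral_density nn_integral_distr nn_integral_cmult)

text \<open>By the divergence theorem this is the outward flux through a smooth boundary. For a
  Borel set it is the functional whose supremum over test fields is the perimeter.\<close>

definition flux :: "(real^3) set \<Rightarrow> (real^3 \<Rightarrow> real^3) \<Rightarrow> real" where
  "flux \<Omega> \<phi> = (\<integral>x. indicator \<Omega> x * divergence \<phi> x \<partial>lborel)"

lemma perimeter_le_iff:
  assumes [measurable]: "\<Omega> \<in> sets borel" and "0 \<le> p"
  shows "perimeter \<Omega> \<le> ennreal p \<longleftrightarrow>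
    (\<forall>\<phi>. C1_compact_support \<phi> \<longrightarrow> (\<forall>x. norm (\<phi> x) \<le> 1) \<longrightarrow> flux \<Omega> \<phi> \<le> p)"
proof -
  have "(LINT x:\<Omega>|lebesgue. divergence \<phi> x) = flux \<Omega> \<phi>" if "C1_compact_support \<phi>" for \<phi>
  proof -
    have [measurable]: "divergence \<phi> \<in> borel_measurable borel"
      using that by (simp add: divergence_measurable C1_compact_support_iff)
    show ?thesis unfolding set_lebesgue_integral_def flux_def by (simp add: integral_completion)
  qed
  then show ?thesis using assms(2) by (auto simp: perimeter_def SUP_le_iff)
qed

lemma perimeter_le:
  assumes "\<Omega> \<in> sets borel" "0 \<le> p"
    and "\<And>\<phi>. C1_compact_support \<phi> \<Longrightarrow> (\<And>x. norm (\<phi> x) \<le> 1) \<Longrightarrow> flux \<Omega> \<phi> \<le> p"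
  shows "perimeter \<Omega> \<le> ennreal p"
  using assms by (simp add: perimeter_le_iff)

lemma flux_le:
  assumes "perimeter \<Omega> \<le> ennreal p" "\<Omega> \<in> sets borel" "0 \<le> p" "C1_compact_support \<phi>" "\<And>x. norm (\<phi> x) \<le> 1"
  shows "flux \<Omega> \<phi> \<le> p"
  using assms perimeter_le_iff by blast

lemma flux_integrable:
  assumes "C1_compact_support \<phi>" "\<Omega> \<in> sets borel"
  shows "integrable lborel (\<lambda>x. indicator \<Omega> x * divergence \<phi> x)"
  using integrable_real_mult_indicator[of \<Omega> lborel "divergence \<phi>"] divergence_integrable[OF assms(1)] assms(2)
  by (simp add: mult.commute)

text \<open>Composing a test field with the dilation multiplies its divergence by \<open>t\<close>,
  while the change of variables contributes \<open>t ^ 3\<close>; the quotient is the factor of the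
  perimeter.\<close>

lemma perimeter_affine:
  fixes t :: real
  assumes \<Omega>[measurable]: "\<Omega> \<in> sets borel" "\<Omega>' \<in> sets borel" and "0 \<le> p" "perimeter \<Omega> \<le> ennreal p" and t: "0 < t"
    and eq: "\<And>x. c + t *\<^sub>R x \<in> \<Omega>' \<longleftrightarrow> x \<in> \<Omega>"
  shows "perimeter \<Omega>' \<le> ennreal (t\<^sup>2 * p)"
proof (rule perimeter_le)
  fix \<phi> assume \<phi>: "C1_compact_support \<phi>" "\<And>x. norm (\<phi> x) \<le> 1"
  let ?\<psi> = "\<lambda>x. \<phi> (c + t *\<^sub>R x)"
  obtain R B where "0 < R" "\<And>x. R < norm x \<Longrightarrow> \<phi> x = 0" using C1_compact_support_bounds[OF \<phi>(1)] by metis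
  have \<psi>: "C1_compact_support ?\<psi>"
  proof -
    have "\<phi> (c + t *\<^sub>R x) = 0" if "(R + norm c) / t < norm x" for x
    proof -
      have "R + norm c < t * norm x" using that t by (simp add: pos_divide_less_eq mult.commute)
      also have "t * norm x \<le> norm (c + t *\<^sub>R x) + norm c"
        using norm_triangle_ineq4[of "c + t *\<^sub>R x" c] t by simp
      finally show ?thesis using \<open>\<And>x. R < norm x \<Longrightarrow> \<phi> x = 0\<close> by simp
    qed
    then show ?thesis using \<phi>(1) C1_field_affine(1) by (auto simp: C1_compact_support_iff)
  qed
  have [measurable]: "divergence \<phi> \<in> borel_measurable borel"
    using \<phi> by (simp add: divergence_measurable C1_compact_support_iff)
  have "flux \<Omega>' \<phi> = t ^ 3 * (\<integral>x. indicator \<Omega>' (c + t *\<^sub>R x) * divergence \<phi> (c + t *\<^sub>R x) \<partial>lborel)"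
    unfolding flux_def using t by (subst lborel_integral_affine[where t=t and c=c]) auto
  also have "\<dots> = t\<^sup>2 * (\<integral>x. t * (indicator \<Omega> x * divergence \<phi> (c + t *\<^sub>R x)) \<partial>lborel)"
    by (simp add: indicator_def eq power2_eq_square power3_eq_cube)
  also have "\<dots> = t\<^sup>2 * flux \<Omega> ?\<psi>"
    using \<phi> C1_field_affine(2)[of \<phi> c t] by (simp add: flux_def C1_compact_support_iff mult.left_commute)
  also have "\<dots> \<le> t\<^sup>2 * p"
    using \<psi> \<phi>(2) assms by (intro mult_left_mono flux_le[of \<Omega>]) auto
  finally show "flux \<Omega>' \<phi> \<le> t\<^sup>2 * p" .
qed (use assms in auto)

lemma flux_Un:
  assumes "A \<in> sets borel" "B \<in> sets borel" "A \<inter> B = {}" "C1_compact_support \<phi>"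
  shows "flux (A \<union> B) \<phi> = flux A \<phi> + flux B \<phi>"
proof -
  have "flux (A \<union> B) \<phi> = (\<integral>x. indicator A x * divergence \<phi> x + indicator B x * divergence \<phi> x \<partial>lborel)"
    unfolding flux_def using assms(3) by (intro Bochner_Integration.integral_cong) (auto simp: indicator_def)
  then show ?thesis using assms by (simp add: flux_integrable flux_def)
qed

lemma perimeter_Un:
  assumes "A \<in> sets borel" "B \<in> sets borel" "A \<inter> B = {}" "0 \<le> p" "0 \<le> q"
    and "perimeter A \<le> ennreal p" "perimeter B \<le> ennreal q"
  shows "perimeter (A \<union> B) \<le> ennreal (p + q)"
  using assms by (intro perimeter_le) (auto simp: flux_Un intro!: add_mono flux_le)

text \<open>Translation invariance makes the integral of every difference quotient vanish, and the
  mean value theorem provides the dominating function for the passage to the limit.\<close>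

lemma integral_divergence_eq_0:
  assumes "C1_compact_support \<phi>"
  shows "(\<integral>x. divergence \<phi> x \<partial>lborel) = 0"
proof -
  have \<phi>: "C1_field \<phi>" using assms by (simp add: C1_compact_support_iff)
  obtain D where D: "\<And>x. (\<phi> has_derivative D x) (at x)" "\<And>v. continuous_on UNIV (\<lambda>x. D x v)"
    "divergence \<phi> = trace_field D" using C1_fieldE[OF \<phi>] by metis
  obtain R where R: "0 < R" "\<And>x. R < norm x \<Longrightarrow> \<phi> x = 0" using C1_compact_support_bounds[OF assms] by metis
  have [measurable]: "\<phi> \<in> borel_measurable borel"
    using C1_field_continuous[OF \<phi>] by (rule borel_measurable_continuous_onI)
  have Dm[measurable]: "(\<lambda>x. D x v) \<in> borel_measurable borel" for v
    using D(2) by (rule borel_measurable_continuous_onI)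
  have bdd: "\<exists>B. \<forall>x\<in>cball 0 r. norm (f x) \<le> B" if "continuous_on UNIV f" for f :: "real^3 \<Rightarrow> real^3" and r
  proof -
    have "compact (f ` cball 0 r)" using that by (intro compact_continuous_image) (auto intro: continuous_on_subset)
    then show ?thesis by (auto simp: compact_eq_bounded_closed bounded_iff)
  qed
  have comp: "integrable lborel (\<lambda>x. D x v $ i) \<and> (\<integral>x. D x v $ i \<partial>lborel) = 0" if v: "norm v = 1" for v i
  proof -
    \<comment> \<open>A base point within \<open>R + 1\<close> is moved by less than 1, so
      \<open>R + 2\<close> covers all intermediate points.\<close>
    obtain B where B: "\<And>x. norm x \<le> R + 2 \<Longrightarrow> norm (D x v) \<le> B"
      using bdd[OF D(2), of "R + 2" v] by (metis mem_cball_0)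
    obtain C where C: "\<And>x. norm x \<le> R \<Longrightarrow> norm (\<phi> x) \<le> C"
      using bdd[OF C1_field_continuous[OF \<phi>], of R] by (metis mem_cball_0)
    define h where "h n = 1 / real (Suc n)" for n
    have h: "0 < h n" "h n \<le> 1" for n by (auto simp: h_def)
    have h0: "h \<longlonglongrightarrow> 0" using LIMSEQ_inverse_real_of_nat by (simp add: h_def[abs_def] inverse_eq_divide)
    let ?q = "\<lambda>n x. (\<phi> (x + h n *\<^sub>R v) $ i - \<phi> x $ i) / h n"
    have der: "((\<lambda>t. \<phi> (x + t *\<^sub>R v) $ i) has_real_derivative D (x + s *\<^sub>R v) v $ i) (at s)" for x s
    proof -
      have "((\<lambda>t. \<phi> (x + t *\<^sub>R v)) has_derivative (\<lambda>t. D (x + s *\<^sub>R v) (t *\<^sub>R v))) (at s)"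
        by (rule has_derivative_compose[of "\<lambda>t. x + t *\<^sub>R v" "\<lambda>t. t *\<^sub>R v", OF _ D(1)]) (auto intro!: derivative_eq_intros)
      then have "((\<lambda>t. \<phi> (x + t *\<^sub>R v) $ i) has_derivative (\<lambda>t. D (x + s *\<^sub>R v) (t *\<^sub>R v) $ i)) (at s)"
        by (rule bounded_linear.has_derivative[OF bounded_linear_vec_nth])
      moreover have "D (x + s *\<^sub>R v) (t *\<^sub>R v) $ i = t * (D (x + s *\<^sub>R v) v $ i)" for t
        using D(1)[of "x + s *\<^sub>R v"] by (simp add: has_derivative_def bounded_linear.linear linear_cmul)
      ultimately show ?thesis
        by (simp add: has_field_derivative_def mult.commute[of _ "D (x + s *\<^sub>R v) v $ i"])
    qed
    have lim: "(\<lambda>n. ?q n x) \<longlonglongrightarrow> D x v $ i" for x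
    proof -
      have "((\<lambda>t. (\<phi> (x + t *\<^sub>R v) $ i - \<phi> x $ i) / t) \<longlongrightarrow> D x v $ i) (at 0)"
        using der[of x 0] by (simp add: DERIV_def)
      moreover have "filterlim h (at 0) sequentially"
        unfolding filterlim_at using h(1) h0 by (auto simp: less_imp_neq[symmetric])
      ultimately show ?thesis by (rule filterlim_compose)
    qed
    have bnd: "norm (?q n x) \<le> B * indicator (cball 0 (R + 1)) x" for n x
    proof (cases "norm x \<le> R + 1")
      case True
      obtain z where z: "0 < z" "z < h n" "\<phi> (x + h n *\<^sub>R v) $ i - \<phi> (x + 0 *\<^sub>R v) $ i = (h n - 0) * (D (x + z *\<^sub>R v) v $ i)"
        using MVT2[of 0 "h n" "\<lambda>t. \<phi> (x + t *\<^sub>R v) $ i" "\<lambda>s. D (x + s *\<^sub>R v) v $ i"] der h by blast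
      have "norm (x + z *\<^sub>R v) \<le> R + 2" using norm_triangle_ineq[of x "z *\<^sub>R v"] True z h[of n] v by simp
      then have "\<bar>D (x + z *\<^sub>R v) v $ i\<bar> \<le> B" using B component_le_norm_cart order_trans by blast
      moreover have "?q n x = D (x + z *\<^sub>R v) v $ i" using z h[of n] by simp
      ultimately show ?thesis using True by simp
    next
      case False
      have "norm x \<le> norm (x + h n *\<^sub>R v) + h n" using norm_triangle_ineq4[of "x + h n *\<^sub>R v" "h n *\<^sub>R v"] v h[of n] by simp
      then show ?thesis using False R h[of n] by simp
    qed
    have Int: "integrable lborel (\<lambda>x. B * indicator (cball (0::real^3) (R + 1)) x)"
      by (rule lborel_integrable_indicator_cball)
    have i\<phi>: "integrable lborel (\<lambda>x. \<phi> (x + s *\<^sub>R v) $ i)" if s: "0 \<le> s" "s \<le> 1" for s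
    proof (rule Bochner_Integration.integrable_bound)
      show "integrable lborel (\<lambda>x. C * indicator (cball (0::real^3) (R + 1)) x)" by (rule lborel_integrable_indicator_cball)
      have "norm (\<phi> (x + s *\<^sub>R v) $ i) \<le> norm (C * indicator (cball (0::real^3) (R + 1)) x)" for x
      proof (cases "norm (x + s *\<^sub>R v) \<le> R")
        case True
        then have "norm x \<le> R + 1" using norm_triangle_ineq4[of "x + s *\<^sub>R v" "s *\<^sub>R v"] v s by simp
        moreover have "\<bar>\<phi> (x + s *\<^sub>R v) $ i\<bar> \<le> \<bar>C\<bar>"
          by (rule order_trans[OF order_trans[OF component_le_norm_cart C[OF True]] abs_ge_self])
        ultimately show ?thesis by simp
      qed (use R in simp)
      then show "AE x in lborel. norm (\<phi> (x + s *\<^sub>R v) $ i) \<le> norm (C * indicator (cball (0::real^3) (R + 1)) x)" by simp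
      have "continuous_on UNIV (\<lambda>x. x + s *\<^sub>R v)" by (intro continuous_intros)
      then have "continuous_on UNIV (\<lambda>x. \<phi> (x + s *\<^sub>R v))" by (rule continuous_on_compose2[OF C1_field_continuous[OF \<phi>]]) simp
      then show "(\<lambda>x. \<phi> (x + s *\<^sub>R v) $ i) \<in> borel_measurable lborel"
        by (auto intro!: borel_measurable_continuous_onI continuous_intros)
    qed
    have zero: "(\<integral>x. ?q n x \<partial>lborel) = 0" for n
    proof -
      have "(\<integral>x. \<phi> x $ i \<partial>lborel) = (\<integral>x. \<phi> (h n *\<^sub>R v + 1 *\<^sub>R x) $ i \<partial>lborel)"
        by (subst lborel_integral_affine[where t=1 and c="h n *\<^sub>R v"]) auto
      then show ?thesis using i\<phi>[of "h n"] i\<phi>[of 0] h[of n] by (simp add: add.commute)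
    qed
    have "(\<lambda>n. (\<integral>x. ?q n x \<partial>lborel)) \<longlonglongrightarrow> (\<integral>x. D x v $ i \<partial>lborel)"
      by (rule integral_dominated_convergence[OF _ _ Int]) (use lim bnd in auto)
    moreover have "integrable lborel (\<lambda>x. D x v $ i)"
      by (rule integrable_dominated_convergence[OF _ _ Int, of _ ?q]) (use lim bnd in auto)
    moreover have "(\<lambda>n. (\<integral>x. ?q n x \<partial>lborel)) \<longlonglongrightarrow> 0" unfolding zero by simp
    ultimately show ?thesis using LIMSEQ_unique by blast
  qed
  show ?thesis unfolding D(3) trace_field_def using comp[OF norm_axis_1] by (simp add: Bochner_Integration.integral_sum)
qed

section \<open>Test fields without compact support\<close>

definition bounded_divergence :: "(real^3 \<Rightarrow> real^3) \<Rightarrow> bool" where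
  "bounded_divergence \<phi> \<longleftrightarrow> C1_field \<phi> \<and> (\<exists>B. \<forall>x. \<bar>divergence \<phi> x\<bar> \<le> B)"

lemma C1_compact_support_bounded_divergence: "C1_compact_support \<phi> \<Longrightarrow> bounded_divergence \<phi>"
  unfolding bounded_divergence_def using C1_compact_support_bounds C1_compact_support_iff by metis

lemma bounded_divergence_integrable:
  fixes \<eta> :: "real^3 \<Rightarrow> real"
  assumes "bounded_divergence \<phi>" and [measurable]: "\<Omega> \<in> sets borel" "\<eta> \<in> borel_measurable borel"
    and "emeasure lborel \<Omega> < \<infinity>" and \<eta>: "\<And>x. \<bar>\<eta> x\<bar> \<le> 1"
  shows "integrable lborel (\<lambda>x. indicator \<Omega> x * (\<eta> x * divergence \<phi> x))"
proof -
  obtain B where B: "\<And>x. \<bar>divergence \<phi> x\<bar> \<le> B" using assms(1) by (auto simp: bounded_divergence_def)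
  have [measurable]: "divergence \<phi> \<in> borel_measurable borel"
    using assms(1) by (simp add: bounded_divergence_def divergence_measurable)
  have le: "\<bar>indicator \<Omega> x * (\<eta> x * divergence \<phi> x)\<bar> \<le> \<bar>B * indicator \<Omega> x\<bar>" for x
    using mult_mono[OF \<eta>[of x] B[of x]] order_trans[OF abs_ge_zero B[of x]]
    by (simp add: indicator_def abs_mult)
  have "integrable lborel (\<lambda>x. B * indicator \<Omega> x)"
    using assms(4) by (intro integrable_mult_right integrable_real_indicator) auto
  then show ?thesis
    by (rule Bochner_Integration.integrable_bound) (use le in simp_all)
qed

text \<open>Serves both as a cutoff and, rescaled, as a mollifier. The third power makes it twice
  continuously differentiable across the unit sphere, which gives a global quadratic Taylor
  estimate.\<close>

definition bump :: "real^3 \<Rightarrow> real" where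
  "bump z = (max 0 (1 - z \<bullet> z)) ^ 3"

definition grad_bump :: "real^3 \<Rightarrow> real^3" where
  "grad_bump z = (- 6 * (max 0 (1 - z \<bullet> z))\<^sup>2) *\<^sub>R z"

lemma bump_nonneg: "0 \<le> bump z" and bump_le_1: "bump z \<le> 1"
  by (auto simp: bump_def intro!: power_le_one)

lemma bump_outside: "1 \<le> norm z \<Longrightarrow> bump z = 0" "1 \<le> norm z \<Longrightarrow> grad_bump z = 0"
proof -
  have "z \<bullet> z = norm z ^ 2" by (simp add: power2_norm_eq_inner)
  then show "1 \<le> norm z \<Longrightarrow> bump z = 0" "1 \<le> norm z \<Longrightarrow> grad_bump z = 0"
    using one_le_power[of "norm z" 2] by (simp_all add: bump_def grad_bump_def)
qed

lemma norm_grad_bump: "norm (grad_bump z) \<le> 6"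
proof (cases "norm z \<le> 1")
  case True
  have "norm (grad_bump z) = 6 * ((max 0 (1 - z \<bullet> z))\<^sup>2 * norm z)" by (simp add: grad_bump_def)
  also have "\<dots> \<le> 6 * (1 * 1)" using True by (intro mult_left_mono mult_mono power_le_one) auto
  finally show ?thesis by simp
qed (simp add: bump_outside)

text \<open>The function \<open>(max 0 s) ^ 3\<close> has second derivative
  \<open>6 * max 0 s\<close>, at most 6 for \<open>s \<le> 1\<close>; half of this is the constant
  3.\<close>

lemma cube_pos_part_Taylor:
  fixes s k :: real
  assumes "s \<le> 1" "s + k \<le> 1"
  shows "\<bar>(max 0 (s + k)) ^ 3 - (max 0 s) ^ 3 - 3 * (max 0 s)\<^sup>2 * k\<bar> \<le> 3 * k\<^sup>2"
proof -
  consider "0 \<le> s" "0 \<le> s + k" | "0 \<le> s" "s + k < 0" | "s < 0" "0 \<le> s + k" | "s < 0" "s + k < 0" by linarith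
  then show ?thesis
  proof cases
    case 1
    then have "(max 0 (s + k)) ^ 3 - (max 0 s) ^ 3 - 3 * (max 0 s)\<^sup>2 * k = k\<^sup>2 * (2 * s + (s + k))"
      by (simp add: power2_eq_square power3_eq_cube algebra_simps)
    moreover have "\<bar>2 * s + (s + k)\<bar> \<le> 3" using 1 assms by simp
    ultimately show ?thesis using mult_left_mono[of "\<bar>2 * s + (s + k)\<bar>" 3 "k\<^sup>2"] by (simp add: abs_mult mult.commute)
  next
    case 2
    define j where "j = - k - s"
    have j: "0 < j" "k = - s - j" using 2 by (auto simp: j_def)
    have "(max 0 (s + k)) ^ 3 - (max 0 s) ^ 3 - 3 * (max 0 s)\<^sup>2 * k = s * (2 * s\<^sup>2 + 3 * (s * j))"
      using 2 by (simp add: j power2_eq_square power3_eq_cube algebra_simps)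
    moreover have "0 \<le> s * (2 * s\<^sup>2 + 3 * (s * j))" using 2 j by simp
    moreover have "s * (2 * s\<^sup>2 + 3 * (s * j)) \<le> 1 * (2 * s\<^sup>2 + 3 * (s * j))" using 2 j assms by (intro mult_right_mono) auto
    moreover have "2 * s\<^sup>2 + 3 * (s * j) \<le> 3 * k\<^sup>2"
    proof -
      have "3 * k\<^sup>2 = 3 * s\<^sup>2 + 6 * (s * j) + 3 * j\<^sup>2" by (simp add: j power2_eq_square algebra_simps)
      moreover have "0 \<le> s\<^sup>2" "0 \<le> s * j" "0 \<le> j\<^sup>2" using 2 j by auto
      ultimately show ?thesis by linarith
    qed
    ultimately show ?thesis by simp
  next
    case 3
    have "(s + k) * (s + k) \<le> k * k" using 3 by (intro mult_mono) auto
    then have "(s + k) * ((s + k) * (s + k)) \<le> 1 * (k * k)" using 3 assms by (intro mult_mono) auto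
    moreover have "0 \<le> (s + k) * ((s + k) * (s + k))" "0 \<le> k * k" using 3 by simp_all
    ultimately have "(s + k) * ((s + k) * (s + k)) \<le> 3 * (k * k)" by linarith
    then show ?thesis using 3 by (simp add: power2_eq_square power3_eq_cube mult.assoc)
  next
    case 4
    then show ?thesis by simp
  qed
qed

text \<open>If both \<open>norm h \<le> 1\<close> and \<open>norm z \<le> 2\<close>, the argument
  \<open>1 - z \<bullet> z\<close> changes by at most \<open>5 * norm h\<close>, and 78 is 3 * 5^2 +
  3, the last 3 coming from the term \<open>h \<bullet> h\<close> in that change. For large
  \<open>h\<close> the values in [0, 1] and the gradient bound 6 suffice; for large \<open>z\<close>
  all terms vanish.\<close>

lemma bump_Taylor: "\<bar>bump (z + h) - bump z - grad_bump z \<bullet> h\<bar> \<le> 78 * (norm h)\<^sup>2"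
proof (cases "norm h \<le> 1")
  case False
  then have h: "1 \<le> norm h" by simp
  have "\<bar>grad_bump z \<bullet> h\<bar> \<le> 6 * norm h"
    using Cauchy_Schwarz_ineq2[of "grad_bump z" h] mult_right_mono[OF norm_grad_bump[of z], of "norm h"] by simp
  also have "\<dots> \<le> 6 * (norm h)\<^sup>2" using mult_right_mono[OF h, of "norm h"] by (simp add: power2_eq_square)
  finally have "\<bar>bump (z + h) - bump z - grad_bump z \<bullet> h\<bar> \<le> 1 + 6 * (norm h)\<^sup>2"
    using bump_nonneg[of z] bump_le_1[of z] bump_nonneg[of "z + h"] bump_le_1[of "z + h"] by linarith
  also have "1 \<le> (norm h)\<^sup>2" using h by simp
  finally show ?thesis by simp
next
  case True
  show ?thesis
  proof (cases "norm z \<le> 2")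
    case False
    then have "1 \<le> norm (z + h)" "1 \<le> norm z" using True norm_triangle_ineq4[of "z + h" h] by auto
    then show ?thesis by (simp add: bump_outside)
  next
    case z: True
    define s k where "s = 1 - z \<bullet> z" and "k = - (2 * (z \<bullet> h) + h \<bullet> h)"
    have sk: "s + k = 1 - (z + h) \<bullet> (z + h)" by (simp add: s_def k_def inner_commute algebra_simps)
    have T: "\<bar>(max 0 (s + k)) ^ 3 - (max 0 s) ^ 3 - 3 * (max 0 s)\<^sup>2 * k\<bar> \<le> 3 * k\<^sup>2"
      by (rule cube_pos_part_Taylor) (simp_all only: sk, simp_all add: s_def)
    have eq: "bump (z + h) - bump z - grad_bump z \<bullet> h
        = ((max 0 (s + k)) ^ 3 - (max 0 s) ^ 3 - 3 * (max 0 s)\<^sup>2 * k) - 3 * (max 0 s)\<^sup>2 * (h \<bullet> h)"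
      unfolding bump_def grad_bump_def sk[symmetric] s_def[symmetric] by (simp add: k_def algebra_simps)
    have "\<bar>z \<bullet> h\<bar> \<le> 2 * norm h" using Cauchy_Schwarz_ineq2[of z h] mult_right_mono[OF z, of "norm h"] by simp
    moreover have "h \<bullet> h \<le> norm h" using True by (simp add: power2_norm_eq_inner[symmetric] power2_eq_square mult_left_le_one_le)
    ultimately have "\<bar>k\<bar> \<le> 5 * norm h" using inner_ge_zero[of h] unfolding k_def by linarith
    then have "k\<^sup>2 \<le> (5 * norm h)\<^sup>2" by (metis abs_ge_zero power2_abs power_mono)
    moreover have "3 * (max 0 s)\<^sup>2 * (h \<bullet> h) \<le> 3 * 1 * (h \<bullet> h)"
      by (intro mult_right_mono mult_left_mono power_le_one) (auto simp: s_def)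
    moreover have "0 \<le> 3 * (max 0 s)\<^sup>2 * (h \<bullet> h)" by simp
    ultimately have "\<bar>bump (z + h) - bump z - grad_bump z \<bullet> h\<bar> \<le> 3 * (5 * norm h)\<^sup>2 + 3 * (h \<bullet> h)"
      using T unfolding eq by linarith
    then show ?thesis by (simp add: power2_norm_eq_inner power_mult_distrib)
  qed
qed

lemma has_derivative_quadratic_error:
  fixes f :: "'a::real_normed_vector \<Rightarrow> 'b::real_normed_vector"
  assumes "bounded_linear D" "\<And>h. norm (f (x + h) - f x - D h) \<le> C * (norm h)\<^sup>2"
  shows "(f has_derivative D) (at x)"
  unfolding has_derivative_at
proof (intro conjI assms(1))
  show "(\<lambda>h. norm (f (x + h) - f x - D h) / norm h) \<midarrow>0\<rightarrow> 0"
  proof (rule Lim_null_comparison)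
    have "norm (norm (f (x + h) - f x - D h) / norm h) \<le> C * norm h" for h
      using assms(2)[of h] by (cases "h = 0") (simp_all add: pos_divide_le_eq power2_eq_square mult.assoc)
    then show "\<forall>\<^sub>F h in at 0. norm (norm (f (x + h) - f x - D h) / norm h) \<le> C * norm h" by simp
    show "((\<lambda>h::'a. C * norm h) \<longlongrightarrow> 0) (at 0)" by (rule tendsto_eq_intros refl)+ simp
  qed
qed

lemma bump_scaled:
  assumes "0 < r"
  shows "((\<lambda>x. bump (x /\<^sub>R r)) has_derivative (\<lambda>h. (grad_bump (x /\<^sub>R r) /\<^sub>R r) \<bullet> h)) (at x)"
    and "continuous_on UNIV (\<lambda>x. grad_bump (x /\<^sub>R r) /\<^sub>R r)"
proof -
  have "(bump has_derivative (\<lambda>h. grad_bump (x /\<^sub>R r) \<bullet> h)) (at (x /\<^sub>R r))"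
    using bump_Taylor by (intro has_derivative_quadratic_error[where C=78] bounded_linear_inner_right) simp
  then have "((\<lambda>x. bump (x /\<^sub>R r)) has_derivative (\<lambda>h. grad_bump (x /\<^sub>R r) \<bullet> (h /\<^sub>R r))) (at x)"
    by (rule has_derivative_compose[of "\<lambda>x. x /\<^sub>R r" "\<lambda>h. h /\<^sub>R r", rotated]) (auto intro!: derivative_eq_intros)
  then show "((\<lambda>x. bump (x /\<^sub>R r)) has_derivative (\<lambda>h. (grad_bump (x /\<^sub>R r) /\<^sub>R r) \<bullet> h)) (at x)" by simp
  show "continuous_on UNIV (\<lambda>x. grad_bump (x /\<^sub>R r) /\<^sub>R r)"
    unfolding grad_bump_def using assms by (intro continuous_intros) auto
qed

text \<open>Cutoffs at radius \<open>n + 1\<close> have gradients of order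
  \<open>1 / (n + 1)\<close>. On a set of finite volume these disappear in the limit, and a bounded
  divergence gives the dominating function.\<close>

lemma flux_le_bounded_divergence:
  assumes P: "0 \<le> P" "perimeter \<Omega> \<le> ennreal P" and \<Omega>[measurable]: "\<Omega> \<in> sets borel" and fin: "emeasure lborel \<Omega> < \<infinity>"
    and \<phi>: "bounded_divergence \<phi>" "\<And>x. norm (\<phi> x) \<le> 1"
  shows "flux \<Omega> \<phi> \<le> P"
proof -
  have C1: "C1_field \<phi>" using \<phi>(1) by (simp add: bounded_divergence_def)
  have [measurable]: "divergence \<phi> \<in> borel_measurable borel" "\<phi> \<in> borel_measurable borel"
    using divergence_measurable[OF C1] C1 by (auto intro!: borel_measurable_continuous_onI C1_field_continuous)
  obtain B where B: "\<And>x. \<bar>divergence \<phi> x\<bar> \<le> B" using \<phi>(1) by (auto simp: bounded_divergence_def)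
  let ?r = "\<lambda>n. real (Suc n)"
  let ?F = "\<lambda>n x. bump (x /\<^sub>R ?r n) *\<^sub>R \<phi> x"
  have F: "C1_field (?F n)"
    "divergence (?F n) x = bump (x /\<^sub>R ?r n) * divergence \<phi> x + (grad_bump (x /\<^sub>R ?r n) /\<^sub>R ?r n) \<bullet> \<phi> x" for n x
    using C1_field_scale[OF bump_scaled C1, of "?r n"] by simp_all
  have F2: "C1_compact_support (?F n)" for n
    unfolding C1_compact_support_iff using F(1)
    by (auto intro!: exI[of _ "?r n"] bump_outside(1) simp del: of_nat_Suc simp: field_simps)
  have F1: "norm (?F n x) \<le> 1" for n x
    using \<phi>(2)[of x] bump_nonneg[of "x /\<^sub>R ?r n"] bump_le_1[of "x /\<^sub>R ?r n"] by (simp add: mult_le_one)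
  have le: "flux \<Omega> (?F n) \<le> P" for n using F1 F2 P by (intro flux_le) auto
  let ?f = "\<lambda>n x. indicator \<Omega> x * (bump (x /\<^sub>R ?r n) * divergence \<phi> x + (grad_bump (x /\<^sub>R ?r n) /\<^sub>R ?r n) \<bullet> \<phi> x)"
  have [measurable]: "bump \<in> borel_measurable borel" "grad_bump \<in> borel_measurable borel"
    unfolding bump_def[abs_def] grad_bump_def[abs_def] by measurable
  have "(\<lambda>n. \<integral>x. ?f n x \<partial>lborel) \<longlonglongrightarrow> (\<integral>x. indicator \<Omega> x * divergence \<phi> x \<partial>lborel)"
  proof (rule integral_dominated_convergence[where w="\<lambda>x. (B + 6) * indicator \<Omega> x"])
    show "integrable lborel (\<lambda>x. (B + 6) * indicator \<Omega> x)"
      using fin by (intro integrable_mult_right integrable_real_indicator) auto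
    have inv: "(\<lambda>n. inverse (?r n)) \<longlonglongrightarrow> 0" by (rule LIMSEQ_inverse_real_of_nat)
    have small: "\<bar>(grad_bump y /\<^sub>R ?r n) \<bullet> \<phi> x\<bar> \<le> 6 * inverse (?r n)" for n x y
    proof -
      have "\<bar>grad_bump y \<bullet> \<phi> x\<bar> \<le> 6 * 1"
        by (rule order_trans[OF Cauchy_Schwarz_ineq2 mult_mono]) (use norm_grad_bump \<phi>(2) in auto)
      then show ?thesis by (simp add: abs_mult mult_left_mono mult.commute)
    qed
    have "(\<lambda>n. ?f n x) \<longlonglongrightarrow> indicator \<Omega> x * divergence \<phi> x" for x
    proof -
      have "(\<lambda>n. bump (x /\<^sub>R ?r n)) \<longlonglongrightarrow> (max 0 (1 - (0 *\<^sub>R x) \<bullet> (0 *\<^sub>R x))) ^ 3"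
        unfolding bump_def by (intro tendsto_intros inv)
      moreover have "(\<lambda>n. (grad_bump (x /\<^sub>R ?r n) /\<^sub>R ?r n) \<bullet> \<phi> x) \<longlonglongrightarrow> 0"
      proof (rule Lim_null_comparison)
        show "\<forall>\<^sub>F n in sequentially. norm ((grad_bump (x /\<^sub>R ?r n) /\<^sub>R ?r n) \<bullet> \<phi> x) \<le> 6 * inverse (?r n)"
          using small by simp
        show "(\<lambda>n. 6 * inverse (?r n)) \<longlonglongrightarrow> 0" by (rule tendsto_eq_intros inv refl)+ simp
      qed
      ultimately have "(\<lambda>n. ?f n x) \<longlonglongrightarrow> indicator \<Omega> x * ((max 0 (1 - (0 *\<^sub>R x) \<bullet> (0 *\<^sub>R x))) ^ 3 * divergence \<phi> x + 0)"
        by (intro tendsto_intros)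
      then show ?thesis by simp
    qed
    then show "AE x in lborel. (\<lambda>n. ?f n x) \<longlonglongrightarrow> indicator \<Omega> x * divergence \<phi> x" by simp
    have "\<bar>?f n x\<bar> \<le> (B + 6) * indicator \<Omega> x" for n x
    proof -
      have "\<bar>bump (x /\<^sub>R ?r n) * divergence \<phi> x\<bar> \<le> 1 * B"
        unfolding abs_mult using bump_nonneg[of "x /\<^sub>R ?r n"] bump_le_1[of "x /\<^sub>R ?r n"] B by (intro mult_mono) auto
      moreover have "6 * inverse (?r n) \<le> 6" by (simp add: field_simps)
      ultimately have "\<bar>bump (x /\<^sub>R ?r n) * divergence \<phi> x + (grad_bump (x /\<^sub>R ?r n) /\<^sub>R ?r n) \<bullet> \<phi> x\<bar> \<le> B + 6"
        using small[where y="x /\<^sub>R ?r n" and n=n and x=x] by linarith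
      then show ?thesis by (simp add: indicator_def)
    qed
    then show "AE x in lborel. norm (?f n x) \<le> (B + 6) * indicator \<Omega> x" for n by simp
  qed measurable
  then have "(\<lambda>n. flux \<Omega> (?F n)) \<longlonglongrightarrow> flux \<Omega> \<phi>" unfolding flux_def F(2) .
  then show ?thesis by (rule LIMSEQ_le_const2) (use le in auto)
qed

section \<open>Gluing two fields across a plane\<close>

lemma smooth_ramp:
  fixes a b M :: real
  assumes ab: "a < b" and M: "1 < M * (b - a)"
  obtains \<eta> \<eta>' where "\<And>t. (\<eta> has_real_derivative \<eta>' t) (at t)" "continuous_on UNIV \<eta>'"
    "\<And>t. 0 \<le> \<eta> t" "\<And>t. \<eta> t \<le> 1" "\<And>t. t \<le> a \<Longrightarrow> \<eta> t = 0" "\<And>t. b \<le> t \<Longrightarrow> \<eta> t = 1"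
    "\<And>t. 0 \<le> \<eta>' t" "\<And>t. \<eta>' t \<le> M * indicator {a<..<b} t"
proof -
  have M0: "0 < M" using ab M by (smt (verit) mult_nonpos_nonneg)
  \<comment> \<open>The derivative \<open>\<eta>'\<close> is a trapezoid over \<open>[a, b]\<close>
    with two sloping pieces of width \<open>w\<close>, normalized to area 1 by \<open>N\<close>. Its
    height is \<open>1 / (b - a - w)\<close>, which is at most \<open>M\<close> for small
    \<open>w\<close> because \<open>M * (b - a)\<close> exceeds 1. Four shifted copies of
    \<open>p\<close>, the primitive of the positive part, integrate it.\<close>
  define w where "w = min ((b - a) / 2) (b - a - 1 / M)"
  have w: "0 < w" "2 * w \<le> b - a" "1 / M \<le> b - a - w"
    using ab M M0 by (auto simp: w_def min_def field_simps)
  define N where "N = w * (b - a - w)"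
  have N: "0 < N" using w by (simp add: N_def)
  define p where "p x = (max 0 x)\<^sup>2 / 2" for x :: real
  have p: "(p has_real_derivative max 0 x) (at x)" for x
  proof -
    consider "x < 0" | "0 < x" | "x = 0" by linarith
    then show ?thesis
    proof cases
      case 1
      then have "((\<lambda>x. 0) has_real_derivative 0) (at x)" by simp
      then have "(p has_real_derivative 0) (at x)"
        by (rule has_field_derivative_transform_within_open[of _ _ _ "{..<0}"]) (use 1 in \<open>auto simp: p_def\<close>)
      then show ?thesis using 1 by simp
    next
      case 2
      have "((\<lambda>x. x\<^sup>2 / 2) has_real_derivative x) (at x)" by (auto intro!: derivative_eq_intros)
      then have "(p has_real_derivative x) (at x)"
        by (rule has_field_derivative_transform_within_open[of _ _ _ "{0<..}"]) (use 2 in \<open>auto simp: p_def\<close>)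
      then show ?thesis using 2 by simp
    next
      case 3
      have "((\<lambda>h. max 0 h * (max 0 h / h) / 2) \<longlongrightarrow> 0) (at (0::real))"
      proof (rule Lim_null_comparison)
        show "\<forall>\<^sub>F h in at (0::real). norm (max 0 h * (max 0 h / h) / 2) \<le> \<bar>h\<bar>"
          by (intro always_eventually) (auto simp: max_def)
        show "(abs \<longlongrightarrow> 0) (at (0::real))" by (rule tendsto_eq_intros) (auto intro: tendsto_rabs_zero)
      qed
      then show ?thesis using 3 by (simp add: DERIV_def p_def power2_eq_square mult.commute)
    qed
  qed
  define \<eta> where "\<eta> t = (p (t - a) - p (t - a - w) - p (t - b + w) + p (t - b)) / N" for t
  define \<eta>' where "\<eta>' t = (max 0 (t - a) - max 0 (t - a - w) - max 0 (t - b + w) + max 0 (t - b)) / N" for t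
  have der: "(\<eta> has_real_derivative \<eta>' t) (at t)" for t
    unfolding \<eta>_def \<eta>'_def using N by (auto intro!: derivative_eq_intros DERIV_chain'[OF _ p])
  have \<eta>'0: "0 \<le> \<eta>' t" for t
    using w N by (auto simp: \<eta>'_def max_def)
  have wN: "w / N \<le> M"
  proof -
    have "w / N = 1 / (b - a - w)" using w by (simp add: N_def)
    moreover have "0 < b - a - w" using w by simp
    ultimately show ?thesis using w(3) M0 by (simp add: pos_divide_le_eq mult.commute)
  qed
  have \<eta>'M: "\<eta>' t \<le> M * indicator {a<..<b} t" for t
  proof (cases "a < t \<and> t < b")
    case True
    have "max 0 (t - a) - max 0 (t - a - w) - max 0 (t - b + w) + max 0 (t - b) \<le> w" using w by (auto simp: max_def)
    then have "\<eta>' t \<le> w / N" unfolding \<eta>'_def using N by (intro divide_right_mono) auto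
    then show ?thesis using True wN by simp
  next
    case False
    then have "\<eta>' t = 0" using w by (auto simp: \<eta>'_def max_def)
    then show ?thesis using False by auto
  qed
  have lo: "\<eta> t = 0" if "t \<le> a" for t using that w by (auto simp: \<eta>_def p_def max_def)
  have hi: "\<eta> t = 1" if "b \<le> t" for t
  proof -
    have "p (t - a) - p (t - a - w) - p (t - b + w) + p (t - b)
        = ((t - a)\<^sup>2 - (t - a - w)\<^sup>2 - (t - b + w)\<^sup>2 + (t - b)\<^sup>2) / 2"
      using that w ab by (simp add: p_def max_def)
    also have "\<dots> = N" by (simp add: N_def power2_eq_square field_simps)
    finally show ?thesis using N by (simp add: \<eta>_def)
  qed
  have mono: "\<eta> s \<le> \<eta> t" if "s \<le> t" for s t
    by (rule DERIV_nonneg_imp_nondecreasing[OF that]) (use der \<eta>'0 in blast)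
  have "continuous_on UNIV \<eta>'" unfolding \<eta>'_def using N by (intro continuous_intros) auto
  moreover have "0 \<le> \<eta> t" "\<eta> t \<le> 1" for t
    using mono[of "min t a" t] lo[of "min t a"] mono[of t "max t b"] hi[of "max t b"] by auto
  ultimately show thesis using der \<eta>'0 \<eta>'M lo hi that by blast
qed

text \<open>Closed half-spaces: the volume above the plane is then left continuous in
  \<open>l\<close>, which fits difference quotients taken from the left.\<close>

definition upper :: "real^3 \<Rightarrow> real \<Rightarrow> (real^3) set" where
  "upper \<nu> l = {x. l \<le> \<nu> \<bullet> x}"

lemma upper_borel[measurable]: "upper \<nu> l \<in> sets borel"
  unfolding upper_def by measurable

text \<open>The field \<open>\<eta> \<phi> + (1 - \<eta>) \<psi>\<close>, with a ramp \<open>\<eta>\<close> in direction \<open>\<nu>\<close>, is admissible for the perimeter of \<open>\<Omega>\<close>; the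
  gradient of \<open>\<eta>\<close> contributes at least \<open>- (1 + \<beta>)\<close> times its size.\<close>

lemma flux_cut_ramp:
  assumes [measurable]: "\<Omega> \<in> sets borel" and fin: "emeasure lborel \<Omega> < \<infinity>"
    and P: "0 \<le> P" "perimeter \<Omega> \<le> ennreal P" and \<nu>: "norm \<nu> = 1"
    and \<phi>: "bounded_divergence \<phi>" "\<And>x. norm (\<phi> x) \<le> 1" "\<And>x. - \<beta> \<le> \<nu> \<bullet> \<phi> x"
    and \<psi>: "bounded_divergence \<psi>" "\<And>x. norm (\<psi> x) \<le> 1"
    and ab: "a < b" "1 < M * (b - a)" and \<beta>: "-1 \<le> \<beta>"
  shows "\<exists>\<eta> :: real \<Rightarrow> real. \<eta> \<in> borel_measurable borel \<and> (\<forall>t. 0 \<le> \<eta> t \<and> \<eta> t \<le> 1)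
    \<and> (\<forall>t\<le>a. \<eta> t = 0) \<and> (\<forall>t\<ge>b. \<eta> t = 1) \<and>
    (\<integral>x. indicator \<Omega> x * (\<eta> (\<nu> \<bullet> x) * divergence \<phi> x + (1 - \<eta> (\<nu> \<bullet> x)) * divergence \<psi> x) \<partial>lborel)
      \<le> P + (1 + \<beta>) * M * (measure lborel (\<Omega> \<inter> upper \<nu> a) - measure lborel (\<Omega> \<inter> upper \<nu> b))"
proof -
  obtain \<eta> \<eta>' where \<eta>: "\<And>t. (\<eta> has_real_derivative \<eta>' t) (at t)" "continuous_on UNIV \<eta>'"
    "\<And>t. 0 \<le> \<eta> t" "\<And>t. \<eta> t \<le> 1" "\<And>t. t \<le> a \<Longrightarrow> \<eta> t = 0" "\<And>t. b \<le> t \<Longrightarrow> \<eta> t = 1"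
    "\<And>t. 0 \<le> \<eta>' t" "\<And>t. \<eta>' t \<le> M * indicator {a<..<b} t"
    using smooth_ramp[OF ab] by metis
  have [measurable]: "\<eta> \<in> borel_measurable borel" "\<eta>' \<in> borel_measurable borel"
    using \<eta>(1,2) by (auto intro!: borel_measurable_continuous_onI DERIV_continuous_on[of UNIV])
  let ?u = "\<lambda>x. \<eta> (\<nu> \<bullet> x)" and ?g = "\<lambda>x. \<eta>' (\<nu> \<bullet> x) *\<^sub>R \<nu>"
  have u: "(?u has_derivative (\<lambda>h. ?g x \<bullet> h)) (at x)" for x
  proof -
    have "(?u has_derivative (\<lambda>h. \<eta>' (\<nu> \<bullet> x) * (\<nu> \<bullet> h))) (at x)"
      using has_derivative_compose[of "\<lambda>x. \<nu> \<bullet> x" "\<lambda>h. \<nu> \<bullet> h" x UNIV \<eta> "\<lambda>t. \<eta>' (\<nu> \<bullet> x) * t"] \<eta>(1)[of "\<nu> \<bullet> x"]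
        bounded_linear_imp_has_derivative[OF bounded_linear_inner_right]
      by (auto simp: has_field_derivative_def)
    then show ?thesis by simp
  qed
  have u': "((\<lambda>x. 1 - ?u x) has_derivative (\<lambda>h. (- ?g x) \<bullet> h)) (at x)" for x
    using has_derivative_diff[OF has_derivative_const u] by (simp add: inner_minus_left)
  have g: "continuous_on UNIV ?g"
  proof -
    have "continuous_on UNIV (\<lambda>x. \<nu> \<bullet> x)" by (intro continuous_intros)
    then have "continuous_on UNIV (\<lambda>x. \<eta>' (\<nu> \<bullet> x))" by (rule continuous_on_compose2[OF \<eta>(2)]) simp
    then show ?thesis by (intro continuous_intros)
  qed
  then have g': "continuous_on UNIV (\<lambda>x. - ?g x)" by (rule continuous_on_minus)
  have c: "C1_field \<phi>" "C1_field \<psi>" using \<phi> \<psi> by (auto simp: bounded_divergence_def)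
  have [measurable]: "\<phi> \<in> borel_measurable borel" "\<psi> \<in> borel_measurable borel"
    using c by (auto intro!: borel_measurable_continuous_onI C1_field_continuous)
  let ?F = "\<lambda>x. ?u x *\<^sub>R \<phi> x + (1 - ?u x) *\<^sub>R \<psi> x"
  have F: "C1_field ?F"
    "divergence ?F x = ?u x * divergence \<phi> x + (1 - ?u x) * divergence \<psi> x + \<eta>' (\<nu> \<bullet> x) * (\<nu> \<bullet> (\<phi> x - \<psi> x))" for x
    using C1_field_add[OF C1_field_scale(1)[OF u g c(1)] C1_field_scale(1)[OF u' g' c(2)]]
    unfolding C1_field_scale(2)[OF u g c(1)] C1_field_scale(2)[OF u' g' c(2)]
    by (simp_all add: inner_diff_right right_diff_distrib)
  obtain B B' where B: "\<And>x. \<bar>divergence \<phi> x\<bar> \<le> B" "\<And>x. \<bar>divergence \<psi> x\<bar> \<le> B'"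
    using \<phi>(1) \<psi>(1) by (auto simp: bounded_divergence_def)
  have F2: "bounded_divergence ?F"
    unfolding bounded_divergence_def
  proof (intro conjI exI allI F(1))
    fix x
    have "\<bar>?u x * divergence \<phi> x\<bar> \<le> B" "\<bar>(1 - ?u x) * divergence \<psi> x\<bar> \<le> B'"
      using \<eta>(3,4)[of "\<nu> \<bullet> x"] by (intro abs_mult_le_of_le_1 B; simp)+
    moreover have "\<bar>\<eta>' (\<nu> \<bullet> x) * (\<nu> \<bullet> (\<phi> x - \<psi> x))\<bar> \<le> M * 2"
    proof -
      have "0 \<le> M" using ab by (smt (verit) mult_nonpos_nonneg)
      then have "\<bar>\<eta>' (\<nu> \<bullet> x)\<bar> \<le> M" using \<eta>(7)[of "\<nu> \<bullet> x"] \<eta>(8)[of "\<nu> \<bullet> x"] by (cases "a < \<nu> \<bullet> x \<and> \<nu> \<bullet> x < b") auto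
      moreover have "\<bar>\<nu> \<bullet> (\<phi> x - \<psi> x)\<bar> \<le> 2"
        using Cauchy_Schwarz_ineq2[of \<nu> "\<phi> x - \<psi> x"] \<nu> norm_triangle_ineq4[of "\<phi> x" "\<psi> x"] \<phi>(2)[of x] \<psi>(2)[of x] by simp
      ultimately show ?thesis unfolding abs_mult by (intro mult_mono) auto
    qed
    ultimately show "\<bar>divergence ?F x\<bar> \<le> B + B' + M * 2" unfolding F(2) by linarith
  qed
  have F1: "norm (?F x) \<le> 1" for x
  proof -
    have "norm (?F x) \<le> ?u x * norm (\<phi> x) + (1 - ?u x) * norm (\<psi> x)"
      using \<eta>(3,4) by (intro order_trans[OF norm_triangle_ineq]) simp
    also have "\<dots> \<le> ?u x * 1 + (1 - ?u x) * 1"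
      using \<eta>(3,4) \<phi>(2) \<psi>(2) by (intro add_mono mult_left_mono) auto
    finally show ?thesis by simp
  qed
  let ?S = "\<Omega> \<inter> upper \<nu> a - \<Omega> \<inter> upper \<nu> b"
  have finm: "emeasure lborel (\<Omega> \<inter> X) < \<infinity>" if "X \<in> sets borel" for X
    using fin by (rule le_less_trans[rotated]) (intro emeasure_mono; auto)
  have S: "emeasure lborel ?S < \<infinity>"
    using fin by (rule le_less_trans[rotated]) (intro emeasure_mono; auto)
  have low: "- ((1 + \<beta>) * M * indicator ?S x) \<le> indicator \<Omega> x * (\<eta>' (\<nu> \<bullet> x) * (\<nu> \<bullet> (\<phi> x - \<psi> x)))" for x
  proof (cases "x \<in> \<Omega> \<and> a < \<nu> \<bullet> x \<and> \<nu> \<bullet> x < b")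
    case True
    have "\<nu> \<bullet> \<psi> x \<le> 1" using norm_cauchy_schwarz[of \<nu> "\<psi> x"] \<nu> \<psi>(2)[of x] by simp
    then have "- (1 + \<beta>) \<le> \<nu> \<bullet> (\<phi> x - \<psi> x)" using \<phi>(3)[of x] by (simp add: inner_diff_right)
    then have "\<eta>' (\<nu> \<bullet> x) * - (1 + \<beta>) \<le> \<eta>' (\<nu> \<bullet> x) * (\<nu> \<bullet> (\<phi> x - \<psi> x))" by (rule mult_left_mono[OF _ \<eta>(7)])
    moreover have "\<eta>' (\<nu> \<bullet> x) * (1 + \<beta>) \<le> M * (1 + \<beta>)" using \<eta>(8)[of "\<nu> \<bullet> x"] True \<beta> by (intro mult_right_mono) auto
    moreover have "indicator ?S x = (1 :: real)" "indicator \<Omega> x = (1 :: real)" using True by (auto simp: upper_def)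
    ultimately show ?thesis by (simp add: algebra_simps)
  next
    case False
    then have "indicator \<Omega> x * \<eta>' (\<nu> \<bullet> x) = 0" using \<eta>(7)[of "\<nu> \<bullet> x"] \<eta>(8)[of "\<nu> \<bullet> x"] by (auto simp: indicator_def)
    have "0 \<le> M" using ab by (smt (verit) mult_nonpos_nonneg)
    then have "0 \<le> (1 + \<beta>) * M * indicator ?S x" using \<beta> by simp
    moreover have "indicator \<Omega> x * (\<eta>' (\<nu> \<bullet> x) * (\<nu> \<bullet> (\<phi> x - \<psi> x))) = 0"
      using \<open>indicator \<Omega> x * \<eta>' (\<nu> \<bullet> x) = 0\<close> by auto
    ultimately show ?thesis by linarith
  qed
  have i1: "integrable lborel (\<lambda>x. indicator \<Omega> x * (?u x * divergence \<phi> x + (1 - ?u x) * divergence \<psi> x))" (is "integrable lborel ?f")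
  proof -
    have [measurable]: "(\<lambda>x. ?u x) \<in> borel_measurable borel" by measurable
    have "integrable lborel (\<lambda>x. indicator \<Omega> x * (?u x * divergence \<phi> x) + indicator \<Omega> x * ((1 - ?u x) * divergence \<psi> x))"
      using \<eta>(3,4) \<phi>(1) \<psi>(1) fin by (intro Bochner_Integration.integrable_add bounded_divergence_integrable) (auto simp: abs_le_iff)
    then show ?thesis by (simp add: distrib_left)
  qed
  have i2: "integrable lborel (\<lambda>x. (1 + \<beta>) * M * indicator ?S x)"
    using S by (intro integrable_mult_right integrable_real_indicator) auto
  have "(\<integral>x. ?f x \<partial>lborel) - (\<integral>x. (1 + \<beta>) * M * indicator ?S x \<partial>lborel) = (\<integral>x. ?f x - (1 + \<beta>) * M * indicator ?S x \<partial>lborel)"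
    using i1 i2 by simp
  also have "\<dots> \<le> flux \<Omega> ?F"
    unfolding flux_def
  proof (intro integral_mono Bochner_Integration.integrable_diff i1 i2)
    show "integrable lborel (\<lambda>x. indicator \<Omega> x * divergence ?F x)"
      using bounded_divergence_integrable[OF F2 \<open>\<Omega> \<in> sets borel\<close>, of "\<lambda>_. 1"] fin by simp
  qed (use low in \<open>simp add: F(2) distrib_left\<close>)
  also have "\<dots> \<le> P" using F1 F2 P fin by (intro flux_le_bounded_divergence) auto
  finally have "(\<integral>x. ?f x \<partial>lborel) \<le> P + (1 + \<beta>) * M * measure lborel ?S" by simp
  also have "measure lborel ?S = measure lborel (\<Omega> \<inter> upper \<nu> a) - measure lborel (\<Omega> \<inter> upper \<nu> b)"
    using finm[of "upper \<nu> a"] ab by (intro measure_Diff) (auto simp: upper_def)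
  finally show ?thesis using \<eta>(3-6) by (intro exI[of _ \<eta>]) simp
qed

text \<open>Limit of \<open>flux_cut_ramp\<close> for ramps of vanishing width that end at the
  plane. The quotients need to be at most \<open>c\<close> infinitely often only, which is what a
  lower limit below \<open>c\<close> provides; the left-hand sides converge along the whole
  sequence.\<close>

lemma flux_cut:
  assumes [measurable]: "\<Omega> \<in> sets borel" and fin: "emeasure lborel \<Omega> < \<infinity>"
    and P: "0 \<le> P" "perimeter \<Omega> \<le> ennreal P" and \<nu>: "norm \<nu> = 1"
    and \<phi>: "bounded_divergence \<phi>" "\<And>x. norm (\<phi> x) \<le> 1" "\<And>x. - \<beta> \<le> \<nu> \<bullet> \<phi> x"
    and \<psi>: "bounded_divergence \<psi>" "\<And>x. norm (\<psi> x) \<le> 1" and \<beta>: "-1 \<le> \<beta>"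
    and c: "\<exists>\<^sub>F n in sequentially. real (Suc n) * (measure lborel (\<Omega> \<inter> upper \<nu> (l - 1 / real (Suc n))) - measure lborel (\<Omega> \<inter> upper \<nu> l)) \<le> c"
  shows "flux (\<Omega> \<inter> upper \<nu> l) \<phi> + flux (\<Omega> - upper \<nu> l) \<psi> \<le> P + (1 + \<beta>) * c"
proof -
  define h where "h n = 1 / real (Suc n)" for n
  have h: "0 < h n" "h \<longlonglongrightarrow> 0" for n using LIMSEQ_inverse_real_of_nat by (auto simp: h_def[abs_def] inverse_eq_divide)
  \<comment> \<open>A ramp needs a slope strictly above the reciprocal of its width; the excess
    factor \<open>1 + h n\<close> tends to 1.\<close>
  define M where "M n = (1 + h n) * real (Suc n)" for n
  have M: "1 < M n * (l - (l - h n))" for n using h(1)[of n] by (simp add: M_def h_def)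
  define Q where "Q n \<eta> \<longleftrightarrow> \<eta> \<in> borel_measurable borel \<and> (\<forall>t. 0 \<le> \<eta> t \<and> \<eta> t \<le> 1)
    \<and> (\<forall>t\<le>l - h n. \<eta> t = 0) \<and> (\<forall>t\<ge>l. \<eta> t = 1) \<and>
    (\<integral>x. indicator \<Omega> x * (\<eta> (\<nu> \<bullet> x) * divergence \<phi> x + (1 - \<eta> (\<nu> \<bullet> x)) * divergence \<psi> x) \<partial>lborel)
      \<le> P + (1 + \<beta>) * M n * (measure lborel (\<Omega> \<inter> upper \<nu> (l - h n)) - measure lborel (\<Omega> \<inter> upper \<nu> l))"
    for n and \<eta> :: "real \<Rightarrow> real"
  have "\<exists>\<eta>. Q n \<eta>" for n
    unfolding Q_def using h(1)[of n] by (intro flux_cut_ramp[OF assms(1) fin P \<nu> \<phi> \<psi> _ M \<beta>]) simp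
  then obtain \<eta> where "\<And>n. Q n (\<eta> n)" by metis
  then have \<eta>: "\<And>n. \<eta> n \<in> borel_measurable borel" "\<And>n t. 0 \<le> \<eta> n t" "\<And>n t. \<eta> n t \<le> 1"
    "\<And>n t. t \<le> l - h n \<Longrightarrow> \<eta> n t = 0" "\<And>n t. l \<le> t \<Longrightarrow> \<eta> n t = 1"
    "\<And>n. (\<integral>x. indicator \<Omega> x * (\<eta> n (\<nu> \<bullet> x) * divergence \<phi> x + (1 - \<eta> n (\<nu> \<bullet> x)) * divergence \<psi> x) \<partial>lborel)
      \<le> P + (1 + \<beta>) * M n * (measure lborel (\<Omega> \<inter> upper \<nu> (l - h n)) - measure lborel (\<Omega> \<inter> upper \<nu> l))"
    unfolding Q_def by blast+
  note \<eta>(1)[measurable]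
  have d[measurable]: "divergence \<phi> \<in> borel_measurable borel" "divergence \<psi> \<in> borel_measurable borel"
    using \<phi> \<psi> by (auto simp: bounded_divergence_def intro!: divergence_measurable)
  obtain B B' where B: "\<And>x. \<bar>divergence \<phi> x\<bar> \<le> B" "\<And>x. \<bar>divergence \<psi> x\<bar> \<le> B'"
    using \<phi>(1) \<psi>(1) by (auto simp: bounded_divergence_def)
  let ?f = "\<lambda>n x. indicator \<Omega> x * (\<eta> n (\<nu> \<bullet> x) * divergence \<phi> x + (1 - \<eta> n (\<nu> \<bullet> x)) * divergence \<psi> x)"
  let ?g = "\<lambda>x. indicator (\<Omega> \<inter> upper \<nu> l) x * divergence \<phi> x + indicator (\<Omega> - upper \<nu> l) x * divergence \<psi> x"
  have "(\<lambda>n. (\<integral>x. ?f n x \<partial>lborel)) \<longlonglongrightarrow> (\<integral>x. ?g x \<partial>lborel)"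
  proof (rule integral_dominated_convergence[where w="\<lambda>x. (B + B') * indicator \<Omega> x"])
    show "integrable lborel (\<lambda>x. (B + B') * indicator \<Omega> x)"
      using fin by (intro integrable_mult_right integrable_real_indicator) auto
    have "(\<lambda>n. ?f n x) \<longlonglongrightarrow> ?g x" for x
    proof (rule tendsto_eventually, cases "l \<le> \<nu> \<bullet> x")
      case True
      then show "\<forall>\<^sub>F n in sequentially. ?f n x = ?g x" by (simp add: \<eta>(5) upper_def indicator_def)
    next
      case False
      then have "\<forall>\<^sub>F n in sequentially. h n < l - \<nu> \<bullet> x" using h(2) by (intro order_tendstoD(2)) auto
      then show "\<forall>\<^sub>F n in sequentially. ?f n x = ?g x"
        by eventually_elim (use False in \<open>auto simp: \<eta>(4) upper_def indicator_def\<close>)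
    qed
    then show "AE x in lborel. (\<lambda>n. ?f n x) \<longlonglongrightarrow> ?g x" by simp
    have "\<bar>?f n x\<bar> \<le> (B + B') * indicator \<Omega> x" for x n
    proof -
      have "\<bar>\<eta> n (\<nu> \<bullet> x) * divergence \<phi> x\<bar> \<le> B" "\<bar>(1 - \<eta> n (\<nu> \<bullet> x)) * divergence \<psi> x\<bar> \<le> B'"
        using \<eta>(2,3)[of n "\<nu> \<bullet> x"] by (intro abs_mult_le_of_le_1 B; simp)+
      then show ?thesis by (auto simp: indicator_def)
    qed
    then show "AE x in lborel. norm (?f n x) \<le> (B + B') * indicator \<Omega> x" for n by simp
  qed measurable
  also have "(\<integral>x. ?g x \<partial>lborel) = flux (\<Omega> \<inter> upper \<nu> l) \<phi> + flux (\<Omega> - upper \<nu> l) \<psi>"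
    unfolding flux_def
  proof (rule Bochner_Integration.integral_add)
    have f: "emeasure lborel (\<Omega> \<inter> X) < \<infinity>" if "X \<in> sets borel" for X
      using fin by (rule le_less_trans[rotated]) (intro emeasure_mono; auto)
    show "integrable lborel (\<lambda>x. indicator (\<Omega> \<inter> upper \<nu> l) x * divergence \<phi> x)"
      using bounded_divergence_integrable[OF \<phi>(1), of "\<Omega> \<inter> upper \<nu> l" "\<lambda>_. 1"] f by simp
    show "integrable lborel (\<lambda>x. indicator (\<Omega> - upper \<nu> l) x * divergence \<psi> x)"
      using bounded_divergence_integrable[OF \<psi>(1), of "\<Omega> - upper \<nu> l" "\<lambda>_. 1"] f[of "- upper \<nu> l"] by (simp add: Diff_eq)
  qed
  finally have lim: "(\<lambda>n. (\<integral>x. ?f n x \<partial>lborel) - (1 + \<beta>) * h n * c) \<longlonglongrightarrow> flux (\<Omega> \<inter> upper \<nu> l) \<phi> + flux (\<Omega> - upper \<nu> l) \<psi> - (1 + \<beta>) * 0 * c"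
    by (intro tendsto_intros h) auto
  show ?thesis
  proof (rule ccontr)
    assume "\<not> ?thesis"
    then have "\<forall>\<^sub>F n in sequentially. P + (1 + \<beta>) * c < (\<integral>x. ?f n x \<partial>lborel) - (1 + \<beta>) * h n * c"
      using order_tendstoD(1)[OF lim, of "P + (1 + \<beta>) * c"] by simp
    from frequently_eventually_frequently[OF c this] obtain n where
      n: "P + (1 + \<beta>) * c < (\<integral>x. ?f n x \<partial>lborel) - (1 + \<beta>) * h n * c"
        "real (Suc n) * (measure lborel (\<Omega> \<inter> upper \<nu> (l - h n)) - measure lborel (\<Omega> \<inter> upper \<nu> l)) \<le> c"
      by (auto simp: h_def dest!: frequently_ex)
    have "(1 + \<beta>) * M n * (measure lborel (\<Omega> \<inter> upper \<nu> (l - h n)) - measure lborel (\<Omega> \<inter> upper \<nu> l)) \<le> (1 + \<beta>) * ((1 + h n) * c)"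
      unfolding M_def using mult_left_mono[OF n(2), of "(1 + \<beta>) * (1 + h n)"] \<beta> h(1)[of n] by (simp add: mult.assoc)
    with \<eta>(6)[of n] n(1) show False by (simp add: algebra_simps)
  qed
qed

section \<open>The capillary isoperimetric inequality\<close>

text \<open>The vector field \<open>g\<close> is the gradient of \<open>\<rho>\<close>.
  Differentiability enters only through the quadratic Taylor estimate.\<close>

locale mollifier =
  fixes \<rho> :: "real^3 \<Rightarrow> real" and g :: "real^3 \<Rightarrow> real^3" and C L \<epsilon> :: real
  assumes nonneg: "\<And>z. 0 \<le> \<rho> z" and outside: "\<And>z. \<epsilon> \<le> norm z \<Longrightarrow> \<rho> z = 0"
    and outside': "\<And>z. \<epsilon> \<le> norm z \<Longrightarrow> g z = 0"
    and even: "\<And>z. \<rho> (- z) = \<rho> z"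
    and Taylor: "\<And>z h. \<bar>\<rho> (z + h) - \<rho> z - g z \<bullet> h\<bar> \<le> C * (norm h)\<^sup>2"
    and cont: "continuous_on UNIV \<rho>" "continuous_on UNIV g"
    and bounded: "\<And>z. \<rho> z \<le> L" "\<And>z. norm (g z) \<le> L"
    and integral: "integrable lborel \<rho>" "(\<integral>z. \<rho> z \<partial>lborel) = 1"
    and pos: "0 < \<epsilon>" "0 \<le> C" "0 \<le> L"

lemma ex_mollifier:
  assumes \<epsilon>: "0 < \<epsilon>"
  shows "\<exists>\<rho> g C L. mollifier \<rho> g C L \<epsilon>"
proof -
  have bm[measurable]: "bump \<in> borel_measurable borel"
    unfolding bump_def[abs_def] by measurable
  have "continuous_on UNIV bump" unfolding bump_def[abs_def] by (intro continuous_intros)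
  have int: "integrable lborel (\<lambda>z. bump (z /\<^sub>R \<epsilon>))"
  proof (rule Bochner_Integration.integrable_bound[OF lborel_integrable_indicator_cball[of 1 0 \<epsilon>]])
    have "norm (bump (z /\<^sub>R \<epsilon>)) \<le> norm (1 * indicator (cball 0 \<epsilon>) z :: real)" for z :: "real^3"
      using bump_nonneg bump_le_1 bump_outside(1)[of "z /\<^sub>R \<epsilon>"] \<epsilon> by (cases "norm z \<le> \<epsilon>") (auto simp: field_simps)
    then show "AE z in lborel. norm (bump (z /\<^sub>R \<epsilon>)) \<le> norm (1 * indicator (cball 0 \<epsilon>) z :: real)" by simp
  qed measurable
  define J where "J = (\<integral>z. bump (z /\<^sub>R \<epsilon>) \<partial>lborel)"
  have J: "0 < J"
  proof -
    have "measure lborel (cball (0::real^3) (\<epsilon> / 2)) * (1 / 8) = (\<integral>z. 1 / 8 * indicator (cball 0 (\<epsilon> / 2)) z \<partial>(lborel :: (real^3) measure))" by simp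
    also have "\<dots> \<le> J"
      unfolding J_def
    proof (rule integral_mono[OF lborel_integrable_indicator_cball int])
      fix z :: "real^3"
      show "1 / 8 * indicator (cball 0 (\<epsilon> / 2)) z \<le> bump (z /\<^sub>R \<epsilon>)"
      proof (cases "norm z \<le> \<epsilon> / 2")
        case True
        then have "norm (z /\<^sub>R \<epsilon>) \<le> 1 / 2" using \<epsilon> by (simp add: field_simps)
        then have "(norm (z /\<^sub>R \<epsilon>))\<^sup>2 \<le> (1 / 2)\<^sup>2" by (intro power_mono) auto
        then have "(z /\<^sub>R \<epsilon>) \<bullet> (z /\<^sub>R \<epsilon>) \<le> 1 / 4" unfolding power2_norm_eq_inner power_divide by simp
        then have "1 / 2 \<le> max 0 (1 - (z /\<^sub>R \<epsilon>) \<bullet> (z /\<^sub>R \<epsilon>))" by (intro max.coboundedI2) linarith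
        then have "(1 / 2) ^ 3 \<le> bump (z /\<^sub>R \<epsilon>)" unfolding bump_def by (rule power_mono) simp
        then show ?thesis using True by (simp add: power3_eq_cube)
      qed (simp add: bump_nonneg)
    qed
    finally show ?thesis using content_cball_gt_0_iff[of "0::real^3" "\<epsilon> / 2"] \<epsilon> by linarith
  qed
  define \<rho> where "\<rho> z = bump (z /\<^sub>R \<epsilon>) / J" for z
  define g where "g z = (grad_bump (z /\<^sub>R \<epsilon>) /\<^sub>R \<epsilon>) /\<^sub>R J" for z
  have "mollifier \<rho> g (78 / \<epsilon>\<^sup>2 / J) (max (1 / J) (6 / \<epsilon> / J)) \<epsilon>"
  proof
    show "0 \<le> \<rho> z" "\<rho> (- z) = \<rho> z" for z using J bump_nonneg by (auto simp: \<rho>_def bump_def)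
    show "\<rho> z = 0" "g z = 0" if "\<epsilon> \<le> norm z" for z
    proof -
      have "1 \<le> norm (z /\<^sub>R \<epsilon>)" using that \<epsilon> by (simp add: field_simps)
      then show "\<rho> z = 0" "g z = 0" by (simp_all add: \<rho>_def g_def bump_outside)
    qed
    show "\<bar>\<rho> (z + h) - \<rho> z - g z \<bullet> h\<bar> \<le> 78 / \<epsilon>\<^sup>2 / J * (norm h)\<^sup>2" for z h
    proof -
      have "\<rho> (z + h) - \<rho> z - g z \<bullet> h = (bump (z /\<^sub>R \<epsilon> + h /\<^sub>R \<epsilon>) - bump (z /\<^sub>R \<epsilon>) - grad_bump (z /\<^sub>R \<epsilon>) \<bullet> (h /\<^sub>R \<epsilon>)) / J"
        using J \<epsilon> by (simp add: \<rho>_def g_def scaleR_add_right divide_inverse algebra_simps)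
      also have "\<bar>\<dots>\<bar> \<le> (78 * (norm (h /\<^sub>R \<epsilon>))\<^sup>2) / J"
        unfolding abs_divide using J bump_Taylor[of "z /\<^sub>R \<epsilon>" "h /\<^sub>R \<epsilon>"] by (simp add: divide_right_mono)
      finally show ?thesis using \<epsilon> by (simp add: power_mult_distrib power_inverse divide_inverse mult_ac)
    qed
    show "continuous_on UNIV \<rho>" "continuous_on UNIV g"
      unfolding \<rho>_def[abs_def] g_def[abs_def] bump_def grad_bump_def using J \<epsilon> by (auto intro!: continuous_intros)
    show "\<rho> z \<le> max (1 / J) (6 / \<epsilon> / J)" for z
      unfolding \<rho>_def using J bump_le_1 by (intro max.coboundedI1 divide_right_mono) auto
    show "norm (g z) \<le> max (1 / J) (6 / \<epsilon> / J)" for z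
    proof (rule max.coboundedI2)
      show "norm (g z) \<le> 6 / \<epsilon> / J"
        using J \<epsilon> norm_grad_bump[of "z /\<^sub>R \<epsilon>"] by (simp add: g_def divide_inverse mult_ac)
    qed
    show "integrable lborel \<rho>" "(\<integral>z. \<rho> z \<partial>lborel) = 1"
      unfolding \<rho>_def[abs_def] using int J by (simp_all add: J_def)
    show "0 < \<epsilon>" "0 \<le> 78 / \<epsilon>\<^sup>2 / J" "0 \<le> max (1 / J) (6 / \<epsilon> / J)" using \<epsilon> J by (auto simp: le_max_iff_disj)
  qed
  then show ?thesis by blast
qed

context mollifier
begin

lemma measurable_mollifier[measurable]: "\<rho> \<in> borel_measurable borel" "g \<in> borel_measurable borel"
  using cont by (auto intro: borel_measurable_continuous_onI)

lemma integrable_conv: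
  fixes y :: "real^3 \<Rightarrow> 'b::{banach, second_countable_topology}"
  assumes y: "integrable lborel y"
  shows "integrable lborel (\<lambda>z. \<rho> (x - z) *\<^sub>R y z)" "integrable lborel (\<lambda>z. (g (x - z) \<bullet> h) *\<^sub>R y z)"
proof -
  have [measurable]: "y \<in> borel_measurable borel" using borel_measurable_integrable[OF y] by simp
  have int: "integrable lborel (\<lambda>z. a *\<^sub>R norm (y z))" for a :: real using y by simp
  show "integrable lborel (\<lambda>z. \<rho> (x - z) *\<^sub>R y z)"
    by (rule Bochner_Integration.integrable_bound[OF int[of L]])
      (use pos nonneg bounded(1) in \<open>auto simp: abs_mult intro!: AE_I2 mult_right_mono\<close>)
  show "integrable lborel (\<lambda>z. (g (x - z) \<bullet> h) *\<^sub>R y z)"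
  proof (rule Bochner_Integration.integrable_bound[OF int[of "L * norm h"]])
    have "\<bar>g u \<bullet> h\<bar> \<le> L * norm h" for u
      using Cauchy_Schwarz_ineq2[of "g u" h] mult_right_mono[OF bounded(2)[of u], of "norm h"] by simp
    then show "AE z in lborel. norm ((g (x - z) \<bullet> h) *\<^sub>R y z) \<le> norm ((L * norm h) *\<^sub>R norm (y z))"
      using pos by (auto simp: abs_mult intro!: AE_I2 mult_right_mono)
  qed measurable
qed

text \<open>Three Taylor estimates, at \<open>z\<close> with the increments
  \<open>z' - z + k\<close> and \<open>z' - z\<close> and at \<open>z'\<close> with the increment
  \<open>k\<close>, isolate \<open>(g z' - g z) \<bullet> k\<close>. Scaling \<open>h\<close> to a
  vector \<open>k\<close> of length \<open>d = norm (z' - z)\<close> bounds the errors by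
  \<open>4 + 1 + 1 = 6\<close> times \<open>C * d * d\<close>.\<close>

lemma grad_Lipschitz: "\<bar>(g z' - g z) \<bullet> h\<bar> \<le> 6 * C * norm (z' - z) * norm h"
proof (cases "h = 0 \<or> z' = z")
  case False
  define d where "d = norm (z' - z)"
  define k where "k = (d / norm h) *\<^sub>R h"
  have d: "0 < d" and nk: "norm k = d" using False by (auto simp: d_def k_def)
  have "(g z' - g z) \<bullet> k = (\<rho> (z + (z' - z + k)) - \<rho> z - g z \<bullet> (z' - z + k)) - (\<rho> (z' + k) - \<rho> z' - g z' \<bullet> k)
      - (\<rho> (z + (z' - z)) - \<rho> z - g z \<bullet> (z' - z))"
    by (simp add: inner_diff_left inner_add_right)
  then have "\<bar>(g z' - g z) \<bullet> k\<bar> \<le> C * (norm (z' - z + k))\<^sup>2 + C * (norm k)\<^sup>2 + C * (norm (z' - z))\<^sup>2"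
    using Taylor[of z "z' - z + k"] Taylor[of z' k] Taylor[of z "z' - z"] by linarith
  also have "(norm (z' - z + k))\<^sup>2 \<le> (2 * d)\<^sup>2"
    using norm_triangle_ineq[of "z' - z" k] nk by (intro power_mono) (auto simp: d_def)
  finally have "\<bar>(g z' - g z) \<bullet> k\<bar> \<le> 6 * C * d * d"
    using pos(2) by (simp add: nk d_def[symmetric] mult_left_mono power2_eq_square)
  moreover have "(g z' - g z) \<bullet> k = (d / norm h) * ((g z' - g z) \<bullet> h)" by (simp add: k_def)
  ultimately have "d / norm h * \<bar>(g z' - g z) \<bullet> h\<bar> \<le> 6 * C * d * d" using d by (simp add: abs_mult)
  then have "\<bar>(g z' - g z) \<bullet> h\<bar> \<le> 6 * C * d * norm h" using d False by (simp add: field_simps)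
  then show ?thesis by (simp add: d_def)
qed auto

text \<open>All derivatives fall on the kernel, so integrability of \<open>y\<close> is
  enough.\<close>

lemma conv_field:
  fixes y :: "real^3 \<Rightarrow> real^3"
  assumes y: "integrable lborel y"
  defines "\<phi> \<equiv> \<lambda>x. (\<integral>z. \<rho> (x - z) *\<^sub>R y z \<partial>lborel)"
  shows "C1_field \<phi>" "divergence \<phi> x = (\<integral>z. g (x - z) \<bullet> y z \<partial>lborel)"
proof -
  define D where "D x h = (\<integral>z. (g (x - z) \<bullet> h) *\<^sub>R y z \<partial>lborel)" for x h
  have [measurable]: "y \<in> borel_measurable borel" using borel_measurable_integrable[OF y] by simp
  define Y where "Y = (\<integral>z. norm (y z) \<partial>lborel)"
  have bl: "bounded_linear (D x)" for x
  proof (rule bounded_linear_intro[where K="L * Y"])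
    show "D x (a + b) = D x a + D x b" for a b
      unfolding D_def using integrable_conv(2)[OF y] by (simp add: inner_add_right scaleR_add_left)
    show "D x (r *\<^sub>R a) = r *\<^sub>R D x a" for r a
      unfolding D_def by (simp flip: scaleR_scaleR)
    show "norm (D x h) \<le> norm h * (L * Y)" for h
    proof -
      have "norm (D x h) \<le> (\<integral>z. norm ((g (x - z) \<bullet> h) *\<^sub>R y z) \<partial>lborel)" unfolding D_def by (rule integral_norm_bound)
      also have "\<dots> \<le> (\<integral>z. L * norm h * norm (y z) \<partial>lborel)"
      proof (rule integral_mono)
        show "integrable lborel (\<lambda>z. norm ((g (x - z) \<bullet> h) *\<^sub>R y z))" using integrable_conv(2)[OF y] by (rule integrable_norm)
        show "integrable lborel (\<lambda>z. L * norm h * norm (y z))" using y by simp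
        show "norm ((g (x - z) \<bullet> h) *\<^sub>R y z) \<le> L * norm h * norm (y z)" for z
          using Cauchy_Schwarz_ineq2[of "g (x - z)" h] mult_right_mono[OF bounded(2)[of "x - z"], of "norm h"]
          by (simp add: mult_right_mono)
      qed
      finally show ?thesis by (simp add: Y_def mult_ac)
    qed
  qed
  have 1: "(\<phi> has_derivative D x) (at x)" for x
  proof (rule has_derivative_quadratic_error[OF bl])
    fix h
    have eq: "\<phi> (x + h) - \<phi> x - D x h = (\<integral>z. (\<rho> (x - z + h) - \<rho> (x - z) - g (x - z) \<bullet> h) *\<^sub>R y z \<partial>lborel)"
      unfolding \<phi>_def D_def using integrable_conv[OF y]
      by (simp add: scaleR_diff_left diff_add_eq)
    have "norm (\<phi> (x + h) - \<phi> x - D x h) \<le> (\<integral>z. norm ((\<rho> (x - z + h) - \<rho> (x - z) - g (x - z) \<bullet> h) *\<^sub>R y z) \<partial>lborel)"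
      unfolding eq by (rule integral_norm_bound)
    also have "\<dots> \<le> (\<integral>z. C * (norm h)\<^sup>2 * norm (y z) \<partial>lborel)"
    proof (rule integral_mono)
      have "integrable lborel (\<lambda>z. \<rho> (x + h - z) *\<^sub>R y z - \<rho> (x - z) *\<^sub>R y z - (g (x - z) \<bullet> h) *\<^sub>R y z)"
        by (intro Bochner_Integration.integrable_diff integrable_conv y)
      then show "integrable lborel (\<lambda>z. norm ((\<rho> (x - z + h) - \<rho> (x - z) - g (x - z) \<bullet> h) *\<^sub>R y z))"
        by (intro integrable_norm) (simp add: scaleR_diff_left diff_add_eq)
      show "integrable lborel (\<lambda>z. C * (norm h)\<^sup>2 * norm (y z))" using y by simp
      show "norm ((\<rho> (x - z + h) - \<rho> (x - z) - g (x - z) \<bullet> h) *\<^sub>R y z) \<le> C * (norm h)\<^sup>2 * norm (y z)" for z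
        using Taylor[of "x - z" h] by (simp add: mult_right_mono)
    qed
    finally show "norm (\<phi> (x + h) - \<phi> x - D x h) \<le> C * Y * (norm h)\<^sup>2" by (simp add: Y_def mult_ac)
  qed
  have 2: "continuous_on UNIV (\<lambda>x. D x v)" for v
  proof -
    have "norm (D x' v - D x v) \<le> 6 * C * norm v * Y * dist x' x" for x x'
    proof -
      have eq: "D x' v - D x v = (\<integral>z. ((g (x' - z) - g (x - z)) \<bullet> v) *\<^sub>R y z \<partial>lborel)"
        unfolding D_def using integrable_conv(2)[OF y] by (simp add: inner_diff_left scaleR_diff_left)
      have "norm (D x' v - D x v) \<le> (\<integral>z. norm (((g (x' - z) - g (x - z)) \<bullet> v) *\<^sub>R y z) \<partial>lborel)"
        unfolding eq by (rule integral_norm_bound)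
      also have "\<dots> \<le> (\<integral>z. 6 * C * norm (x' - x) * norm v * norm (y z) \<partial>lborel)"
      proof (rule integral_mono)
        have "integrable lborel (\<lambda>z. (g (x' - z) \<bullet> v) *\<^sub>R y z - (g (x - z) \<bullet> v) *\<^sub>R y z)"
          by (intro Bochner_Integration.integrable_diff integrable_conv y)
        then show "integrable lborel (\<lambda>z. norm (((g (x' - z) - g (x - z)) \<bullet> v) *\<^sub>R y z))"
          by (intro integrable_norm) (simp add: inner_diff_left scaleR_diff_left)
        show "integrable lborel (\<lambda>z. 6 * C * norm (x' - x) * norm v * norm (y z))" using y by simp
        show "norm (((g (x' - z) - g (x - z)) \<bullet> v) *\<^sub>R y z) \<le> 6 * C * norm (x' - x) * norm v * norm (y z)" for z
          using grad_Lipschitz[of "x' - z" "x - z" v] by (simp add: mult_right_mono)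
      qed
      finally show ?thesis by (simp add: Y_def dist_norm mult_ac)
    qed
    then have "(6 * C * norm v * Y)-lipschitz_on UNIV (\<lambda>x. D x v)"
      using pos by (intro lipschitz_onI) (auto simp: dist_norm Y_def)
    then show ?thesis by (rule lipschitz_on_continuous_on)
  qed
  show "C1_field \<phi>" by (rule C1_fieldI[OF 1 2])
  have comp: "D x (axis i 1) $ i = (\<integral>z. (g (x - z) $ i) * (y z $ i) \<partial>lborel)" for i
    unfolding D_def using integral_bounded_linear[OF bounded_linear_vec_nth[of i] integrable_conv(2)[OF y, of x "axis i 1"]]
    by (simp add: inner_axis)
  have ic: "integrable lborel (\<lambda>z. (g (x - z) $ i) * (y z $ i))" for i
    using integrable_bounded_linear[OF bounded_linear_vec_nth[of i] integrable_conv(2)[OF y, of x "axis i 1"]]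
    by (simp add: inner_axis)
  show "divergence \<phi> x = (\<integral>z. g (x - z) \<bullet> y z \<partial>lborel)"
    unfolding C1_fieldI(2)[OF 1 2] trace_field_def comp
    by (subst Bochner_Integration.integral_sum[symmetric]) (use ic in \<open>auto simp: inner_vec_def\<close>)
qed

text \<open>The Taylor estimate of the kernel, integrated against \<open>w\<close>. Nonnegativity of
  \<open>w\<close> preserves the inequality.\<close>

lemma conv_Taylor:
  fixes w :: "real^3 \<Rightarrow> real"
  assumes w: "integrable lborel w" and nn: "\<And>x. 0 \<le> w x"
  shows "(\<integral>x. \<rho> (x - (z - u)) * w x \<partial>lborel)
    \<le> (\<integral>x. \<rho> (x - z) * w x \<partial>lborel) + (\<integral>x. w x *\<^sub>R g (x - z) \<partial>lborel) \<bullet> u + C * (\<integral>x. w x \<partial>lborel) * (norm u)\<^sup>2"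
proof -
  have [measurable]: "w \<in> borel_measurable borel" using borel_measurable_integrable[OF w] by simp
  have i1: "integrable lborel (\<lambda>x. \<rho> (x - z) * w x)" for z
  proof (rule Bochner_Integration.integrable_bound[of _ "\<lambda>x. L * w x"])
    show "integrable lborel (\<lambda>x. L * w x)" using w by simp
  qed (use pos nonneg bounded(1) nn in \<open>auto simp: abs_mult intro!: AE_I2 mult_right_mono\<close>)
  have i2: "integrable lborel (\<lambda>x. w x *\<^sub>R g (x - z))"
  proof (rule Bochner_Integration.integrable_bound[of _ "\<lambda>x. w x * L"])
    show "integrable lborel (\<lambda>x. w x * L)" using w by simp
  qed (use pos bounded(2) nn in \<open>auto simp: abs_mult intro!: AE_I2 mult_left_mono\<close>)
  have i3: "integrable lborel (\<lambda>x. w x *\<^sub>R g (x - z) \<bullet> u)" by (intro integrable_inner_left i2)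
  have "(\<integral>x. \<rho> (x - (z - u)) * w x \<partial>lborel) \<le> (\<integral>x. \<rho> (x - z) * w x + w x *\<^sub>R g (x - z) \<bullet> u + C * (norm u)\<^sup>2 * w x \<partial>lborel)"
  proof (rule integral_mono)
    fix x
    have "\<rho> (x - (z - u)) \<le> \<rho> (x - z) + g (x - z) \<bullet> u + C * (norm u)\<^sup>2"
      using Taylor[of "x - z" u] by (simp add: diff_diff_eq2 diff_add_eq)
    from mult_right_mono[OF this nn[of x]]
    show "\<rho> (x - (z - u)) * w x \<le> \<rho> (x - z) * w x + w x *\<^sub>R g (x - z) \<bullet> u + C * (norm u)\<^sup>2 * w x"
      by (simp add: algebra_simps)
  qed (use i1 i3 w in auto)
  also have "\<dots> = (\<integral>x. \<rho> (x - z) * w x \<partial>lborel) + (\<integral>x. w x *\<^sub>R g (x - z) \<partial>lborel) \<bullet> u + C * (\<integral>x. w x \<partial>lborel) * (norm u)\<^sup>2"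
    using i1 i3 w integral_inner_left[of u lborel "\<lambda>x. w x *\<^sub>R g (x - z)"] i2 by (simp del: inner_scaleR_left)
  finally show ?thesis .
qed

text \<open>Integration by parts: smoothing the field \<open>y\<close> and testing with
  \<open>w\<close> is the same as smoothing \<open>w\<close> and testing its negative gradient with
  \<open>y\<close>.\<close>

lemma conv_Fubini:
  fixes w :: "real^3 \<Rightarrow> real" and y :: "real^3 \<Rightarrow> real^3"
  assumes w: "integrable lborel w" and y: "integrable lborel y"
  shows "(\<integral>x. w x * (\<integral>z. g (x - z) \<bullet> y z \<partial>lborel) \<partial>lborel) = (\<integral>z. (\<integral>x. w x *\<^sub>R g (x - z) \<partial>lborel) \<bullet> y z \<partial>lborel)"
    and "integrable lborel (\<lambda>z. (\<integral>x. w x *\<^sub>R g (x - z) \<partial>lborel) \<bullet> y z)"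
proof -
  have [measurable]: "w \<in> borel_measurable borel" "y \<in> borel_measurable borel"
    using borel_measurable_integrable[OF w] borel_measurable_integrable[OF y] by simp_all
  have i2: "integrable lborel (\<lambda>x. w x *\<^sub>R g (x - z))" for z
  proof (rule Bochner_Integration.integrable_bound[of _ "\<lambda>x. w x * L"])
    show "integrable lborel (\<lambda>x. w x * L)" using w by simp
  qed (use pos bounded(2) in \<open>auto simp: abs_mult intro!: AE_I2 mult_left_mono\<close>)
  have P: "integrable (lborel \<Otimes>\<^sub>M lborel) (\<lambda>(x, z). w x * (g (x - z) \<bullet> y z))"
  proof (rule Bochner_Integration.integrable_bound[of _ "\<lambda>(x, z). w x * (L * norm (y z))"])
    show "integrable (lborel \<Otimes>\<^sub>M lborel) (\<lambda>(x, z). w x * (L * norm (y z)))"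
      using w y pos by (intro lborel_pair.Fubini_integrable) (auto simp: abs_mult)
    have "norm (w x * (g (x - z) \<bullet> y z)) \<le> norm (w x * (L * norm (y z)))" for x z
    proof -
      have "\<bar>g (x - z) \<bullet> y z\<bar> \<le> L * norm (y z)"
        using Cauchy_Schwarz_ineq2[of "g (x - z)" "y z"] mult_right_mono[OF bounded(2)[of "x - z"], of "norm (y z)"] by simp
      then show ?thesis using pos by (simp add: abs_mult mult_left_mono)
    qed
    then show "AE p in lborel \<Otimes>\<^sub>M lborel. norm (case p of (x, z) \<Rightarrow> w x * (g (x - z) \<bullet> y z)) \<le> norm (case p of (x, z) \<Rightarrow> w x * (L * norm (y z)))"
      by (intro AE_I2) auto
  qed measurable
  have inner: "(\<integral>x. w x *\<^sub>R g (x - z) \<partial>lborel) \<bullet> y z = (\<integral>x. w x * (g (x - z) \<bullet> y z) \<partial>lborel)" for z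
    using integral_inner_left[of "y z" lborel "\<lambda>x. w x *\<^sub>R g (x - z)"] i2[of z] by simp
  show "(\<integral>x. w x * (\<integral>z. g (x - z) \<bullet> y z \<partial>lborel) \<partial>lborel) = (\<integral>z. (\<integral>x. w x *\<^sub>R g (x - z) \<partial>lborel) \<bullet> y z \<partial>lborel)"
    using lborel_pair.Fubini_integral[OF P] by (simp add: inner)
  show "integrable lborel (\<lambda>z. (\<integral>x. w x *\<^sub>R g (x - z) \<partial>lborel) \<bullet> y z)"
    unfolding inner using lborel_pair.integrable_snd[OF P] by simp
qed

end

text \<open>A finite net will replace the cap, so a measurable choice of a maximizer can be built by
  adding one candidate at a time.\<close>

lemma measurable_argmax:
  assumes "finite N" "N \<noteq> {}"
  shows "\<exists>s \<in> borel_measurable borel. \<forall>p::real^3. s p \<in> N \<and> (\<forall>n\<in>N. p \<bullet> n \<le> p \<bullet> s p)"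
  using assms
proof (induction N rule: finite_ne_induct)
  case (singleton x)
  then show ?case by (intro bexI[of _ "\<lambda>_. x"]) auto
next
  case (insert x N)
  then obtain s where s[measurable]: "s \<in> borel_measurable borel" and s': "\<And>p. s p \<in> N" "\<And>p n. n \<in> N \<Longrightarrow> p \<bullet> n \<le> p \<bullet> s p" by metis
  let ?s = "\<lambda>p. if p \<bullet> s p \<le> p \<bullet> x then x else s p"
  have "?s \<in> borel_measurable borel" by measurable
  moreover have "?s p \<in> insert x N \<and> (\<forall>n\<in>insert x N. p \<bullet> n \<le> p \<bullet> ?s p)" for p
    using s'(1)[of p] s'(2)[of _ p] by (auto intro: order_trans)
  ultimately show ?case by (intro bexI[of _ ?s]) auto
qed

section \<open>From the level sets of a smoothed function to a field of large flux\<close>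

context mollifier
begin

definition smooth :: "(real^3 \<Rightarrow> real) \<Rightarrow> real^3 \<Rightarrow> real" where
  "smooth w z = (\<integral>x. \<rho> (x - z) * w x \<partial>lborel)"

text \<open>Minus the gradient of \<open>smooth w\<close>, because the kernel is evaluated at
  \<open>x - z\<close> and differentiated in its argument.\<close>

definition grad_smooth :: "(real^3 \<Rightarrow> real) \<Rightarrow> real^3 \<Rightarrow> real^3" where
  "grad_smooth w z = (\<integral>x. w x *\<^sub>R g (x - z) \<partial>lborel)"

lemma integral_mollifier_shift:
  "integrable lborel (\<lambda>x. \<rho> (x - z))" "(\<integral>x. \<rho> (x - z) \<partial>lborel) = 1"
  "integrable lborel (\<lambda>z. \<rho> (x - z))" "(\<integral>z. \<rho> (x - z) \<partial>lborel) = 1"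
proof -
  have *: "(\<integral>\<^sup>+x. ennreal (\<rho> (x - z)) \<partial>lborel) = 1" for z
  proof -
    have "(\<integral>\<^sup>+x. ennreal (\<rho> x) \<partial>lborel) = (\<integral>\<^sup>+x. ennreal (\<rho> (- z + 1 *\<^sub>R x)) \<partial>lborel)"
      by (subst lborel_nn_integral_affine[where t=1 and c="- z"]) auto
    moreover have "(\<integral>\<^sup>+x. ennreal (\<rho> x) \<partial>lborel) = 1" using integral nonneg by (simp add: nn_integral_eq_integral)
    ultimately show ?thesis by simp
  qed
  show 1: "integrable lborel (\<lambda>x. \<rho> (x - z))" for z
    using * nonneg by (intro integrableI_nonneg) auto
  show 2: "(\<integral>x. \<rho> (x - z) \<partial>lborel) = 1" for z
    using * nonneg by (subst integral_eq_nn_integral) auto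
  have "\<rho> (x - z) = \<rho> (z - x)" for z using even[of "z - x"] by simp
  then show "integrable lborel (\<lambda>z. \<rho> (x - z))" "(\<integral>z. \<rho> (x - z) \<partial>lborel) = 1" using 1 2 by simp_all
qed

text \<open>An average of values in a convex set stays in it. The constraints concern
  \<open>y z + \<nu>\<close>, since \<open>y\<close> itself takes values in the translated
  cap.\<close>

lemma conv_in_cap:
  fixes y :: "real^3 \<Rightarrow> real^3"
  assumes y: "integrable lborel y" and K: "\<And>z. norm (y z + \<nu>) \<le> 1" "\<And>z. - \<beta> \<le> \<nu> \<bullet> (y z + \<nu>)"
  defines "\<phi> \<equiv> \<lambda>x. (\<integral>z. \<rho> (x - z) *\<^sub>R y z \<partial>lborel)"
  shows "norm (\<phi> x + \<nu>) \<le> 1" "- \<beta> \<le> \<nu> \<bullet> (\<phi> x + \<nu>)"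
proof -
  have iy: "integrable lborel (\<lambda>z. \<rho> (x - z) *\<^sub>R y z)" by (rule integrable_conv[OF y])
  have i\<nu>: "integrable lborel (\<lambda>z. \<rho> (x - z) *\<^sub>R \<nu>)" by (intro integrable_scaleR_left integral_mollifier_shift(3))
  have i: "integrable lborel (\<lambda>z. \<rho> (x - z) *\<^sub>R (y z + \<nu>))" using iy i\<nu> by (simp add: scaleR_add_right)
  have eq: "\<phi> x + \<nu> = (\<integral>z. \<rho> (x - z) *\<^sub>R (y z + \<nu>) \<partial>lborel)"
    using iy i\<nu> integral_mollifier_shift(3,4)[of x] by (simp add: scaleR_add_right \<phi>_def)
  have "norm (\<phi> x + \<nu>) \<le> (\<integral>z. norm (\<rho> (x - z) *\<^sub>R (y z + \<nu>)) \<partial>lborel)" unfolding eq by (rule integral_norm_bound)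
  also have "\<dots> \<le> (\<integral>z. \<rho> (x - z) \<partial>lborel)"
  proof (rule integral_mono[OF integrable_norm[OF i] integral_mollifier_shift(3)])
    show "norm (\<rho> (x - z) *\<^sub>R (y z + \<nu>)) \<le> \<rho> (x - z)" for z
      using K(1)[of z] nonneg by (simp add: mult_left_le)
  qed
  finally show "norm (\<phi> x + \<nu>) \<le> 1" using integral_mollifier_shift(4) by simp
  have "- \<beta> = (\<integral>z. \<rho> (x - z) * - \<beta> \<partial>lborel)" using integral_mollifier_shift(4)[of x] by simp
  also have "\<dots> \<le> (\<integral>z. \<rho> (x - z) *\<^sub>R (y z + \<nu>) \<bullet> \<nu> \<partial>lborel)"
  proof (rule integral_mono)
    show "integrable lborel (\<lambda>z. \<rho> (x - z) * - \<beta>)" using integral_mollifier_shift(3)[of x] by simp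
    show "integrable lborel (\<lambda>z. \<rho> (x - z) *\<^sub>R (y z + \<nu>) \<bullet> \<nu>)" using i by (intro integrable_inner_left)
    show "\<rho> (x - z) * - \<beta> \<le> \<rho> (x - z) *\<^sub>R (y z + \<nu>) \<bullet> \<nu>" for z
      using mult_left_mono[OF K(2)[of z] nonneg[of "x - z"]] by (simp add: inner_commute)
  qed
  also have "\<dots> = \<nu> \<bullet> (\<phi> x + \<nu>)"
    unfolding eq using integral_inner_left[of \<nu> lborel "\<lambda>z. \<rho> (x - z) *\<^sub>R (y z + \<nu>)"] i by (simp only: inner_commute[of \<nu>])
  finally show "- \<beta> \<le> \<nu> \<bullet> (\<phi> x + \<nu>)" .
qed

lemma conv_compact_support:
  fixes y :: "real^3 \<Rightarrow> real^3"
  assumes y: "integrable lborel y" and 0: "\<And>z. R < norm z \<Longrightarrow> y z = 0"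
  shows "C1_compact_support (\<lambda>x. \<integral>z. \<rho> (x - z) *\<^sub>R y z \<partial>lborel)"
  unfolding C1_compact_support_iff
proof (intro conjI exI allI impI conv_field(1)[OF y])
  fix x :: "real^3" assume x: "R + \<epsilon> < norm x"
  have "\<rho> (x - z) *\<^sub>R y z = 0" for z
  proof (cases "R < norm z")
    case False
    then have "\<epsilon> \<le> norm (x - z)" using x norm_triangle_ineq2[of x z] by linarith
    then show ?thesis by (simp add: outside)
  qed (simp add: 0)
  then have "(\<integral>z. \<rho> (x - z) *\<^sub>R y z \<partial>lborel) = (\<integral>z. 0 \<partial>(lborel :: (real^3) measure))"
    by (intro Bochner_Integration.integral_cong) auto
  then show "(\<integral>z. \<rho> (x - z) *\<^sub>R y z \<partial>lborel) = 0" by simp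
qed

text \<open>A coarea argument at a positive scale \<open>\<delta>\<close>: the function
  \<open>M\<close> dominates \<open>smooth w (z - \<delta> *\<^sub>R u)\<close> for every
  \<open>u\<close> in \<open>K\<close>, so its level sets contain those of \<open>smooth w\<close>
  enlarged by \<open>\<delta>\<close> times \<open>K\<close>. Brunn-Minkowski compares the volumes
  at each level, the layer cake formula integrates over the levels, and division by
  \<open>\<delta>\<close> leaves the integral of
  \<open>grad_smooth w z \<bullet> y z\<close>.\<close>

lemma level_set_field:
  fixes K :: "(real^3) set"
  assumes w[measurable]: "w \<in> borel_measurable borel" and w01: "\<And>x. 0 \<le> w x" "\<And>x. w x \<le> 1" and w0: "\<And>x. R < norm x \<Longrightarrow> w x = 0"
    and R: "0 < R" and K: "compact K" "0 \<in> K" "K \<subseteq> cball 0 2" "0 < measure lborel K"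
    and \<sigma>: "0 < \<sigma>" "\<sigma> < 1" and m: "0 < m" "\<And>t. 0 < t \<Longrightarrow> t < 1 - \<sigma> \<Longrightarrow> m \<le> measure lborel {z. t < smooth w z}"
    and e: "0 < e"
  shows "\<exists>y. integrable lborel y \<and> (\<forall>z. y z \<in> K) \<and> (\<forall>z. R + \<epsilon> + 2 < norm z \<longrightarrow> y z = 0) \<and>
    3 * root 3 (measure lborel K) * (root 3 m)\<^sup>2 * (1 - \<sigma>) - e \<le> (\<integral>x. w x * (\<integral>z. g (x - z) \<bullet> y z \<partial>lborel) \<partial>lborel)"
proof -
  let ?f = "smooth w" and ?G = "grad_smooth w"
  define Rb where "Rb = R + \<epsilon> + 2"
  define W where "W = (\<integral>x. w x \<partial>lborel)"
  define vol where "vol = measure lborel (cball (0::real^3) Rb)"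
  have wle: "norm (w x) \<le> norm (1 * indicator (cball 0 R) x :: real)" for x
    using w01[of x] w0[of x] by (cases "norm x \<le> R") auto
  have wi: "integrable lborel w"
    by (rule Bochner_Integration.integrable_bound[OF lborel_integrable_indicator_cball[of 1 0 R]]) (use wle in simp_all)
  have W: "0 \<le> W" unfolding W_def using w01 by simp
  have [measurable]: "?f \<in> borel_measurable borel" "?G \<in> borel_measurable borel"
    unfolding smooth_def[abs_def] grad_smooth_def[abs_def] by measurable
  have f0: "0 \<le> ?f z" for z unfolding smooth_def using nonneg w01 by simp
  have f1: "?f z \<le> 1" for z
  proof -
    have "?f z \<le> (\<integral>x. \<rho> (x - z) \<partial>lborel)"
      unfolding smooth_def
    proof (rule integral_mono[OF _ integral_mollifier_shift(1)])
      show "integrable lborel (\<lambda>x. \<rho> (x - z) * w x)"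
        using w01 nonneg by (intro Bochner_Integration.integrable_bound[OF integral_mollifier_shift(1)]) (auto simp: abs_mult intro!: AE_I2 mult_left_le)
      show "\<rho> (x - z) * w x \<le> \<rho> (x - z)" for x using w01 nonneg by (intro mult_left_le) auto
    qed
    then show ?thesis using integral_mollifier_shift(2) by simp
  qed
  have fout: "?f z = 0" if "R + \<epsilon> < norm z" for z
  proof -
    have "\<rho> (x - z) * w x = 0" for x
    proof (cases "R < norm x")
      case False
      then have "\<epsilon> \<le> norm (x - z)" using that norm_triangle_ineq2[of z x] by (simp add: norm_minus_commute)
      then show ?thesis by (simp add: outside)
    qed (simp add: w0)
    then have "smooth w z = (\<integral>x. 0 \<partial>(lborel :: (real^3) measure))"
      unfolding smooth_def by (intro Bochner_Integration.integral_cong) auto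
    then show ?thesis by simp
  qed
  have G: "norm (?G z) \<le> L * W" for z
  proof -
    have "norm (?G z) \<le> (\<integral>x. norm (w x *\<^sub>R g (x - z)) \<partial>lborel)" unfolding grad_smooth_def by (rule integral_norm_bound)
    also have "\<dots> \<le> (\<integral>x. L * w x \<partial>lborel)"
    proof (rule integral_mono')
      show "integrable lborel (\<lambda>x. L * w x)" using wi by simp
      show "norm (w x *\<^sub>R g (x - z)) \<le> L * w x" for x using mult_left_mono[OF bounded(2)[of "x - z"] w01(1)[of x]] w01 by (simp add: mult.commute)
      show "0 \<le> L * w x" for x using pos w01 by simp
    qed
    finally show ?thesis by (simp add: W_def)
  qed
  \<comment> \<open>Two errors are kept below \<open>e / 2\<close> each: a net of mesh
    \<open>\<eta>\<close> costs \<open>L * W * \<eta>\<close> per unit of volume, and the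
    second-order Taylor term costs \<open>4 * C * W * \<delta>\<close>, as vectors of
    \<open>K\<close> have length at most 2.\<close>
  define \<eta> \<delta> where "\<eta> = e / (2 * (L * W * vol + 1))" and "\<delta> = min 1 (e / (2 * (4 * C * W * vol + 1)))"
  have vol: "0 \<le> vol" by (simp add: vol_def)
  have den: "0 < L * W * vol + 1" "0 < 4 * C * W * vol + 1" using vol W pos by (auto intro!: add_nonneg_pos)
  have \<eta>: "0 < \<eta>" "L * W * \<eta> * vol \<le> e / 2"
  proof -
    show "0 < \<eta>" using e den by (simp add: \<eta>_def)
    have "L * W * \<eta> * vol = (e / 2) * (L * W * vol / (L * W * vol + 1))" by (simp add: \<eta>_def)
    also have "\<dots> \<le> (e / 2) * 1" using e den by (intro mult_left_mono) auto
    finally show "L * W * \<eta> * vol \<le> e / 2" by simp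
  qed
  have \<delta>: "0 < \<delta>" "\<delta> \<le> 1" "4 * C * W * \<delta> * vol \<le> e / 2"
  proof -
    show "0 < \<delta>" "\<delta> \<le> 1" using e den by (auto simp: \<delta>_def)
    have "4 * C * W * \<delta> * vol \<le> 4 * C * W * (e / (2 * (4 * C * W * vol + 1))) * vol"
      using vol W pos by (intro mult_right_mono mult_left_mono) (auto simp: \<delta>_def)
    also have "\<dots> = (e / 2) * (4 * C * W * vol / (4 * C * W * vol + 1))" using den by (simp add: field_simps)
    also have "\<dots> \<le> (e / 2) * 1" using e den by (intro mult_left_mono) auto
    finally show "4 * C * W * \<delta> * vol \<le> e / 2" by simp
  qed
  obtain N where N: "finite N" "N \<subseteq> K" "K \<subseteq> (\<Union>n\<in>N. ball n \<eta>)"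
    using compactE_image[OF K(1), of K "\<lambda>n. ball n \<eta>"] \<eta>(1) by (metis UN_I centre_in_ball open_ball subsetI)
  then have "N \<noteq> {}" using K(2) by blast
  then obtain s where s[measurable]: "s \<in> borel_measurable borel" and s': "\<And>p. s p \<in> N" "\<And>p n. n \<in> N \<Longrightarrow> p \<bullet> n \<le> p \<bullet> s p"
    using measurable_argmax[OF N(1)] by metis
  \<comment> \<open>Beyond \<open>Rb\<close> the function \<open>smooth w\<close> and its translates
    by \<open>\<delta>\<close> times \<open>K\<close> vanish. There \<open>y\<close> can be 0, a
    point of \<open>K\<close>, which makes it integrable.\<close>
  define y where "y z = (if norm z \<le> Rb then s (?G z) else 0)" for z
  have [measurable]: "y \<in> borel_measurable borel" unfolding y_def by measurable
  have yK: "y z \<in> K" for z using s'(1)[of "?G z"] N K(2) by (auto simp: y_def)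
  have yi: "integrable lborel y"
  proof (rule Bochner_Integration.integrable_bound[OF lborel_integrable_indicator_cball[of 2 0 Rb]])
    have "norm (y z) \<le> norm (2 * indicator (cball 0 Rb) z :: real)" for z
      using yK[of z] K(3) by (cases "norm z \<le> Rb") (auto simp: y_def)
    then show "AE z in lborel. norm (y z) \<le> norm (2 * indicator (cball 0 Rb) z :: real)" by simp
  qed simp
  define c where "c = L * W * \<eta> + 4 * C * W * \<delta>"
  define M where "M z = indicator (cball 0 Rb) z * (?f z + \<delta> * (?G z \<bullet> y z) + \<delta> * c)" for z
  have [measurable]: "cball (0::real^3) Rb \<in> sets borel" by simp
  have [measurable]: "M \<in> borel_measurable borel" unfolding M_def[abs_def] by measurable
  have key: "?f (z - \<delta> *\<^sub>R u) \<le> M z" if u: "u \<in> K" and z: "norm z \<le> Rb" for z u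
  proof -
    have "?f (z - \<delta> *\<^sub>R u) \<le> ?f z + ?G z \<bullet> (\<delta> *\<^sub>R u) + C * W * (norm (\<delta> *\<^sub>R u))\<^sup>2"
      unfolding smooth_def grad_smooth_def W_def using conv_Taylor[OF wi w01(1)] .
    also have "C * W * (norm (\<delta> *\<^sub>R u))\<^sup>2 \<le> C * W * (\<delta> * 2)\<^sup>2"
      using u K(3) \<delta> W pos by (intro mult_left_mono power_mono) auto
    also have "?G z \<bullet> (\<delta> *\<^sub>R u) \<le> \<delta> * (?G z \<bullet> y z + L * W * \<eta>)"
    proof -
      obtain n where n: "n \<in> N" "dist n u < \<eta>" using N(3) u by auto
      have "?G z \<bullet> u = ?G z \<bullet> n + ?G z \<bullet> (u - n)" by (simp add: inner_diff_right)
      also have "?G z \<bullet> (u - n) \<le> L * W * \<eta>"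
        using n G[of z] order_trans[OF norm_cauchy_schwarz mult_mono[of "norm (?G z)" "L * W" "norm (u - n)" \<eta>]] \<eta> W pos
        by (simp add: dist_norm norm_minus_commute)
      also have "?G z \<bullet> n \<le> ?G z \<bullet> y z" using s'(2)[OF n(1), of "?G z"] z by (simp add: y_def)
      finally show ?thesis using \<delta> by (simp add: mult_left_mono)
    qed
    finally show ?thesis using z by (simp add: M_def c_def power2_eq_square algebra_simps)
  qed
  have fM: "?f z \<le> M z" for z
  proof (cases "norm z \<le> Rb")
    case True
    then show ?thesis using key[OF K(2)] by simp
  next
    case False
    then have "R + \<epsilon> < norm z" by (simp add: Rb_def)
    then show ?thesis using False fout by (simp add: M_def)
  qed
  have M0: "0 \<le> M z" for z using f0 fM order_trans by blast
  have bnd: "norm z \<le> R + \<epsilon>" if "t < ?f z" "0 < t" for t z using fout[of z] that by (cases "norm z \<le> R + \<epsilon>") auto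
  have bndM: "norm z \<le> Rb" if "t < M z" "0 < t" for t z using that by (cases "norm z \<le> Rb") (auto simp: M_def)
  define \<kappa> where "\<kappa> = root 3 (measure lborel K)"
  have \<kappa>: "0 < \<kappa>" using K(4) by (simp add: \<kappa>_def)
  \<comment> \<open>The term of \<open>(a + \<delta> * \<kappa>) ^ 3\<close> linear in
    \<open>\<delta>\<close>, with \<open>root 3 m\<close> as lower bound for
    \<open>a\<close>.\<close>
  define D where "D = 3 * \<delta> * \<kappa> * (root 3 m)\<^sup>2"
  have D: "0 \<le> D" using \<delta> \<kappa> by (simp add: D_def)
  have fin: "emeasure lborel {z. t < h z} < \<infinity>" if "\<And>z. t < h z \<Longrightarrow> norm z \<le> r" for h :: "real^3 \<Rightarrow> real" and t r
  proof -
    have "{z. t < h z} \<subseteq> cball 0 r" using that by auto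
    then have "emeasure lborel {z. t < h z} \<le> emeasure lborel (cball (0::real^3) r)" by (intro emeasure_mono) auto
    then show ?thesis using emeasure_lborel_cball_finite le_less_trans by blast
  qed
  have lev: "emeasure lborel {z. t < ?f z} + ennreal (D * indicator {0<..<1-\<sigma>} t) \<le> emeasure lborel {z. t < M z}" if t: "0 < t" for t
  proof (cases "t < 1 - \<sigma>")
    case False
    then show ?thesis using fM by (auto intro!: emeasure_mono intro: less_le_trans)
  next
    case True
    let ?S = "{z. t < ?f z}" and ?T = "{z. t < M z}" and ?B = "(*\<^sub>R) \<delta> ` K"
    have mS: "m \<le> measure lborel ?S" using m True t by blast
    have KB: "K \<in> sets borel" using K(1) by (simp add: borel_compact)
    have B: "measure lborel ?B = \<delta> ^ 3 * measure lborel K" by (rule measure_scaleR_image3[OF KB \<delta>(1)])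
    have "(root 3 (measure lborel ?S) + root 3 (measure lborel ?B)) ^ 3 \<le> measure lborel ?T"
    proof (rule brunn_minkowski3)
      show "?B \<in> sets borel" using KB \<delta> by (intro sets_scaleR_image) auto
      show "bounded ?S" using bnd t by (auto simp: bounded_iff)
      show "bounded ?T" using bndM t by (auto simp: bounded_iff)
      show "bounded ?B" using K(1) by (intro bounded_scaling compact_imp_bounded)
      show "0 < measure lborel ?S" using mS m by simp
      show "0 < measure lborel ?B" unfolding B using K \<delta> by simp
      fix a b assume a: "a \<in> ?S" and b: "b \<in> ?B"
      then obtain u where u: "u \<in> K" "b = \<delta> *\<^sub>R u" by auto
      have "norm b \<le> 1 * 2" using u K(3) \<delta> unfolding u(2) norm_scaleR by (intro mult_mono) auto
      then have "norm (a + b) \<le> Rb" using bnd[of t a] a t norm_triangle_ineq[of a b] by (simp add: Rb_def)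
      from key[OF u(1) this] show "a + b \<in> ?T" using a u by simp
    qed simp_all
    moreover have "root 3 (measure lborel ?B) = \<delta> * \<kappa>"
      unfolding B \<kappa>_def using \<delta> by (simp add: real_root_mult real_root_power_cancel)
    moreover define a where "a = root 3 (measure lborel ?S)"
    moreover have a: "root 3 m \<le> a" "0 < root 3 m" "a ^ 3 = measure lborel ?S" using mS m by (auto simp: a_def)
    moreover have "a ^ 3 + D \<le> (a + \<delta> * \<kappa>) ^ 3"
    proof -
      have "(root 3 m)\<^sup>2 \<le> a\<^sup>2" using a by (intro power_mono) auto
      then have "D \<le> 3 * \<delta> * \<kappa> * a\<^sup>2" unfolding D_def using \<delta> \<kappa> by (intro mult_left_mono) auto
      moreover have "(a + \<delta> * \<kappa>) ^ 3 = a ^ 3 + 3 * \<delta> * \<kappa> * a\<^sup>2 + 3 * a * (\<delta> * \<kappa>)\<^sup>2 + (\<delta> * \<kappa>) ^ 3"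
        by (simp add: power2_eq_square power3_eq_cube algebra_simps)
      moreover have "0 \<le> a" using a by linarith
      then have "0 \<le> 3 * a * (\<delta> * \<kappa>)\<^sup>2" "0 \<le> (\<delta> * \<kappa>) ^ 3" using \<delta> \<kappa> by auto
      ultimately show ?thesis by linarith
    qed
    ultimately have "measure lborel ?S + D \<le> measure lborel ?T" by simp
    then have "ennreal (measure lborel ?S) + ennreal D \<le> ennreal (measure lborel ?T)"
      using D by (simp flip: ennreal_plus)
    moreover have "emeasure lborel ?S = ennreal (measure lborel ?S)" "emeasure lborel ?T = ennreal (measure lborel ?T)"
      using fin[where h="smooth w" and t=t and r="R + \<epsilon>"] bnd[OF _ t] fin[where h=M and t=t and r=Rb] bndM[OF _ t]
      by (auto simp: emeasure_eq_ennreal_measure)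
    ultimately show ?thesis using True t by simp
  qed
  have "(\<integral>\<^sup>+z. ennreal (?f z) \<partial>lborel) + ennreal (D * (1 - \<sigma>))
      = (\<integral>\<^sup>+t\<in>{0<..}. emeasure lborel {z. t < ?f z} \<partial>lborel) + (\<integral>\<^sup>+t. ennreal D * indicator {0<..<1-\<sigma>} t \<partial>lborel)"
    using f0 \<sigma> D by (subst nn_integral_layer_cake) (auto simp: sigma_finite_lborel nn_integral_cmult_indicator ennreal_mult)
  also have "\<dots> = (\<integral>\<^sup>+t. emeasure lborel {z. t < ?f z} * indicator {0<..} t + ennreal D * indicator {0<..<1-\<sigma>} t \<partial>lborel)"
    by (rule nn_integral_add[symmetric]) measurable
  also have "\<dots> \<le> (\<integral>\<^sup>+t\<in>{0<..}. emeasure lborel {z. t < M z} \<partial>lborel)"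
  proof (rule nn_integral_mono)
    fix t :: real
    show "emeasure lborel {z. t < ?f z} * indicator {0<..} t + ennreal D * indicator {0<..<1-\<sigma>} t \<le> emeasure lborel {z. t < M z} * indicator {0<..} t"
      using lev[of t] by (cases "0 < t") (auto simp: indicator_def)
  qed
  also have "\<dots> = (\<integral>\<^sup>+z. ennreal (M z) \<partial>lborel)"
    using M0 by (subst nn_integral_layer_cake) (auto simp: sigma_finite_lborel)
  finally have nn: "(\<integral>\<^sup>+z. ennreal (?f z) \<partial>lborel) + ennreal (D * (1 - \<sigma>)) \<le> (\<integral>\<^sup>+z. ennreal (M z) \<partial>lborel)" .
  have fi: "integrable lborel ?f"
  proof (rule Bochner_Integration.integrable_bound[OF lborel_integrable_indicator_cball[of 1 0 "R + \<epsilon>"]])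
    have "norm (?f z) \<le> norm (1 * indicator (cball 0 (R + \<epsilon>)) z :: real)" for z
      using f0[of z] f1[of z] fout[of z] by (cases "norm z \<le> R + \<epsilon>") auto
    then show "AE z in lborel. norm (?f z) \<le> norm (1 * indicator (cball 0 (R + \<epsilon>)) z :: real)" by simp
  qed simp
  have Gi: "integrable lborel (\<lambda>z. ?G z \<bullet> y z)" unfolding grad_smooth_def by (rule conv_Fubini(2)[OF wi yi])
  have Meq: "M z = ?f z + \<delta> * (?G z \<bullet> y z) + \<delta> * c * indicator (cball 0 Rb) z" for z
  proof (cases "norm z \<le> Rb")
    case False
    then have "R + \<epsilon> < norm z" by (simp add: Rb_def)
    then show ?thesis using False fout by (simp add: M_def y_def)
  qed (simp add: M_def)
  have Mi: "integrable lborel M" "(\<integral>z. M z \<partial>lborel) = (\<integral>z. ?f z \<partial>lborel) + \<delta> * (\<integral>z. ?G z \<bullet> y z \<partial>lborel) + \<delta> * c * vol"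
    unfolding Meq vol_def using fi Gi lborel_integrable_indicator_cball[of 1 "0::real^3" Rb] by simp_all
  have "ennreal ((\<integral>z. ?f z \<partial>lborel) + D * (1 - \<sigma>)) \<le> ennreal (\<integral>z. M z \<partial>lborel)"
    using nn f0 M0 fi Mi(1) D \<sigma> by (simp add: nn_integral_eq_integral ennreal_plus)
  then have "(\<integral>z. ?f z \<partial>lborel) + D * (1 - \<sigma>) \<le> (\<integral>z. M z \<partial>lborel)"
    using M0 by (subst (asm) ennreal_le_iff) auto
  then have "D * (1 - \<sigma>) \<le> \<delta> * (\<integral>z. ?G z \<bullet> y z \<partial>lborel) + \<delta> * (c * vol)" unfolding Mi(2) by simp
  also have "\<dots> \<le> \<delta> * ((\<integral>z. ?G z \<bullet> y z \<partial>lborel) + e)"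
  proof -
    have "c * vol \<le> e" using \<eta>(2) \<delta>(3) by (simp add: c_def distrib_right)
    then show ?thesis using \<delta> by (simp add: distrib_left)
  qed
  finally have "\<delta> * (3 * \<kappa> * (root 3 m)\<^sup>2 * (1 - \<sigma>)) \<le> \<delta> * ((\<integral>z. ?G z \<bullet> y z \<partial>lborel) + e)" by (simp add: D_def mult_ac)
  then have "3 * \<kappa> * (root 3 m)\<^sup>2 * (1 - \<sigma>) \<le> (\<integral>z. ?G z \<bullet> y z \<partial>lborel) + e" using \<delta>(1) by simp
  then show ?thesis
    using yi yK conv_Fubini(1)[OF wi yi] by (intro exI[of _ y]) (auto simp: \<kappa>_def y_def Rb_def grad_smooth_def)
qed

text \<open>A mass balance for \<open>F\<close>, the smoothing of \<open>w\<close> restricted to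
  \<open>E\<close>. Its integral is at least \<open>(1 - \<tau>') * measure lborel E\<close>, while
  it is at most 1 everywhere, at most \<open>1 - \<sigma>\<close> outside the level set, and 0
  outside \<open>U\<close>. So only little of \<open>E\<close> can miss the level set.\<close>

lemma level_set_volume:
  assumes w[measurable]: "w \<in> borel_measurable borel" and w01: "\<And>x. 0 \<le> w x" "\<And>x. w x \<le> 1"
    and E: "E \<in> sets borel" "emeasure lborel E < \<infinity>" and U[measurable]: "U \<in> sets borel"
    and UC: "emeasure lborel (U - E) \<le> ennreal \<tau>" "0 \<le> \<tau>"
    and CU: "\<And>x z. x \<in> E \<Longrightarrow> dist x z < \<epsilon> \<Longrightarrow> z \<in> U"
    and wC: "\<And>x. x \<in> E \<Longrightarrow> 1 - \<tau>' \<le> w x" and \<tau>': "\<tau>' \<le> 1" and \<sigma>: "0 < \<sigma>" and t: "0 < t" "t < 1 - \<sigma>"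
    and fin: "emeasure lborel {z. t < smooth w z} < \<infinity>"
  shows "measure lborel E - (\<tau>' * measure lborel E + \<tau>) / \<sigma> \<le> measure lborel {z. t < smooth w z}"
proof -
  note E(1)[measurable]
  let ?S = "{z. t < smooth w z}"
  have [measurable]: "smooth w \<in> borel_measurable borel" unfolding smooth_def[abs_def] by measurable
  define F where "F z = (\<integral>\<^sup>+x. ennreal (\<rho> (x - z)) * (indicator E x * ennreal (w x)) \<partial>lborel)" for z
  have iw: "integrable lborel (\<lambda>x. \<rho> (x - z) * w x)" for z
    using w01 nonneg by (intro Bochner_Integration.integrable_bound[OF integral_mollifier_shift(1)]) (auto simp: abs_mult intro!: AE_I2 mult_left_le)
  have Fs: "F z \<le> ennreal (smooth w z)" for z
  proof -
    have "F z \<le> (\<integral>\<^sup>+x. ennreal (\<rho> (x - z) * w x) \<partial>lborel)"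
      unfolding F_def using nonneg w01 by (intro nn_integral_mono) (auto simp: indicator_def ennreal_mult)
    also have "\<dots> = ennreal (smooth w z)"
      unfolding smooth_def using iw nonneg w01 by (intro nn_integral_eq_integral) auto
    finally show ?thesis .
  qed
  have F1: "F z \<le> 1" for z
  proof -
    have "F z \<le> (\<integral>\<^sup>+x. ennreal (\<rho> (x - z)) \<partial>lborel)"
      unfolding F_def using w01 by (intro nn_integral_mono) (auto simp: indicator_def intro!: mult_left_le)
    also have "\<dots> = 1" using integral_mollifier_shift(1,2)[of z] nonneg by (simp add: nn_integral_eq_integral)
    finally show ?thesis .
  qed
  have F0: "F z = 0" if "z \<notin> U" for z
  proof -
    have "ennreal (\<rho> (x - z)) * (indicator E x * ennreal (w x)) = 0" for x
    proof (cases "x \<in> E")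
      case True
      then have "\<epsilon> \<le> norm (x - z)" using CU[of x z] that by (force simp: dist_norm not_less)
      then show ?thesis by (simp add: outside)
    qed simp
    then have "F z = (\<integral>\<^sup>+x. 0 \<partial>(lborel :: (real^3) measure))" unfolding F_def by (intro nn_integral_cong) auto
    then show ?thesis by simp
  qed
  have finC: "emeasure lborel (E \<inter> X) < \<infinity>" if "X \<in> sets borel" for X
    using E(2) by (rule le_less_trans[rotated]) (intro emeasure_mono; auto)
  have "ennreal ((1 - \<tau>') * measure lborel E) = (\<integral>\<^sup>+x. ennreal (1 - \<tau>') * indicator E x \<partial>lborel)"
    using E \<tau>' by (subst nn_integral_cmult_indicator) (auto simp: emeasure_eq_ennreal_measure ennreal_mult)
  also have "\<dots> \<le> (\<integral>\<^sup>+x. indicator E x * ennreal (w x) * (\<integral>\<^sup>+z. ennreal (\<rho> (x - z)) \<partial>lborel) \<partial>lborel)"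
  proof (rule nn_integral_mono)
    fix x
    have "(\<integral>\<^sup>+z. ennreal (\<rho> (x - z)) \<partial>lborel) = 1" using integral_mollifier_shift(3,4)[of x] nonneg by (simp add: nn_integral_eq_integral)
    then show "ennreal (1 - \<tau>') * indicator E x \<le> indicator E x * ennreal (w x) * (\<integral>\<^sup>+z. ennreal (\<rho> (x - z)) \<partial>lborel)"
      using wC[of x] by (auto simp: indicator_def intro!: ennreal_leI)
  qed
  also have "\<dots> = (\<integral>\<^sup>+x. (\<integral>\<^sup>+z. ennreal (\<rho> (x - z)) * (indicator E x * ennreal (w x)) \<partial>lborel) \<partial>lborel)"
    by (intro nn_integral_cong) (subst nn_integral_multc, auto simp: mult.commute)
  also have "\<dots> = (\<integral>\<^sup>+z. F z \<partial>lborel)"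
    unfolding F_def by (rule lborel_pair.Fubini'[symmetric]) measurable
  also have "\<dots> \<le> (\<integral>\<^sup>+z. indicator (E \<inter> ?S) z + ennreal (1 - \<sigma>) * indicator (E \<inter> - ?S) z + indicator (U - E) z \<partial>lborel)"
  proof (rule nn_integral_mono)
    fix z
    have "F z \<le> ennreal (1 - \<sigma>)" if "\<not> t < smooth w z"
      using Fs[of z] that t by (elim order_trans) (auto intro!: ennreal_leI)
    then show "F z \<le> indicator (E \<inter> ?S) z + ennreal (1 - \<sigma>) * indicator (E \<inter> - ?S) z + indicator (U - E) z"
      using F1[of z] F0[of z] CU[of z z] pos by (auto simp: indicator_def)
  qed
  also have "\<dots> = emeasure lborel (E \<inter> ?S) + ennreal (1 - \<sigma>) * emeasure lborel (E \<inter> - ?S) + emeasure lborel (U - E)"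
    by (simp add: nn_integral_add nn_integral_cmult_indicator)
  also have "\<dots> \<le> ennreal (measure lborel (E \<inter> ?S)) + ennreal (1 - \<sigma>) * ennreal (measure lborel (E \<inter> - ?S)) + ennreal \<tau>"
    using finC[of ?S] finC[of "- ?S"] UC by (auto simp: emeasure_eq_ennreal_measure intro!: add_mono)
  also have "\<dots> = ennreal (measure lborel (E \<inter> ?S) + (1 - \<sigma>) * measure lborel (E \<inter> - ?S) + \<tau>)"
    using UC t by (simp add: ennreal_plus ennreal_mult)
  finally have "(1 - \<tau>') * measure lborel E \<le> measure lborel (E \<inter> ?S) + (1 - \<sigma>) * measure lborel (E \<inter> - ?S) + \<tau>"
    using UC t by (subst (asm) ennreal_le_iff) auto
  moreover have CS: "measure lborel E = measure lborel (E \<inter> ?S) + measure lborel (E \<inter> - ?S)"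
  proof -
    have "measure lborel ((E \<inter> ?S) \<union> (E \<inter> - ?S)) = measure lborel (E \<inter> ?S) + measure lborel (E \<inter> - ?S)"
      using finC[of ?S] finC[of "- ?S"] by (intro measure_Union) auto
    moreover have "(E \<inter> ?S) \<union> (E \<inter> - ?S) = E" by auto
    ultimately show ?thesis by simp
  qed
  ultimately have "\<sigma> * measure lborel (E \<inter> - ?S) \<le> \<tau>' * measure lborel E + \<tau>" by (simp add: algebra_simps)
  then have "measure lborel (E \<inter> - ?S) \<le> (\<tau>' * measure lborel E + \<tau>) / \<sigma>" using \<sigma> by (simp add: field_simps)
  moreover have "measure lborel (E \<inter> ?S) \<le> measure lborel ?S"
    using fin by (intro measure_mono_fmeasurable) (auto simp: fmeasurable_def)
  ultimately show ?thesis using CS by linarith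
qed

end

text \<open>The open set surrounds \<open>C\<close> and not \<open>F\<close>: smoothing at a scale
  below the distance from \<open>C\<close> to the complement of \<open>U\<close> then moves mass
  from \<open>C\<close> into \<open>U\<close> only.\<close>

lemma ex_compact_open_approx:
  fixes F :: "(real^3) set"
  assumes F[measurable]: "F \<in> sets borel" and fin: "emeasure lborel F < \<infinity>" and \<tau>: "0 < \<tau>"
  obtains C U where "compact C" "C \<subseteq> F" "measure lborel F - \<tau> \<le> measure lborel C"
    "open U" "C \<subseteq> U" "emeasure lborel (U - C) \<le> ennreal \<tau>"
proof -
  have "(\<lambda>n. measure lborel (F \<inter> cball 0 (real n))) \<longlonglongrightarrow> measure lborel (\<Union>n. F \<inter> cball 0 (real n))"
  proof (rule Lim_measure_incseq)
    show "incseq (\<lambda>n. F \<inter> cball 0 (real n))" by (auto simp: incseq_def)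
    have "emeasure lborel (\<Union>n. F \<inter> cball 0 (real n)) \<le> emeasure lborel F" by (intro emeasure_mono) auto
    then show "emeasure lborel (\<Union>n. F \<inter> cball 0 (real n)) \<noteq> \<infinity>" using fin by auto
  qed auto
  moreover have "(\<Union>n. F \<inter> cball 0 (real n)) = F" by (auto intro: real_arch_simple)
  ultimately have "\<forall>\<^sub>F n in sequentially. measure lborel F - \<tau> / 2 < measure lborel (F \<inter> cball 0 (real n))"
    using \<tau> by (intro order_tendstoD(1)) auto
  then obtain n where n: "measure lborel F - \<tau> / 2 < measure lborel (F \<inter> cball 0 (real n))"
    by (auto simp: eventually_sequentially)
  let ?E = "F \<inter> cball 0 (real n)"
  have "?E \<in> sets lebesgue" by simp
  then obtain C where C: "closed C" "C \<subseteq> ?E" "?E - C \<in> lmeasurable" "emeasure lebesgue (?E - C) < ennreal (\<tau> / 2)"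
    using sets_lebesgue_inner_closed[of ?E "\<tau> / 2"] \<tau> by (metis half_gt_zero)
  have cC: "compact C" using C(1,2) by (meson bounded_cball bounded_subset compact_eq_bounded_closed le_inf_iff)
  have [measurable]: "C \<in> sets borel" using C by simp
  have Ef: "emeasure lborel ?E < \<infinity>" using fin by (rule le_less_trans[rotated]) (intro emeasure_mono; auto)
  have "measure lborel (?E - C) \<le> \<tau> / 2"
  proof -
    have "emeasure lborel (?E - C) \<le> ennreal (\<tau> / 2)" using C(4) by simp
    then show ?thesis unfolding measure_def by (rule enn2real_leI[rotated]) (use \<tau> in simp)
  qed
  moreover have "measure lborel (?E - C) = measure lborel ?E - measure lborel C"
    using Ef C(2) by (intro measure_Diff) auto
  ultimately have CF: "measure lborel F - \<tau> \<le> measure lborel C" using n by simp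
  have "C \<in> sets lebesgue" by simp
  then obtain U where U: "open U" "C \<subseteq> U" "U - C \<in> lmeasurable" "emeasure lebesgue (U - C) < ennreal \<tau>"
    using sets_lebesgue_outer_open[of C \<tau>] \<tau> by metis
  then have "emeasure lborel (U - C) \<le> ennreal \<tau>" by simp
  then show thesis using that cC C(2) CF U by blast
qed

text \<open>The Wulff shape of the capillary problem: for \<open>\<beta>\<close> in [-1, 1] its
  support function is at most 1 on unit vectors and equals \<open>\<beta>\<close> at
  \<open>- \<nu>\<close>, the outer normal of the upper part along the cutting plane.\<close>

definition cap :: "real^3 \<Rightarrow> real \<Rightarrow> (real^3) set" where
  "cap \<nu> \<beta> = {y. norm y \<le> 1 \<and> - \<beta> \<le> \<nu> \<bullet> y}"

lemma closed_cap: "closed (cap \<nu> \<beta>)"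
  unfolding cap_def by (intro closed_Collect_conj closed_Collect_le continuous_intros)

text \<open>Smooth the indicator of \<open>F\<close> to a function \<open>f\<close>, choose at each point the \<open>y\<close> in the cap maximizing
  \<open>- \<nabla>f \<bullet> y\<close>, and smooth this choice to obtain \<open>\<phi>\<close>. Brunn--Minkowski for the level sets of \<open>f\<close> and small multiples of the
  cap bounds the resulting integral of the support function of the cap. The cap is translated by \<open>- \<nu>\<close> to contain
  \<open>0\<close>, so that the choice may vanish outside the support of \<open>f\<close>.\<close>

lemma capillary_isoperimetric:
  assumes F[measurable]: "F \<in> sets borel" and fin: "emeasure lborel F < \<infinity>" and F0: "0 < measure lborel F"
    and \<nu>: "norm \<nu> = 1" and \<beta>: "-1 \<le> \<beta>" and cap0: "0 < measure lborel (cap \<nu> \<beta>)" and e: "0 < e"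
  obtains \<phi> where "bounded_divergence \<phi>" "\<And>x. norm (\<phi> x) \<le> 1" "\<And>x. - \<beta> \<le> \<nu> \<bullet> \<phi> x"
    "3 * root 3 (measure lborel (cap \<nu> \<beta>)) * (root 3 (measure lborel F))\<^sup>2 - e \<le> flux F \<phi>"
proof -
  define v where "v = measure lborel F"
  define \<kappa> where "\<kappa> = root 3 (measure lborel (cap \<nu> \<beta>))"
  have v: "0 < v" using F0 by (simp add: v_def)
  define K where "K = (\<lambda>y. - \<nu> + y) ` cap \<nu> \<beta>"
  have KI: "u \<in> K \<longleftrightarrow> norm (u + \<nu>) \<le> 1 \<and> - \<beta> \<le> \<nu> \<bullet> (u + \<nu>)" for u
    by (auto simp: K_def cap_def image_iff intro!: bexI[of _ "u + \<nu>"])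
  have \<nu>\<nu>: "\<nu> \<bullet> \<nu> = 1" using \<nu> by (simp add: power2_norm_eq_inner[symmetric])
  have K: "compact K" "0 \<in> K" "K \<subseteq> cball 0 2" "measure lborel K = measure lborel (cap \<nu> \<beta>)"
  proof -
    have "bounded (cap \<nu> \<beta>)" by (auto simp: bounded_iff cap_def)
    then have "compact (cap \<nu> \<beta>)" using closed_cap by (simp add: compact_eq_bounded_closed)
    then show "compact K" unfolding K_def by (rule compact_translation)
    show "0 \<in> K" using \<nu> \<nu>\<nu> \<beta> by (simp add: KI)
    show "K \<subseteq> cball 0 2"
    proof
      fix u assume "u \<in> K"
      then have "norm (u + \<nu>) \<le> 1" by (simp add: KI)
      then show "u \<in> cball 0 2" using norm_triangle_ineq4[of "u + \<nu>" \<nu>] \<nu> by simp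
    qed
    have "measure lebesgue K = measure lebesgue (cap \<nu> \<beta>)" unfolding K_def by (rule measure_translation)
    then show "measure lborel K = measure lborel (cap \<nu> \<beta>)"
      using closed_cap \<open>compact K\<close> by (simp add: borel_closed borel_compact measure_completion)
  qed
  \<comment> \<open>A small \<open>\<sigma>\<close> pays for both losses of
    \<open>level_set_field\<close>, the volume \<open>v - \<sigma>\<close> in place of
    \<open>v\<close> and the levels above \<open>1 - \<sigma>\<close>, with
    \<open>e / 4\<close>.\<close>
  have "((\<lambda>\<sigma>. 3 * \<kappa> * (root 3 (v - \<sigma>))\<^sup>2 * (1 - \<sigma>)) \<longlongrightarrow> 3 * \<kappa> * (root 3 (v - 0))\<^sup>2 * (1 - 0)) (at_right 0)"
    by (intro tendsto_intros)
  then have "\<forall>\<^sub>F \<sigma> in at_right 0. 3 * \<kappa> * (root 3 v)\<^sup>2 - e / 4 < 3 * \<kappa> * (root 3 (v - \<sigma>))\<^sup>2 * (1 - \<sigma>)"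
    using e by (intro order_tendstoD(1)) auto
  moreover have "\<forall>\<^sub>F \<sigma> in at_right 0. 0 < \<sigma> \<and> \<sigma> < min 1 v"
    using v by (intro eventually_conj eventually_at_right_less) (auto simp: eventually_at_right_field intro!: exI[of _ "min 1 v"])
  ultimately have "\<forall>\<^sub>F \<sigma> in at_right 0. 3 * \<kappa> * (root 3 v)\<^sup>2 - e / 4 < 3 * \<kappa> * (root 3 (v - \<sigma>))\<^sup>2 * (1 - \<sigma>) \<and> 0 < \<sigma> \<and> \<sigma> < min 1 v"
    by (rule eventually_conj)
  then obtain \<sigma> where \<sigma>: "0 < \<sigma>" "\<sigma> < 1" "\<sigma> < v" "3 * \<kappa> * (root 3 v)\<^sup>2 - e / 4 < 3 * \<kappa> * (root 3 (v - \<sigma>))\<^sup>2 * (1 - \<sigma>)"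
    by (auto dest!: eventually_happens)
  \<comment> \<open>Chosen such that the loss in \<open>level_set_volume\<close> is at most
    \<open>2 * \<sigma> / 3\<close> and the loss from \<open>F\<close> to \<open>C\<close> at most
    \<open>\<sigma> / 3\<close>; every level set then keeps volume
    \<open>v - \<sigma>\<close>.\<close>
  define \<tau> \<tau>' where "\<tau> = \<sigma>\<^sup>2 / 3" and "\<tau>' = \<sigma>\<^sup>2 / (3 * (v + 1))"
  have \<tau>: "0 < \<tau>" "0 < \<tau>'" "\<tau>' \<le> 1" using \<sigma> v power_le_one[of \<sigma> 2] by (auto simp: \<tau>_def \<tau>'_def)
  obtain C U where CU: "compact C" "C \<subseteq> F" "v - \<tau> \<le> measure lborel C"
    "open U" "C \<subseteq> U" "emeasure lborel (U - C) \<le> ennreal \<tau>"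
    unfolding v_def by (rule ex_compact_open_approx[OF F fin \<tau>(1)])
  obtain \<epsilon> where \<epsilon>: "0 < \<epsilon>" "\<And>x z. x \<in> C \<Longrightarrow> dist x z < \<epsilon> \<Longrightarrow> z \<in> U"
  proof -
    have "\<exists>d>0. \<forall>x\<in>C. \<forall>y\<in>- U. d \<le> dist x y"
      using CU by (intro separate_compact_closed) auto
    then show thesis using that by (metis ComplI not_less)
  qed
  obtain \<rho> g Cc L where mol: "mollifier \<rho> g Cc L \<epsilon>" using ex_mollifier[OF \<epsilon>(1)] by blast
  interpret mollifier \<rho> g Cc L \<epsilon> by (rule mol)
  obtain B where B: "0 < B" "\<And>x. x \<in> C \<Longrightarrow> norm x \<le> B"
    using compact_imp_bounded[OF CU(1)] by (auto simp: bounded_pos)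
  \<comment> \<open>The first entry keeps the gradient of the cutoff, integrated over
    \<open>F\<close>, below \<open>e / 4\<close>. The second makes the cutoff at least
    \<open>1 - \<tau>'\<close> on \<open>C\<close>.\<close>
  define r where "r = max (48 * v / e) (B * sqrt (3 / \<tau>'))"
  have r: "0 < r" "12 * v / r \<le> e / 4" "3 * (B / r)\<^sup>2 \<le> \<tau>'"
  proof -
    have "0 < 48 * v / e" using v e by simp
    then show r0: "0 < r" by (simp add: r_def less_max_iff_disj)
    have "48 * v / e \<le> r" by (simp add: r_def)
    then show "12 * v / r \<le> e / 4" using r0 e by (simp add: field_simps)
    have "B * sqrt (3 / \<tau>') \<le> r" by (simp add: r_def)
    then have "(B * sqrt (3 / \<tau>'))\<^sup>2 \<le> r\<^sup>2" using B \<tau> by (intro power_mono) auto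
    then have "B\<^sup>2 * (3 / \<tau>') \<le> r\<^sup>2" using \<tau> by (simp add: power_mult_distrib)
    then show "3 * (B / r)\<^sup>2 \<le> \<tau>'" using \<tau> r0 by (simp add: power_divide field_simps)
  qed
  have [measurable]: "bump \<in> borel_measurable borel" unfolding bump_def[abs_def] by measurable
  define w where "w x = indicator F x * bump (x /\<^sub>R r)" for x
  have w[measurable]: "w \<in> borel_measurable borel" unfolding w_def[abs_def] by measurable
  have w01: "0 \<le> w x" "w x \<le> 1" for x using bump_nonneg[of "x /\<^sub>R r"] bump_le_1[of "x /\<^sub>R r"] by (auto simp: w_def indicator_def)
  have w0: "w x = 0" if "r < norm x" for x
  proof -
    have "1 \<le> norm (x /\<^sub>R r)" using that r by (simp add: field_simps)
    then show ?thesis by (simp add: w_def bump_outside)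
  qed
  have wC: "1 - \<tau>' \<le> w x" if "x \<in> C" for x
  proof -
    have "norm (x /\<^sub>R r) \<le> B / r" using B(2)[OF that] r(1) by (simp add: field_simps)
    then have "(norm (x /\<^sub>R r))\<^sup>2 \<le> (B / r)\<^sup>2" by (intro power_mono) auto
    then have q: "(x /\<^sub>R r) \<bullet> (x /\<^sub>R r) \<le> \<tau>' / 3" using r(3) unfolding power2_norm_eq_inner by linarith
    define p where "p = (x /\<^sub>R r) \<bullet> (x /\<^sub>R r)"
    have p: "0 \<le> p" "p \<le> \<tau>' / 3" unfolding p_def by (rule inner_ge_zero, rule q)
    have "1 + real 3 * (- p) \<le> (1 + (- p)) ^ 3" using p \<tau> by (intro Bernoulli_inequality) auto
    moreover have "bump (x /\<^sub>R r) = (1 - p) ^ 3" unfolding bump_def p_def[symmetric] using p \<tau> by simp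
    ultimately show ?thesis using p that CU(2) by (simp add: w_def subset_eq)
  qed
  have lev: "v - \<sigma> \<le> measure lborel {z. t < smooth w z}" if t: "0 < t" "t < 1 - \<sigma>" for t
  proof -
    have Cb: "C \<in> sets borel" using CU(1) by (simp add: borel_compact)
    have Cf: "emeasure lborel C < \<infinity>" using fin CU(2) by (rule_tac le_less_trans[OF emeasure_mono]) auto
    have sf: "emeasure lborel {z. t < smooth w z} < \<infinity>"
    proof -
      have "norm z \<le> r + \<epsilon>" if "t < smooth w z" for z
      proof (rule ccontr)
        assume z: "\<not> norm z \<le> r + \<epsilon>"
        have "\<rho> (x - z) * w x = 0" for x
        proof (cases "r < norm x")
          case False
          then have "\<epsilon> \<le> norm (x - z)" using z norm_triangle_ineq2[of z x] by (simp add: norm_minus_commute)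
          then show ?thesis by (simp add: outside)
        qed (simp add: w0)
        then have "smooth w z = (\<integral>x. 0 \<partial>(lborel :: (real^3) measure))"
          unfolding smooth_def by (intro Bochner_Integration.integral_cong) auto
        then show False using that t by simp
      qed
      then have "{z. t < smooth w z} \<subseteq> cball 0 (r + \<epsilon>)" by auto
      then have "emeasure lborel {z. t < smooth w z} \<le> emeasure lborel (cball (0::real^3) (r + \<epsilon>))" by (intro emeasure_mono) auto
      then show ?thesis using emeasure_lborel_cball_finite le_less_trans by blast
    qed
    have "measure lborel C - (\<tau>' * measure lborel C + \<tau>) / \<sigma> \<le> measure lborel {z. t < smooth w z}"
      using CU(4) \<tau> by (intro level_set_volume[OF w w01 Cb Cf _ CU(6) _ \<epsilon>(2) wC _ \<sigma>(1) t sf]) auto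
    moreover have "(\<tau>' * measure lborel C + \<tau>) / \<sigma> \<le> 2 * \<sigma> / 3"
    proof -
      have "measure lborel C \<le> v"
        unfolding v_def using fin CU(2) Cb by (intro measure_mono_fmeasurable) (auto simp: fmeasurable_def)
      then have "\<tau>' * measure lborel C \<le> \<tau>' * (v + 1)" using \<tau> by (intro mult_left_mono) auto
      also have "\<dots> = \<sigma>\<^sup>2 / 3" using v by (simp add: \<tau>'_def field_simps)
      finally have "\<tau>' * measure lborel C + \<tau> \<le> 2 * \<sigma>\<^sup>2 / 3" by (simp add: \<tau>_def)
      then show ?thesis using \<sigma> by (simp add: pos_divide_le_eq power2_eq_square)
    qed
    moreover have "\<tau> \<le> \<sigma> / 3" using \<sigma> by (simp add: \<tau>_def power2_eq_square mult_left_le)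
    ultimately show ?thesis using CU(3) by linarith
  qed
  have K0: "0 < measure lborel K" using K(4) cap0 by simp
  have e4: "0 < e / 4" and v\<sigma>: "0 < v - \<sigma>" using e \<sigma> by auto
  have "\<exists>y. integrable lborel y \<and> (\<forall>z. y z \<in> K) \<and> (\<forall>z. r + \<epsilon> + 2 < norm z \<longrightarrow> y z = 0) \<and>
    3 * root 3 (measure lborel K) * (root 3 (v - \<sigma>))\<^sup>2 * (1 - \<sigma>) - e / 4 \<le> (\<integral>x. w x * (\<integral>z. g (x - z) \<bullet> y z \<partial>lborel) \<partial>lborel)"
    by (rule level_set_field[OF w w01 w0 r(1) K(1,2,3) K0 \<sigma>(1,2) v\<sigma> lev e4])
  then obtain y where y0: "integrable lborel y \<and> (\<forall>z. y z \<in> K) \<and> (\<forall>z. r + \<epsilon> + 2 < norm z \<longrightarrow> y z = 0) \<and>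
    3 * root 3 (measure lborel K) * (root 3 (v - \<sigma>))\<^sup>2 * (1 - \<sigma>) - e / 4 \<le> (\<integral>x. w x * (\<integral>z. g (x - z) \<bullet> y z \<partial>lborel) \<partial>lborel)"
    by (rule exE)
  then have y: "integrable lborel y" "\<And>z. y z \<in> K" "\<And>z. r + \<epsilon> + 2 < norm z \<Longrightarrow> y z = 0"
    "3 * root 3 (measure lborel K) * (root 3 (v - \<sigma>))\<^sup>2 * (1 - \<sigma>) - e / 4 \<le> (\<integral>x. w x * (\<integral>z. g (x - z) \<bullet> y z \<partial>lborel) \<partial>lborel)"
    by blast+
  define \<psi> where "\<psi> x = (\<integral>z. \<rho> (x - z) *\<^sub>R y z \<partial>lborel)" for x
  have \<psi>C: "C1_compact_support \<psi>" unfolding \<psi>_def by (rule conv_compact_support[OF y(1,3)])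
  then have \<psi>1: "C1_field \<psi>" by (simp add: C1_compact_support_iff)
  have div\<psi>: "divergence \<psi> x = (\<integral>z. g (x - z) \<bullet> y z \<partial>lborel)" for x unfolding \<psi>_def by (rule conv_field(2)[OF y(1)])
  have \<psi>K: "norm (\<psi> x + \<nu>) \<le> 1" "- \<beta> \<le> \<nu> \<bullet> (\<psi> x + \<nu>)" for x
    unfolding \<psi>_def using y(2) by (auto simp: KI intro!: conv_in_cap[OF y(1)])
  let ?\<theta> = "\<lambda>x. bump (x /\<^sub>R r)" and ?g = "\<lambda>x. grad_bump (x /\<^sub>R r) /\<^sub>R r"
  note sc = C1_field_scale[OF bump_scaled[OF r(1)] \<psi>1]
  have const: "C1_field (\<lambda>x. \<nu>)" "divergence (\<lambda>x. \<nu>) x = 0" for x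
    using C1_fieldI[of "\<lambda>x. \<nu>" "\<lambda>x h. 0"] by (auto simp: trace_field_def)
  \<comment> \<open>The cutoff is the one in \<open>w\<close>, so the integral of \<open>w\<close>
    times the divergence of \<open>\<psi>\<close> is the main part of the flux. Adding
    \<open>\<nu>\<close> undoes the translation of the cap: each value is a convex combination of
    \<open>\<psi> x + \<nu>\<close> and \<open>\<nu>\<close>, both in the cap.\<close>
  define \<phi> where "\<phi> x = ?\<theta> x *\<^sub>R \<psi> x + \<nu>" for x
  have \<phi>1: "C1_field \<phi>" "divergence \<phi> x = ?\<theta> x * divergence \<psi> x + ?g x \<bullet> \<psi> x" for x
    unfolding \<phi>_def using C1_field_add[OF sc(1) const(1)] sc(2) const(2) by auto
  have \<psi>2: "norm (\<psi> x) \<le> 2" for x using norm_triangle_ineq4[of "\<psi> x + \<nu>" \<nu>] \<psi>K(1)[of x] \<nu> by simp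
  have g\<psi>: "\<bar>?g x \<bullet> \<psi> x\<bar> \<le> 12 / r" for x
  proof -
    have "\<bar>grad_bump (x /\<^sub>R r) \<bullet> \<psi> x\<bar> \<le> 6 * 2"
      by (rule order_trans[OF Cauchy_Schwarz_ineq2 mult_mono]) (use norm_grad_bump \<psi>2 in auto)
    then show ?thesis using r(1) by (simp add: abs_mult divide_inverse mult.commute mult_left_mono)
  qed
  obtain R' B' where B': "\<And>x. \<bar>divergence \<psi> x\<bar> \<le> B'" using C1_compact_support_bounds[OF \<psi>C] by metis
  have bd: "bounded_divergence \<phi>"
    unfolding bounded_divergence_def
  proof (intro conjI exI allI \<phi>1(1))
    fix x
    have "\<bar>?\<theta> x * divergence \<psi> x\<bar> \<le> B'"
      using bump_nonneg[of "x /\<^sub>R r"] bump_le_1[of "x /\<^sub>R r"] by (intro abs_mult_le_of_le_1 B') auto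
    then show "\<bar>divergence \<phi> x\<bar> \<le> B' + 12 / r" unfolding \<phi>1(2) using g\<psi>[of x] by linarith
  qed
  have conv: "\<phi> x = ?\<theta> x *\<^sub>R (\<psi> x + \<nu>) + (1 - ?\<theta> x) *\<^sub>R \<nu>" for x by (simp add: \<phi>_def algebra_simps)
  have n1: "norm (\<phi> x) \<le> 1" for x
  proof -
    have "norm (\<phi> x) \<le> ?\<theta> x * norm (\<psi> x + \<nu>) + (1 - ?\<theta> x) * norm \<nu>"
      unfolding conv using bump_nonneg[of "x /\<^sub>R r"] bump_le_1[of "x /\<^sub>R r"] by (intro order_trans[OF norm_triangle_ineq]) simp
    also have "\<dots> \<le> ?\<theta> x * 1 + (1 - ?\<theta> x) * 1"
      using bump_nonneg[of "x /\<^sub>R r"] bump_le_1[of "x /\<^sub>R r"] \<psi>K(1) \<nu> by (intro add_mono mult_left_mono) auto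
    finally show ?thesis by simp
  qed
  have n2: "- \<beta> \<le> \<nu> \<bullet> \<phi> x" for x
  proof -
    have "?\<theta> x * - \<beta> + (1 - ?\<theta> x) * - \<beta> \<le> ?\<theta> x * (\<nu> \<bullet> (\<psi> x + \<nu>)) + (1 - ?\<theta> x) * 1"
      using bump_nonneg[of "x /\<^sub>R r"] bump_le_1[of "x /\<^sub>R r"] \<psi>K(2) \<beta> by (intro add_mono mult_left_mono) auto
    also have "\<dots> = \<nu> \<bullet> \<phi> x" unfolding conv using \<nu>\<nu> by (simp add: inner_add_right)
    finally show ?thesis by (simp add: algebra_simps)
  qed
  have "(\<integral>x. w x * divergence \<psi> x \<partial>lborel) - 12 / r * v \<le> flux F \<phi>"
  proof -
    have i1: "integrable lborel (\<lambda>x. w x * divergence \<psi> x)"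
      using bounded_divergence_integrable[OF C1_compact_support_bounded_divergence[OF \<psi>C] F, of ?\<theta>] fin bump_nonneg bump_le_1
      by (simp add: w_def mult.assoc)
    have i2: "integrable lborel (\<lambda>x. 12 / r * indicator F x)"
      using fin by (intro integrable_mult_right integrable_real_indicator) auto
    have "(\<integral>x. w x * divergence \<psi> x \<partial>lborel) - 12 / r * v = (\<integral>x. w x * divergence \<psi> x - 12 / r * indicator F x \<partial>lborel)"
      using i1 i2 by (simp add: v_def)
    also have "\<dots> \<le> flux F \<phi>"
      unfolding flux_def
    proof (rule integral_mono)
      show "integrable lborel (\<lambda>x. w x * divergence \<psi> x - 12 / r * indicator F x)"
        by (rule Bochner_Integration.integrable_diff[OF i1 i2])
      show "integrable lborel (\<lambda>x. indicator F x * divergence \<phi> x)"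
        using bounded_divergence_integrable[OF bd F, of "\<lambda>_. 1"] fin by simp
      show "w x * divergence \<psi> x - 12 / r * indicator F x \<le> indicator F x * divergence \<phi> x" for x
        using g\<psi>[of x] by (auto simp: w_def \<phi>1(2) indicator_def abs_le_iff)
    qed
    finally show ?thesis .
  qed
  then have "3 * \<kappa> * (root 3 v)\<^sup>2 - e \<le> flux F \<phi>"
    using y(4) \<sigma>(4) r(2) e unfolding div\<psi> K(4) \<kappa>_def times_divide_eq_left by linarith
  then show thesis using that bd n1 n2 by (simp add: v_def \<kappa>_def)
qed

text \<open>With closed levels, because the sets of points of the ball where
  \<open>z \<bullet> u\<close> is at least \<open>t\<close> are the closed caps.\<close>

lemma nn_integral_layer_cake_le:
  fixes f :: "'a \<Rightarrow> real"
  assumes "sigma_finite_measure M" and f[measurable]: "f \<in> borel_measurable M"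
    and "\<And>x. x \<in> space M \<Longrightarrow> 0 \<le> f x"
  shows "(\<integral>\<^sup>+x. ennreal (f x) \<partial>M)
    = (\<integral>\<^sup>+t\<in>{0<..}. emeasure M {x \<in> space M. t \<le> f x} \<partial>lborel)"
proof -
  interpret M: sigma_finite_measure M by fact
  interpret pair_sigma_finite M "lborel :: real measure" ..
  have "(\<integral>\<^sup>+x. ennreal (f x) \<partial>M) = (\<integral>\<^sup>+x. (\<integral>\<^sup>+t. indicator {0<..f x} t \<partial>lborel) \<partial>M)"
    using assms by (intro nn_integral_cong) simp
  also have "\<dots> = (\<integral>\<^sup>+x. (\<integral>\<^sup>+t. (if 0 < t \<and> t \<le> f x then 1 else 0) \<partial>lborel) \<partial>M)"
    by (intro nn_integral_cong) (auto simp: indicator_def)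
  also have "\<dots> = (\<integral>\<^sup>+t. (\<integral>\<^sup>+x. (if 0 < t \<and> t \<le> f x then 1 else 0) \<partial>M) \<partial>lborel)"
    by (rule Fubini'[symmetric]) measurable
  also have "\<dots> = (\<integral>\<^sup>+t\<in>{0<..}. emeasure M {x \<in> space M. t \<le> f x} \<partial>lborel)"
  proof (intro nn_integral_cong)
    fix t :: real
    have "(\<integral>\<^sup>+x. (if 0 < t \<and> t \<le> f x then 1 else 0) \<partial>M)
        = (\<integral>\<^sup>+x. indicator {x \<in> space M. t \<le> f x} x * indicator {0<..} t \<partial>M)"
      by (intro nn_integral_cong) (auto simp: indicator_def)
    also have "\<dots> = emeasure M {x \<in> space M. t \<le> f x} * indicator {0<..} t"
      by (subst nn_integral_multc) simp_all
    finally show "(\<integral>\<^sup>+x. (if 0 < t \<and> t \<le> f x then 1 else 0) \<partial>M)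
      = emeasure M {x \<in> space M. t \<le> f x} * indicator {0<..} t" .
  qed
  finally show ?thesis .
qed

section \<open>Volumes and Coulomb integrals\<close>

text \<open>The sections orthogonal to the axis are discs of area
  \<open>pi * (1 - x\<^sup>2)\<close>, integrated from \<open>- \<beta>\<close> to 1.\<close>

lemma emeasure_cap_axis:
  assumes \<beta>: "-1 \<le> \<beta>" "\<beta> \<le> 1"
  shows "emeasure lborel (cap (axis 1 1) \<beta>) = ennreal (pi * (2/3 + \<beta> - \<beta> ^ 3 / 3))"
proof -
  let ?T = "\<lambda>(x, y, z). vector [x, y, z] :: real^3"
  let ?S = "?T -` cap (axis 1 1) \<beta>"
  have [measurable]: "cap (axis 1 1) \<beta> \<in> sets borel" by (simp add: borel_closed closed_cap)
  have Sb: "?S \<in> sets borel" using measurable_sets[OF borel_measurable_vector3, of "cap (axis 1 1) \<beta>"] by simp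
  have mem: "(x, p) \<in> ?S \<longleftrightarrow> - \<beta> \<le> x \<and> x\<^sup>2 \<le> 1 \<and> p \<in> cball 0 (sqrt (1 - x\<^sup>2))" for x p
  proof -
    obtain y z where p: "p = (y, z)" by (cases p)
    have "norm (vector [x, y, z] :: real^3) \<le> 1 \<longleftrightarrow> x\<^sup>2 + y\<^sup>2 + z\<^sup>2 \<le> 1"
    proof -
      have "(norm (vector [x, y, z] :: real^3))\<^sup>2 = x\<^sup>2 + y\<^sup>2 + z\<^sup>2"
        unfolding power2_norm_eq_inner inner_vec_def UNIV_3 by (simp add: power2_eq_square)
      then show ?thesis using abs_square_le_1[of "norm (vector [x, y, z] :: real^3)"] by simp
    qed
    moreover have "p \<in> cball 0 (sqrt (1 - x\<^sup>2)) \<longleftrightarrow> y\<^sup>2 + z\<^sup>2 \<le> 1 - x\<^sup>2"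
      by (simp add: p norm_Pair)
    moreover have "x\<^sup>2 + y\<^sup>2 + z\<^sup>2 \<le> 1 \<Longrightarrow> x\<^sup>2 \<le> 1" by (smt (verit) zero_le_power2)
    ultimately show ?thesis by (auto simp: p cap_def inner_axis' algebra_simps)
  qed
  have "emeasure lborel (cap (axis 1 1) \<beta>) = emeasure (distr lborel borel ?T) (cap (axis 1 1) \<beta>)" by (simp add: lborel_vector3)
  also have "\<dots> = emeasure (lborel \<Otimes>\<^sub>M lborel) ?S" by (subst emeasure_distr) (auto simp: lborel_prod)
  also have "\<dots> = (\<integral>\<^sup>+x. emeasure lborel (Pair x -` ?S) \<partial>lborel)"
    using Sb by (intro lborel.emeasure_pair_measure_alt) (metis lborel_prod sets_lborel)
  also have "\<dots> = (\<integral>\<^sup>+x. ennreal (pi * (1 - x\<^sup>2)) * indicator {-\<beta>..1} x \<partial>lborel)"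
  proof (rule nn_integral_cong)
    fix x :: real
    show "emeasure lborel (Pair x -` ?S) = ennreal (pi * (1 - x\<^sup>2)) * indicator {-\<beta>..1} x"
    proof (cases "x \<in> {-\<beta>..1}")
      case True
      then have x: "x\<^sup>2 \<le> 1" using \<beta> by (simp add: abs_square_le_1 abs_le_iff)
      have "Pair x -` ?S = cball 0 (sqrt (1 - x\<^sup>2))" using mem[of x] x True by (auto simp del: mem_cball)
      then have "emeasure lborel (Pair x -` ?S) = ennreal (unit_ball_vol (real DIM(real \<times> real)) * sqrt (1 - x\<^sup>2) ^ DIM(real \<times> real))"
        using x by (simp add: emeasure_cball)
      then show ?thesis using True x by (simp add: unit_ball_vol_2)
    next
      case False
      have "Pair x -` ?S = {}" using mem[of x] False by (auto simp: abs_square_le_1 abs_le_iff)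
      then show ?thesis using False by simp
    qed
  qed
  also have "\<dots> = ennreal ((pi * (1 - 1 ^ 3 / 3)) - (pi * (-\<beta> - (-\<beta>) ^ 3 / 3)))"
  proof (rule nn_integral_FTC_Icc[where F="\<lambda>x. pi * (x - x ^ 3 / 3)"])
    show "((\<lambda>x. pi * (x - x ^ 3 / 3)) has_real_derivative pi * (1 - x\<^sup>2)) (at x)" for x
      by (auto intro!: derivative_eq_intros)
    show "0 \<le> pi * (1 - x\<^sup>2)" if "x \<in> {-\<beta>..1}" for x
      using that \<beta> by (simp add: abs_square_le_1 abs_le_iff)
  qed (use \<beta> in auto)
  also have "(pi * (1 - 1 ^ 3 / 3)) - (pi * (-\<beta> - (-\<beta>) ^ 3 / 3)) = pi * (2/3 + \<beta> - \<beta> ^ 3 / 3)"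
    by (simp add: algebra_simps)
  finally show ?thesis .
qed

lemma emeasure_cap:
  assumes \<nu>: "norm \<nu> = 1" and \<beta>: "-1 \<le> \<beta>" "\<beta> \<le> 1"
  shows "emeasure lborel (cap \<nu> \<beta>) = ennreal (pi * (2/3 + \<beta> - \<beta> ^ 3 / 3))"
proof -
  obtain f :: "real^3 \<Rightarrow> real^3" where f: "orthogonal_transformation f" "f (axis 1 1) = \<nu>"
    using orthogonal_transformation_exists[of "axis 1 1" \<nu>] \<nu> by auto
  have inner: "f x \<bullet> f y = x \<bullet> y" and nm: "norm (f x) = norm x" for x y
    using f(1) by (auto simp: orthogonal_transformation_def orthogonal_transformation_norm[OF f(1)])
  have "f ` cap (axis 1 1) \<beta> = cap \<nu> \<beta>"
  proof -
    have "y \<in> f ` cap (axis 1 1) \<beta>" if "y \<in> cap \<nu> \<beta>" for y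
    proof -
      obtain x where "y = f x" using orthogonal_transformation_surj[OF f(1)] by blast
      then show ?thesis using that inner[of "axis 1 1" x] nm f(2) by (auto simp: cap_def)
    qed
    moreover have "f x \<in> cap \<nu> \<beta>" if "x \<in> cap (axis 1 1) \<beta>" for x
      using that inner[of "axis 1 1" x] nm f(2) by (auto simp: cap_def)
    ultimately show ?thesis by blast
  qed
  moreover have lm: "cap u \<beta> \<in> lmeasurable" for u :: "real^3"
  proof -
    have "bounded (cap u \<beta>)" by (auto simp: bounded_iff cap_def)
    then show ?thesis using closed_cap by (simp add: compact_eq_bounded_closed lmeasurable_compact)
  qed
  ultimately have "measure lebesgue (cap \<nu> \<beta>) = measure lebesgue (cap (axis 1 1) \<beta>)"
    using measure_orthogonal_image[OF f(1) lm] by metis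
  then have "emeasure lebesgue (cap \<nu> \<beta>) = emeasure lebesgue (cap (axis 1 1) \<beta>)"
    using lm by (simp add: emeasure_eq_measure2)
  then show ?thesis using emeasure_cap_axis[OF \<beta>] closed_cap by (simp add: borel_closed)
qed

lemma measure_cap:
  assumes \<nu>: "norm \<nu> = 1" and \<beta>: "-1 \<le> \<beta>" "\<beta> \<le> 1"
  shows "measure lborel (cap \<nu> \<beta>) = pi * (2/3 + \<beta> - \<beta> ^ 3 / 3)"
proof -
  have "0 \<le> (1 + \<beta>)\<^sup>2 * (2 - \<beta>) / 3" using \<beta> by simp
  also have "\<dots> = 2/3 + \<beta> - \<beta> ^ 3 / 3" by (simp add: power2_eq_square power3_eq_cube field_simps)
  finally show ?thesis using emeasure_cap[OF assms] by (simp add: measure_def)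
qed

lemma emeasure_ball3: "0 \<le> r \<Longrightarrow> emeasure lborel (cball (c::real^3) r) = ennreal (4 / 3 * pi * r ^ 3)"
  using emeasure_cball[of r c] unit_ball_vol_3 by (simp add: mult_ac)

lemma cap_empty:
  assumes "1 < t" "norm u = 1"
  shows "cap u (- t) = {}"
proof -
  have "u \<bullet> y \<le> norm y" for y using norm_cauchy_schwarz[of u y] assms by simp
  then show ?thesis using assms by (auto simp: cap_def) (metis not_le order_trans)
qed

text \<open>Directions are averaged over the ball with weight \<open>norm z\<close>, which by
  homogeneity amounts to averaging over the sphere. The level sets are caps. Divided by the total
  weight \<open>pi\<close> from \<open>nn_integral_norm_ball\<close>, the constant becomes the mean
  1/4.\<close>

lemma nn_integral_inner_pos_part_ball:
  fixes w :: "real^3"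
  shows "(\<integral>\<^sup>+z\<in>cball 0 1. ennreal (max 0 (z \<bullet> w)) \<partial>lborel) = ennreal (pi / 4 * norm w)"
proof (cases "w = 0")
  case False
  define u where "u = w /\<^sub>R norm w"
  have u: "norm u = 1" and w: "w = norm w *\<^sub>R u" using False by (auto simp: u_def)
  define f where "f z = indicator (cball 0 1) z * max 0 (z \<bullet> u)" for z :: "real^3"
  have [measurable]: "f \<in> borel_measurable borel" unfolding f_def[abs_def]
    by (intro borel_measurable_times borel_measurable_indicator borel_measurable_max) auto
  have lev: "emeasure lborel {z. t \<le> f z} * indicator {0<..} t = ennreal (pi * (2/3 - t + t ^ 3 / 3)) * indicator {0<..1} t" for t
  proof (cases "0 < t")
    case True
    then have "{z. t \<le> f z} = cap u (- t)" by (auto simp: f_def cap_def indicator_def inner_commute)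
    moreover have "cap u (- t) = {}" if "1 < t" using that u by (rule cap_empty)
    ultimately show ?thesis using True emeasure_cap[OF u, of "- t"] by (cases "t \<le> 1") auto
  qed simp
  have "(\<integral>\<^sup>+z. ennreal (f z) \<partial>lborel) = (\<integral>\<^sup>+t. ennreal (pi * (2/3 - t + t ^ 3 / 3)) * indicator {0<..1} t \<partial>lborel)"
    by (subst nn_integral_layer_cake_le) (auto simp: sigma_finite_lborel lev, simp add: f_def)
  also have "\<dots> = (\<integral>\<^sup>+t. ennreal (pi * (2/3 - t + t ^ 3 / 3)) * indicator {0..1} t \<partial>lborel)"
    using AE_lborel_singleton[of "0::real"] by (intro nn_integral_cong_AE) (auto simp: indicator_def)
  also have "\<dots> = ennreal (pi * (2/3 * 1 - 1\<^sup>2 / 2 + 1 ^ 4 / 12) - pi * (2/3 * 0 - 0\<^sup>2 / 2 + 0 ^ 4 / 12))"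
  proof (rule nn_integral_FTC_Icc[where F="\<lambda>t. pi * (2/3 * t - t\<^sup>2 / 2 + t ^ 4 / 12)"])
    show "((\<lambda>t. pi * (2/3 * t - t\<^sup>2 / 2 + t ^ 4 / 12)) has_real_derivative pi * (2/3 - t + t ^ 3 / 3)) (at t)" for t
      by (auto intro!: derivative_eq_intros)
    show "0 \<le> pi * (2/3 - t + t ^ 3 / 3)" if "t \<in> {0..1}" for t
    proof -
      have "0 \<le> (1 - t)\<^sup>2 * (2 + t) / 3" using that by simp
      also have "\<dots> = 2/3 - t + t ^ 3 / 3" by (simp add: power2_eq_square power3_eq_cube field_simps)
      finally show ?thesis by simp
    qed
  qed auto
  finally have "(\<integral>\<^sup>+z. ennreal (f z) \<partial>lborel) = ennreal (pi / 4)" by simp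
  moreover have "ennreal (max 0 (z \<bullet> w)) * indicator (cball 0 1) z = ennreal (norm w) * ennreal (f z)" for z
  proof -
    have "max 0 (z \<bullet> w) = norm w * max 0 (z \<bullet> u)"
      by (subst w) (simp add: max_def zero_le_mult_iff mult_le_0_iff)
    then show ?thesis by (auto simp: f_def indicator_def ennreal_mult)
  qed
  ultimately have "(\<integral>\<^sup>+z\<in>cball 0 1. ennreal (max 0 (z \<bullet> w)) \<partial>lborel) = ennreal (norm w) * ennreal (pi / 4)"
    by (simp add: nn_integral_cmult)
  then show ?thesis by (simp add: mult.commute flip: ennreal_mult)
qed simp

section \<open>Radial integrals and the self-interaction of the ball\<close>

lemma nn_integral_norm_radial:
  fixes h :: "real \<Rightarrow> ennreal"
  assumes [measurable]: "h \<in> borel_measurable borel"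
  shows "(\<integral>\<^sup>+x. h (norm x) \<partial>(lborel :: (real^3) measure)) = (\<integral>\<^sup>+t. ennreal (4 * pi * t\<^sup>2) * indicator {0..} t * h t \<partial>lborel)"
proof -
  let ?M = "distr (lborel :: (real^3) measure) borel norm"
  let ?N = "density lborel (\<lambda>t::real. ennreal (4 * pi * t\<^sup>2) * indicator {0..} t)"
  have M: "emeasure ?M {..a} = (if a < 0 then 0 else ennreal (4 / 3 * pi * a ^ 3))" for a
  proof -
    have "norm -` {..a} = cball (0::real^3) a" by auto
    then show ?thesis using emeasure_ball3[of a 0] by (auto simp: emeasure_distr)
  qed
  have N: "emeasure ?N {..a} = (if a < 0 then 0 else ennreal (4 / 3 * pi * a ^ 3))" for a
  proof (cases "a < 0")
    case False
    have "emeasure ?N {..a} = (\<integral>\<^sup>+t. ennreal (4 * pi * t\<^sup>2) * indicator {0..a} t \<partial>lborel)"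
      by (subst emeasure_density) (auto intro!: nn_integral_cong simp: indicator_def)
    also have "\<dots> = ennreal (4 / 3 * pi * a ^ 3 - 4 / 3 * pi * 0 ^ 3)"
      using False by (intro nn_integral_FTC_Icc) (auto intro!: derivative_eq_intros simp: power2_eq_square)
    finally show ?thesis using False by simp
  next
    case True
    have "emeasure ?N {..a} = (\<integral>\<^sup>+t. 0 \<partial>(lborel :: real measure))"
      using True by (subst emeasure_density) (auto intro!: nn_integral_cong simp del: nn_integral_const simp: indicator_def)
    then show ?thesis using True by simp
  qed
  have "?M = ?N"
  proof (rule measure_eqI_generator_eq[where E="range atMost" and \<Omega>=UNIV and A="\<lambda>i. {..real i}"])
    show "Int_stable (range atMost :: real set set)" by (auto simp: Int_stable_def)
    show "emeasure ?M X = emeasure ?N X" if "X \<in> range atMost" for X using that M N by auto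
    show "sets ?M = sigma_sets UNIV (range atMost)" "sets ?N = sigma_sets UNIV (range atMost)"
      by (simp_all add: borel_eq_atMost)
    show "(\<Union>i. {..real i}) = UNIV" by (auto intro: real_arch_simple)
    show "emeasure ?M {..real i} \<noteq> \<infinity>" for i by (simp add: M)
  qed auto
  then have "(\<integral>\<^sup>+x. h x \<partial>?M) = (\<integral>\<^sup>+x. h x \<partial>?N)" by simp
  then show ?thesis by (simp add: nn_integral_distr nn_integral_density)
qed

lemma nn_integral_norm_ball: "(\<integral>\<^sup>+z\<in>cball (0::real^3) 1. ennreal (norm z) \<partial>lborel) = ennreal pi"
proof -
  have "(\<integral>\<^sup>+z\<in>cball (0::real^3) 1. ennreal (norm z) \<partial>lborel) = (\<integral>\<^sup>+z. ennreal (norm (z::real^3)) * indicator {..1} (norm z) \<partial>lborel)"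
    by (intro nn_integral_cong) (auto simp: indicator_def)
  also have "\<dots> = (\<integral>\<^sup>+t. ennreal (4 * pi * t\<^sup>2) * indicator {0..} t * (ennreal t * indicator {..1} t) \<partial>lborel)"
    by (rule nn_integral_norm_radial) measurable
  also have "\<dots> = (\<integral>\<^sup>+t. ennreal (4 * pi * t ^ 3) * indicator {0..1} t \<partial>lborel)"
    by (intro nn_integral_cong) (auto simp: indicator_def power2_eq_square power3_eq_cube mult_ac simp flip: ennreal_mult)
  also have "\<dots> = ennreal (pi * 1 ^ 4 - pi * 0 ^ 4)"
    by (intro nn_integral_FTC_Icc) (auto intro!: derivative_eq_intros)
  finally show ?thesis by simp
qed

text \<open>Normalized without the factor 1/2: for disjoint sets it is the interaction energy, and
  on the diagonal it is twice the Coulomb energy. This is the origin of the bounds of the form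
  \<open>ennreal (2 * d)\<close> below.\<close>

definition coulomb :: "(real^3) set \<Rightarrow> (real^3) set \<Rightarrow> ennreal" where
  "coulomb F G = (\<integral>\<^sup>+x. \<integral>\<^sup>+y. indicator F x * indicator G y * ennreal (1 / norm (x - y)) \<partial>lborel \<partial>lborel)"

text \<open>The plane halfway between the two centres splits the lens into two parts, each contained
  in a cap at distance \<open>norm h / 2\<close> from the centre of its ball.\<close>

lemma emeasure_lens:
  fixes h :: "real^3"
  assumes h: "h \<noteq> 0"
  shows "emeasure lborel {x. x \<in> cball 0 1 \<and> x - h \<in> cball 0 1}
    \<le> ennreal (2 * pi * (2/3 - norm h / 2 + norm h ^ 3 / 24)) * indicator {..2} (norm h)"
proof -
  define u where "u = h /\<^sub>R norm h"
  define s where "s = norm h / 2"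
  have u: "norm u = 1" "norm (- u) = 1" and hu: "h = (2 * s) *\<^sub>R u" and s: "0 < s" using h by (auto simp: u_def s_def)
  let ?L = "{x. x \<in> cball 0 1 \<and> x - h \<in> cball 0 1}"
  have uu: "u \<bullet> u = 1" using u by (simp add: power2_norm_eq_inner[symmetric])
  have sub: "?L \<subseteq> cap u (- s) \<union> (+) h ` cap (- u) (- s)"
  proof
    fix x assume x: "x \<in> ?L"
    show "x \<in> cap u (- s) \<union> (+) h ` cap (- u) (- s)"
    proof (cases "s \<le> u \<bullet> x")
      case True
      then show ?thesis using x by (simp add: cap_def)
    next
      case False
      then have "x - h \<in> cap (- u) (- s)" using x by (simp add: cap_def inner_diff_right hu uu)
      then show ?thesis by (metis UnI2 add.commute diff_add_cancel image_eqI)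
    qed
  qed
  have tr: "emeasure lborel ((+) h ` cap (- u) (- s)) = emeasure lborel (cap (- u) (- s))"
  proof -
    have "emeasure lebesgue ((\<lambda>x. 1 *\<^sub>R x + h) ` cap (- u) (- s)) = emeasure lebesgue (cap (- u) (- s))"
      using emeasure_lebesgue_affine[of 1 h "cap (- u) (- s)"] by simp
    moreover have "(\<lambda>x. 1 *\<^sub>R x + h) ` cap (- u) (- s) = (+) h ` cap (- u) (- s)" by (auto simp: add.commute)
    moreover have "closed ((+) h ` cap (- u) (- s))" by (intro closed_translation closed_cap)
    ultimately show ?thesis by (simp add: borel_closed closed_cap)
  qed
  have "emeasure lborel ?L \<le> emeasure lborel (cap u (- s) \<union> (+) h ` cap (- u) (- s))"
    using sub closed_cap by (intro emeasure_mono) (auto intro!: borel_closed closed_Un closed_translation)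
  also have "\<dots> \<le> emeasure lborel (cap u (- s)) + emeasure lborel (cap (- u) (- s))"
    unfolding tr[symmetric] by (intro emeasure_subadditive) (auto intro!: borel_closed closed_translation closed_cap)
  also have "\<dots> \<le> ennreal (2 * pi * (2/3 - norm h / 2 + norm h ^ 3 / 24)) * indicator {..2} (norm h)"
  proof (cases "s \<le> 1")
    case True
    have "0 \<le> (1 - s)\<^sup>2 * (2 + s) / 3" using s by simp
    also have "\<dots> = 2/3 - s + s ^ 3 / 3" by (simp add: power2_eq_square power3_eq_cube field_simps)
    finally have "0 \<le> pi * (2/3 - s + s ^ 3 / 3)" by simp
    then have "emeasure lborel (cap u (- s)) + emeasure lborel (cap (- u) (- s)) = ennreal (2 * (pi * (2/3 - s + s ^ 3 / 3)))"
      using emeasure_cap[OF u(1), of "- s"] emeasure_cap[OF u(2), of "- s"] s True by (simp flip: ennreal_plus)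
    then show ?thesis using True by (simp add: s_def power_divide mult.assoc)
  next
    case False
    then show ?thesis using cap_empty u by simp
  qed
  finally show ?thesis .
qed

text \<open>After the substitution \<open>h = x - y\<close> the inner integral is the volume of a
  lens times a factor depending on \<open>norm h\<close> only, so the rest is a radial
  integral.\<close>

lemma coulomb_unit_ball: "coulomb (cball 0 1) (cball 0 1) \<le> ennreal (32 / 15 * pi\<^sup>2)"
proof -
  let ?B = "cball (0::real^3) 1"
  have [measurable]: "?B \<in> sets borel" by simp
  have "coulomb ?B ?B = (\<integral>\<^sup>+x. \<integral>\<^sup>+h. indicator ?B x * indicator ?B (x - h) * ennreal (1 / norm h) \<partial>lborel \<partial>lborel)"
    unfolding coulomb_def
  proof (rule nn_integral_cong)
    fix x :: "real^3"
    show "(\<integral>\<^sup>+y. indicator ?B x * indicator ?B y * ennreal (1 / norm (x - y)) \<partial>lborel) = (\<integral>\<^sup>+h. indicator ?B x * indicator ?B (x - h) * ennreal (1 / norm h) \<partial>lborel)"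
      by (subst lborel_nn_integral_affine[where t="-1" and c=x]) simp_all
  qed
  also have "\<dots> = (\<integral>\<^sup>+h. \<integral>\<^sup>+x. indicator ?B x * indicator ?B (x - h) * ennreal (1 / norm h) \<partial>lborel \<partial>lborel)"
    by (rule lborel_pair.Fubini'[symmetric]) measurable
  also have "\<dots> \<le> (\<integral>\<^sup>+h. ennreal (2 * pi * (2/3 - norm h / 2 + norm h ^ 3 / 24)) * indicator {..2} (norm h) * ennreal (1 / norm h) \<partial>(lborel :: (real^3) measure))"
  proof (rule nn_integral_mono_AE)
    have "(\<integral>\<^sup>+x. indicator ?B x * indicator ?B (x - h) * ennreal (1 / norm h) \<partial>lborel)
        \<le> ennreal (2 * pi * (2/3 - norm h / 2 + norm h ^ 3 / 24)) * indicator {..2} (norm h) * ennreal (1 / norm h)" if "h \<noteq> 0" for h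
    proof -
      have "(\<integral>\<^sup>+x. indicator ?B x * indicator ?B (x - h) * ennreal (1 / norm h) \<partial>lborel)
          = (\<integral>\<^sup>+x. indicator {x. x \<in> ?B \<and> x - h \<in> ?B} x * ennreal (1 / norm h) \<partial>lborel)"
        by (intro nn_integral_cong) (simp add: indicator_def)
      also have "\<dots> = emeasure lborel {x. x \<in> ?B \<and> x - h \<in> ?B} * ennreal (1 / norm h)"
      proof (subst nn_integral_multc)
        have "{x. x \<in> ?B \<and> x - h \<in> ?B} \<in> sets borel" by measurable
        then show "indicator {x. x \<in> ?B \<and> x - h \<in> ?B} \<in> borel_measurable lborel"
          "(\<integral>\<^sup>+x. indicator {x. x \<in> ?B \<and> x - h \<in> ?B} x \<partial>lborel) * ennreal (1 / norm h) = emeasure lborel {x. x \<in> ?B \<and> x - h \<in> ?B} * ennreal (1 / norm h)"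
          by simp_all
      qed
      also have "\<dots> \<le> ennreal (2 * pi * (2/3 - norm h / 2 + norm h ^ 3 / 24)) * indicator {..2} (norm h) * ennreal (1 / norm h)"
        by (rule mult_right_mono[OF emeasure_lens[OF that]]) simp
      finally show ?thesis .
    qed
    then show "AE h in lborel. (\<integral>\<^sup>+x. indicator ?B x * indicator ?B (x - h) * ennreal (1 / norm h) \<partial>lborel)
        \<le> ennreal (2 * pi * (2/3 - norm h / 2 + norm h ^ 3 / 24)) * indicator {..2} (norm h) * ennreal (1 / norm h)"
      using AE_lborel_singleton[of "0::real^3"] by auto
  qed
  also have "\<dots> = (\<integral>\<^sup>+t. ennreal (4 * pi * t\<^sup>2) * indicator {0..} t * (ennreal (2 * pi * (2/3 - t / 2 + t ^ 3 / 24)) * indicator {..2} t * ennreal (1 / t)) \<partial>lborel)"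
    by (rule nn_integral_norm_radial) measurable
  also have "\<dots> = (\<integral>\<^sup>+t. ennreal (8 * pi\<^sup>2 * (2/3 * t - t\<^sup>2 / 2 + t ^ 4 / 24)) * indicator {0..2} t \<partial>lborel)"
  proof (rule nn_integral_cong)
    fix t :: real
    consider "t < 0" | "t = 0" | "0 < t" "t \<le> 2" | "2 < t" by linarith
    then show "ennreal (4 * pi * t\<^sup>2) * indicator {0..} t * (ennreal (2 * pi * (2/3 - t / 2 + t ^ 3 / 24)) * indicator {..2} t * ennreal (1 / t))
        = ennreal (8 * pi\<^sup>2 * (2/3 * t - t\<^sup>2 / 2 + t ^ 4 / 24)) * indicator {0..2} t"
    proof cases
      case 3
      have "0 \<le> (2 - t)\<^sup>2 * (4 + t) / 24" using 3 by simp
      also have "\<dots> = 2/3 - t / 2 + t ^ 3 / 24" by (simp add: power2_eq_square power3_eq_cube field_simps)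
      finally have "0 \<le> 2/3 - t / 2 + t ^ 3 / 24" .
      moreover have "8 * pi\<^sup>2 * (2/3 * t - t\<^sup>2 / 2 + t ^ 4 / 24) = (4 * pi * t\<^sup>2) * ((2 * pi * (2/3 - t / 2 + t ^ 3 / 24)) * (1 / t))"
        using 3 by (simp add: power2_eq_square power3_eq_cube power4_eq_xxxx field_simps)
      ultimately have "ennreal (8 * pi\<^sup>2 * (2/3 * t - t\<^sup>2 / 2 + t ^ 4 / 24)) = ennreal (4 * pi * t\<^sup>2) * (ennreal (2 * pi * (2/3 - t / 2 + t ^ 3 / 24)) * ennreal (1 / t))"
        using 3 by (simp only: ennreal_mult[symmetric] zero_le_mult_iff) (simp add: ennreal_mult[symmetric])
      then show ?thesis using 3 by simp
    qed auto
  qed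
  also have "\<dots> = ennreal (8 * pi\<^sup>2 * (2\<^sup>2 / 3 - 2 ^ 3 / 6 + 2 ^ 5 / 120) - 8 * pi\<^sup>2 * (0\<^sup>2 / 3 - 0 ^ 3 / 6 + 0 ^ 5 / 120))"
  proof (rule nn_integral_FTC_Icc[where F="\<lambda>t. 8 * pi\<^sup>2 * (t\<^sup>2 / 3 - t ^ 3 / 6 + t ^ 5 / 120)"])
    show "((\<lambda>t. 8 * pi\<^sup>2 * (t\<^sup>2 / 3 - t ^ 3 / 6 + t ^ 5 / 120)) has_real_derivative 8 * pi\<^sup>2 * (2/3 * t - t\<^sup>2 / 2 + t ^ 4 / 24)) (at t)" for t
      by (auto intro!: derivative_eq_intros)
    show "0 \<le> 8 * pi\<^sup>2 * (2/3 * t - t\<^sup>2 / 2 + t ^ 4 / 24)" if "t \<in> {0..2}" for t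
    proof -
      have "0 \<le> t * ((2 - t)\<^sup>2 * (4 + t) / 24)" using that by simp
      also have "\<dots> = 2/3 * t - t\<^sup>2 / 2 + t ^ 4 / 24" by (simp add: power2_eq_square power4_eq_xxxx field_simps)
      finally show ?thesis by simp
    qed
  qed auto
  finally show ?thesis by simp
qed

section \<open>Borel representatives, additivity and scaling of the Coulomb integral\<close>

lemma coulomb_measurable[measurable]:
  assumes [measurable]: "F \<in> sets borel" "G \<in> sets borel"
  shows "(\<lambda>(x, y). indicator F x * indicator G y * ennreal (1 / norm (x - y))) \<in> borel_measurable (lborel \<Otimes>\<^sub>M (lborel :: (real^3) measure))"
  by measurable

lemma sigma_finite_lebesgue: "sigma_finite_measure (lebesgue :: 'a::euclidean_space measure)"
proof
  show "\<exists>A. countable A \<and> A \<subseteq> sets lebesgue \<and> \<Union> A = space (lebesgue :: 'a measure) \<and> (\<forall>a\<in>A. emeasure lebesgue a \<noteq> \<infinity>)"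
  proof (intro exI conjI)
    show "countable (range (\<lambda>n. cball (0::'a) (real n)))" by simp
    show "\<Union> (range (\<lambda>n. cball (0::'a) (real n))) = space lebesgue" by (auto intro: real_arch_simple)
    show "\<forall>a\<in>range (\<lambda>n. cball (0::'a) (real n)). emeasure lebesgue a \<noteq> \<infinity>"
      using emeasure_lborel_cball_finite[of "0::'a"] by (auto simp: less_top[symmetric])
  qed auto
qed

lemma coulomb_energy_lebesgue:
  assumes \<Omega>: "\<Omega> \<in> sets lebesgue"
  shows "coulomb_energy \<Omega> = (1/2) * coulomb \<Omega> \<Omega>"
proof -
  interpret L: sigma_finite_measure "lebesgue :: (real^3) measure" by (rule sigma_finite_lebesgue)
  have id: "(\<lambda>x. x) \<in> (lebesgue :: (real^3) measure) \<rightarrow>\<^sub>M borel" by (simp add: measurable_completion)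
  have 1: "(\<lambda>z. fst z) \<in> (lebesgue \<Otimes>\<^sub>M lebesgue) \<rightarrow>\<^sub>M (borel :: (real^3) measure)"
    "(\<lambda>z. snd z) \<in> (lebesgue \<Otimes>\<^sub>M lebesgue) \<rightarrow>\<^sub>M (borel :: (real^3) measure)"
    by (rule measurable_compose[OF measurable_fst id] measurable_compose[OF measurable_snd id])+
  have m: "(\<lambda>z. ennreal (1 / norm (fst z - snd z)) * indicator (\<Omega> \<times> \<Omega>) z) \<in> borel_measurable (lebesgue \<Otimes>\<^sub>M lebesgue)"
  proof (rule borel_measurable_times_ennreal)
    show "(\<lambda>z. ennreal (1 / norm (fst z - snd z))) \<in> borel_measurable (lebesgue \<Otimes>\<^sub>M (lebesgue :: (real^3) measure))"
      using measurable_compose[OF borel_measurable_diff[OF 1], of "\<lambda>u. ennreal (1 / norm u)" borel] by simp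
    show "indicator (\<Omega> \<times> \<Omega>) \<in> borel_measurable (lebesgue \<Otimes>\<^sub>M lebesgue)"
      by (rule borel_measurable_indicator[OF pair_measureI[OF \<Omega> \<Omega>]])
  qed
  have "(\<integral>\<^sup>+ z\<in>\<Omega> \<times> \<Omega>. ennreal (1 / norm (fst z - snd z)) \<partial>(lebesgue \<Otimes>\<^sub>M lebesgue))
      = (\<integral>\<^sup>+x. \<integral>\<^sup>+y. ennreal (1 / norm (x - y)) * indicator (\<Omega> \<times> \<Omega>) (x, y) \<partial>lebesgue \<partial>lebesgue)"
    using L.nn_integral_fst[OF m] by simp
  also have "\<dots> = coulomb \<Omega> \<Omega>"
    unfolding coulomb_def nn_integral_completion by (intro nn_integral_cong) (auto simp: indicator_def)
  finally show ?thesis by (simp add: coulomb_energy_def)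
qed

text \<open>Volume, test integrals and Coulomb integrals ignore null sets, so a minimizer can be
  taken to be Borel.\<close>

lemma borel_representative:
  assumes \<Omega>: "\<Omega> \<in> sets lebesgue"
  obtains \<Omega>' where "\<Omega>' \<in> sets borel" "emeasure lborel \<Omega>' = emeasure lebesgue \<Omega>"
    "liquid_drop_energy \<Omega> = perimeter \<Omega>' + (1/2) * coulomb \<Omega>' \<Omega>'"
proof -
  obtain S N N' where SN: "\<Omega> = S \<union> N" "N \<subseteq> N'" "N' \<in> null_sets lborel" "S \<in> sets lborel"
    using sets_completionE[OF \<Omega>] by metis
  have S[measurable]: "S \<in> sets borel" using SN by simp
  have AE: "AE x in lborel. x \<in> \<Omega> \<longleftrightarrow> x \<in> S"
    using AE_not_in[OF SN(3)] by eventually_elim (use SN in auto)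
  have "perimeter \<Omega> = perimeter S"
    unfolding perimeter_def
  proof (intro SUP_cong refl arg_cong[where f=ennreal])
    fix \<phi> assume "\<phi> \<in> {\<phi>. C1_compact_support \<phi> \<and> (\<forall>x. norm (\<phi> x) \<le> 1)}"
    then have d: "divergence \<phi> \<in> borel_measurable borel" by (simp add: C1_compact_support_iff divergence_measurable)
    show "(LINT x:\<Omega>|lebesgue. divergence \<phi> x) = (LINT x:S|lebesgue. divergence \<phi> x)"
      unfolding set_lebesgue_integral_def
    proof (rule integral_cong_AE)
      have d': "divergence \<phi> \<in> borel_measurable lebesgue" using d by (simp add: measurable_completion)
      show "(\<lambda>x. indicat_real \<Omega> x *\<^sub>R divergence \<phi> x) \<in> borel_measurable lebesgue"
        using \<Omega> d' by (intro borel_measurable_scaleR borel_measurable_indicator) auto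
      show "(\<lambda>x. indicat_real S x *\<^sub>R divergence \<phi> x) \<in> borel_measurable lebesgue"
        using d' by (intro borel_measurable_scaleR borel_measurable_indicator) auto
      show "AE x in lebesgue. indicat_real \<Omega> x *\<^sub>R divergence \<phi> x = indicat_real S x *\<^sub>R divergence \<phi> x"
        using AE_completion[OF AE] by eventually_elim (simp add: indicator_def)
    qed
  qed
  moreover have "coulomb \<Omega> \<Omega> = coulomb S S"
    unfolding coulomb_def
  proof (rule nn_integral_cong_AE)
    show "AE x in lborel. (\<integral>\<^sup>+y. indicator \<Omega> x * indicator \<Omega> y * ennreal (1 / norm (x - y)) \<partial>lborel) = (\<integral>\<^sup>+y. indicator S x * indicator S y * ennreal (1 / norm (x - y)) \<partial>lborel)"
      using AE
    proof eventually_elim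
      case (elim x)
      show ?case
        by (rule nn_integral_cong_AE) (use AE in \<open>eventually_elim, simp add: elim indicator_def\<close>)
    qed
  qed
  moreover have "emeasure lborel S = emeasure lebesgue \<Omega>"
  proof -
    have "emeasure lebesgue \<Omega> = emeasure lebesgue S"
      using AE_completion[OF AE] \<Omega> by (intro emeasure_eq_AE) auto
    then show ?thesis by simp
  qed
  ultimately show thesis
    using that[OF S] coulomb_energy_lebesgue[OF \<Omega>] by (simp add: liquid_drop_energy_def)
qed

lemma min_energy_le:
  assumes "\<Omega> \<in> sets borel" "emeasure lborel \<Omega> = ennreal A"
  shows "min_energy A \<le> perimeter \<Omega> + (1/2) * coulomb \<Omega> \<Omega>"
proof -
  have "min_energy A \<le> liquid_drop_energy \<Omega>"
    unfolding min_energy_def using assms by (intro INF_lower) auto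
  then show ?thesis using assms coulomb_energy_lebesgue[of \<Omega>] by (simp add: liquid_drop_energy_def)
qed

lemma coulomb_commute:
  assumes [measurable]: "F \<in> sets borel" "G \<in> sets borel"
  shows "coulomb F G = coulomb G F"
proof -
  have "coulomb F G = (\<integral>\<^sup>+y. \<integral>\<^sup>+x. indicator F x * indicator G y * ennreal (1 / norm (x - y)) \<partial>lborel \<partial>lborel)"
    unfolding coulomb_def by (rule lborel_pair.Fubini'[symmetric]) measurable
  then show ?thesis by (simp add: coulomb_def norm_minus_commute mult.commute[of "indicator F _"])
qed

lemma coulomb_Un_left:
  assumes [measurable]: "A \<in> sets borel" "B \<in> sets borel" "G \<in> sets borel" and "A \<inter> B = {}"
  shows "coulomb (A \<union> B) G = coulomb A G + coulomb B G"
proof -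
  have ind: "indicator (A \<union> B) x = (indicator A x + indicator B x :: ennreal)" for x
    using assms(4) by (auto simp: indicator_def)
  show ?thesis
    unfolding coulomb_def ind distrib_right by (subst nn_integral_add[symmetric], measurable, subst nn_integral_add, measurable)
qed

lemma coulomb_Un:
  assumes [measurable]: "A \<in> sets borel" "B \<in> sets borel" and "A \<inter> B = {}"
  shows "coulomb (A \<union> B) (A \<union> B) = coulomb A A + coulomb B B + 2 * coulomb A B"
proof -
  have "coulomb (A \<union> B) (A \<union> B) = coulomb A (A \<union> B) + coulomb B (A \<union> B)" using assms by (simp add: coulomb_Un_left)
  also have "coulomb A (A \<union> B) = coulomb A A + coulomb A B"
    using assms coulomb_commute[of A "A \<union> B"] coulomb_commute[of A B] by (simp add: coulomb_Un_left)
  also have "coulomb B (A \<union> B) = coulomb A B + coulomb B B"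
    using assms coulomb_commute[of B "A \<union> B"] by (simp add: coulomb_Un_left)
  finally show ?thesis by (simp add: mult_2 add_ac)
qed

lemma coulomb_affine:
  fixes t :: real
  assumes [measurable]: "F \<in> sets borel" "G \<in> sets borel" "F' \<in> sets borel" "G' \<in> sets borel" and t: "0 < t"
    and eq: "\<And>x. c + t *\<^sub>R x \<in> F' \<longleftrightarrow> x \<in> F" "\<And>x. c + t *\<^sub>R x \<in> G' \<longleftrightarrow> x \<in> G"
  shows "coulomb F' G' = ennreal (t ^ 5) * coulomb F G"
proof -
  let ?k = "\<lambda>F G x y. indicator F x * indicator G y * ennreal (1 / norm (x - y))"
  have k: "?k F' G' (c + t *\<^sub>R x) (c + t *\<^sub>R y) = ennreal (1 / t) * ?k F G x y" for x y
  proof -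
    have "norm (c + t *\<^sub>R x - (c + t *\<^sub>R y)) = t * norm (x - y)" using t by (simp flip: scaleR_diff_right)
    then have "ennreal (1 / norm (c + t *\<^sub>R x - (c + t *\<^sub>R y))) = ennreal (1 / t) * ennreal (1 / norm (x - y))"
      using t by (simp flip: ennreal_mult)
    then show ?thesis by (simp add: indicator_def eq)
  qed
  have "coulomb F' G' = ennreal (t ^ 3) * (\<integral>\<^sup>+x. (\<integral>\<^sup>+y. ?k F' G' (c + t *\<^sub>R x) y \<partial>lborel) \<partial>lborel)"
    unfolding coulomb_def using t by (subst lborel_nn_integral_affine[where t=t and c=c]) auto
  also have "(\<integral>\<^sup>+x. (\<integral>\<^sup>+y. ?k F' G' (c + t *\<^sub>R x) y \<partial>lborel) \<partial>lborel) = (\<integral>\<^sup>+x. ennreal (t ^ 3) * (ennreal (1 / t) * (\<integral>\<^sup>+y. ?k F G x y \<partial>lborel)) \<partial>lborel)"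
  proof (rule nn_integral_cong)
    fix x
    have "(\<integral>\<^sup>+y. ?k F' G' (c + t *\<^sub>R x) y \<partial>lborel) = ennreal (t ^ 3) * (\<integral>\<^sup>+y. ?k F' G' (c + t *\<^sub>R x) (c + t *\<^sub>R y) \<partial>lborel)"
      using t by (subst lborel_nn_integral_affine[where t=t and c=c]) auto
    also have "\<dots> = ennreal (t ^ 3) * (\<integral>\<^sup>+y. ennreal (1 / t) * ?k F G x y \<partial>lborel)" unfolding k ..
    also have "(\<integral>\<^sup>+y. ennreal (1 / t) * ?k F G x y \<partial>lborel) = ennreal (1 / t) * (\<integral>\<^sup>+y. ?k F G x y \<partial>lborel)"
      by (rule nn_integral_cmult) measurable
    finally show "(\<integral>\<^sup>+y. ?k F' G' (c + t *\<^sub>R x) y \<partial>lborel) = ennreal (t ^ 3) * (ennreal (1 / t) * (\<integral>\<^sup>+y. ?k F G x y \<partial>lborel))" .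
  qed
  also have "\<dots> = ennreal (t ^ 3) * (ennreal (1 / t) * coulomb F G)"
    unfolding coulomb_def by (subst nn_integral_cmult, measurable, subst nn_integral_cmult, measurable)
  also have "ennreal (t ^ 3) * (ennreal (t ^ 3) * (ennreal (1 / t) * coulomb F G)) = ennreal (t ^ 3 * (t ^ 3 * (1 / t))) * coulomb F G"
    using t by (simp add: mult.assoc[symmetric] ennreal_mult[symmetric])
  also have "t ^ 3 * (t ^ 3 * (1 / t)) = t ^ 5" using t by (simp add: field_simps flip: power_Suc power_add)
  finally show ?thesis .
qed

lemma coulomb_far:
  assumes [measurable]: "F \<in> sets borel" "G \<in> sets borel" and d: "0 < d" "\<And>x y. x \<in> F \<Longrightarrow> y \<in> G \<Longrightarrow> d \<le> norm (x - y)"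
  shows "coulomb F G \<le> ennreal (1 / d) * (emeasure lborel F * emeasure lborel G)"
proof -
  have "coulomb F G \<le> (\<integral>\<^sup>+x. \<integral>\<^sup>+y. ennreal (1 / d) * (indicator F x * indicator G y) \<partial>lborel \<partial>lborel)"
  proof -
    have "1 / norm (x - y) \<le> 1 / d" if "x \<in> F" "y \<in> G" for x y
      using d(1) d(2)[OF that] by (intro divide_left_mono mult_pos_pos) auto
    then show ?thesis
      unfolding coulomb_def by (intro nn_integral_mono) (auto simp: indicator_def intro!: ennreal_leI)
  qed
  also have "\<dots> = (\<integral>\<^sup>+x. ennreal (1 / d) * (indicator F x * emeasure lborel G) \<partial>lborel)"
    by (simp add: nn_integral_cmult)
  also have "\<dots> = ennreal (1 / d) * (emeasure lborel F * emeasure lborel G)"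
    by (simp add: nn_integral_cmult nn_integral_multc)
  finally show ?thesis .
qed

lemma affine_image_borel:
  fixes G :: "(real^3) set"
  assumes "G \<in> sets borel" "0 < t"
  shows "\<exists>G'. G' \<in> sets borel \<and> (\<forall>x. c + t *\<^sub>R x \<in> G' \<longleftrightarrow> x \<in> G) \<and> (\<forall>y. y \<in> G' \<longleftrightarrow> (y - c) /\<^sub>R t \<in> G)
    \<and> emeasure lborel G' = ennreal (t ^ 3) * emeasure lborel G"
proof -
  define G' where "G' = (\<lambda>y. (y - c) /\<^sub>R t) -` G \<inter> space borel"
  have m: "G' \<in> sets borel" unfolding G'_def by (rule measurable_sets[OF _ assms(1)]) measurable
  have 1: "c + t *\<^sub>R x \<in> G' \<longleftrightarrow> x \<in> G" for x using assms(2) by (simp add: G'_def)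
  have "emeasure lborel G' = (\<integral>\<^sup>+y. indicator G' y \<partial>lborel)" using m by simp
  also have "\<dots> = ennreal (t ^ 3) * (\<integral>\<^sup>+x. indicator G' (c + t *\<^sub>R x) \<partial>lborel)"
    using m assms(2) by (subst lborel_nn_integral_affine[where t=t and c=c]) auto
  also have "(\<lambda>x. indicator G' (c + t *\<^sub>R x) :: ennreal) = indicator G" by (auto simp: indicator_def 1)
  finally have "emeasure lborel G' = ennreal (t ^ 3) * emeasure lborel G" using assms(1) by simp
  then show ?thesis using m 1 by (intro exI[of _ G']) (simp add: G'_def)
qed

section \<open>Competitors made of two distant pieces, and the perimeter of the ball\<close>

lemma half_ennreal:
  assumes "0 \<le> x"
  shows "(1/2) * ennreal (2 * x) = ennreal x"
proof -
  have "(1/2 :: ennreal) = ennreal (1/2)"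
    using ennreal_divide_numeral[of 1 "num.Bit0 num.One"] by simp
  moreover have "ennreal (1/2) * ennreal (2 * x) = ennreal (1/2 * (2 * x))"
    by (rule ennreal_mult[symmetric]) (use assms in simp_all)
  ultimately show ?thesis by simp
qed

text \<open>The second set is pushed away by \<open>s\<close> along \<open>- \<nu>\<close>, which
  makes the interaction at most \<open>a * b / s\<close>. Separation by a plane guarantees this
  distance even for unbounded sets. The energy of infinitely distant pieces is reached only in the
  limit, hence the \<open>\<epsilon>\<close>.\<close>

lemma min_energy_split:
  assumes F[measurable]: "F \<in> sets borel" and G[measurable]: "G \<in> sets borel" and \<nu>: "norm \<nu> = 1"
    and sep: "\<And>x. x \<in> F \<Longrightarrow> l \<le> \<nu> \<bullet> x" "\<And>x. x \<in> G \<Longrightarrow> \<nu> \<bullet> x \<le> l"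
    and vol: "emeasure lborel F = ennreal a" "emeasure lborel G = ennreal b" "0 \<le> a" "0 \<le> b"
    and per: "perimeter F \<le> ennreal p" "perimeter G \<le> ennreal q" "0 \<le> p" "0 \<le> q"
    and cou: "coulomb F F \<le> ennreal (2 * d)" "coulomb G G \<le> ennreal (2 * e)" "0 \<le> d" "0 \<le> e"
  shows "min_energy (a + b) \<le> ennreal (p + q + d + e)"
proof (rule ennreal_le_epsilon)
  fix \<epsilon> :: real assume \<epsilon>: "0 < \<epsilon>"
  define s where "s = (a * b + 1) / \<epsilon>"
  have s: "0 < s" "a * b / s \<le> \<epsilon>"
  proof -
    show "0 < s" using \<epsilon> vol by (simp add: s_def add_nonneg_pos)
    then show "a * b / s \<le> \<epsilon>" using \<epsilon> by (simp add: s_def field_simps)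
  qed
  obtain G' where G': "G' \<in> sets borel" "\<And>x. - s *\<^sub>R \<nu> + 1 *\<^sub>R x \<in> G' \<longleftrightarrow> x \<in> G" "\<And>y. y \<in> G' \<longleftrightarrow> (y - - s *\<^sub>R \<nu>) /\<^sub>R 1 \<in> G"
    "emeasure lborel G' = ennreal (1 ^ 3) * emeasure lborel G"
    using affine_image_borel[OF G zero_less_one, of "- s *\<^sub>R \<nu>"] by blast
  note G'(1)[measurable]
  have \<nu>\<nu>: "\<nu> \<bullet> \<nu> = 1" using \<nu> by (simp add: power2_norm_eq_inner[symmetric])
  have below: "\<nu> \<bullet> y \<le> l - s" if "y \<in> G'" for y
    using sep(2)[of "y + s *\<^sub>R \<nu>"] G'(3)[of y] that \<nu>\<nu> by (simp add: inner_add_right)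
  have disj: "F \<inter> G' = {}" using sep(1) below s by force
  have far: "s \<le> norm (x - y)" if "x \<in> F" "y \<in> G'" for x y
  proof -
    have "s \<le> \<nu> \<bullet> (x - y)" using sep(1)[OF that(1)] below[OF that(2)] by (simp add: inner_diff_right)
    also have "\<dots> \<le> norm (x - y)" using norm_cauchy_schwarz[of \<nu> "x - y"] \<nu> by simp
    finally show ?thesis .
  qed
  have "perimeter G' \<le> ennreal (1\<^sup>2 * q)"
    using G'(2) per by (intro perimeter_affine[of G G' q 1 "- s *\<^sub>R \<nu>"]) auto
  then have per': "perimeter (F \<union> G') \<le> ennreal (p + q)" using per disj by (intro perimeter_Un) auto
  have "coulomb G' G' = ennreal (1 ^ 5) * coulomb G G"
    using G'(2) by (intro coulomb_affine[of G G G' G' 1 "- s *\<^sub>R \<nu>"]) auto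
  then have "coulomb (F \<union> G') (F \<union> G') = coulomb F F + coulomb G G + 2 * coulomb F G'"
    using disj by (subst coulomb_Un) auto
  also have "\<dots> \<le> ennreal (2 * d) + ennreal (2 * e) + 2 * ennreal (a * b / s)"
  proof (intro add_mono cou mult_left_mono)
    have "coulomb F G' \<le> ennreal (1 / s) * (emeasure lborel F * emeasure lborel G')" using far s by (intro coulomb_far) auto
    also have "\<dots> = ennreal (a * b / s)" using vol G'(4) s by (simp flip: ennreal_mult)
    finally show "coulomb F G' \<le> ennreal (a * b / s)" .
  qed simp
  also have "\<dots> = ennreal (2 * (d + e + a * b / s))"
  proof -
    have "2 * ennreal z = ennreal (2 * z)" if "0 \<le> z" for z using that by (simp add: ennreal_mult)
    moreover have "0 \<le> a * b / s" using vol s by simp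
    ultimately show ?thesis unfolding distrib_left
      using cou by (metis add_nonneg_nonneg ennreal_plus mult_nonneg_nonneg zero_le_numeral)
  qed
  also have "\<dots> \<le> ennreal (2 * (d + e + \<epsilon>))" using s by (intro ennreal_leI) simp
  finally have cou': "coulomb (F \<union> G') (F \<union> G') \<le> ennreal (2 * (d + e + \<epsilon>))" .
  have "emeasure lborel (F \<union> G') = ennreal (a + b)"
    using vol G'(4) disj by (subst plus_emeasure[symmetric]) (auto simp: ennreal_plus)
  then have "min_energy (a + b) \<le> perimeter (F \<union> G') + (1/2) * coulomb (F \<union> G') (F \<union> G')" by (intro min_energy_le) auto
  also have "\<dots> \<le> ennreal (p + q) + (1/2) * ennreal (2 * (d + e + \<epsilon>))"
    using per' cou' by (intro add_mono mult_left_mono) auto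
  also have "(1/2) * ennreal (2 * (d + e + \<epsilon>)) = ennreal (d + e + \<epsilon>)"
    using cou \<epsilon> by (intro half_ennreal) simp
  also have "ennreal (p + q) + ennreal (d + e + \<epsilon>) = ennreal (p + q + d + e) + ennreal \<epsilon>"
    using per cou \<epsilon> by (simp flip: ennreal_plus add: add_ac)
  finally show "min_energy (a + b) \<le> ennreal (p + q + d + e) + ennreal \<epsilon>" .
qed

text \<open>The field is multiplied by a cutoff \<open>\<theta>\<close> that falls from 1 to 0 in a
  thin shell around the ball. By \<open>integral_divergence_eq_0\<close> the integral of
  \<open>\<theta> x * divergence \<phi> x\<close> is at most the maximal slope of
  \<open>\<theta>\<close> times the volume of the shell. The cutoff is a ramp in
  \<open>x \<bullet> x\<close>, hence differentiable at the origin as well.\<close>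

lemma perimeter_unit_ball: "perimeter (cball 0 1) \<le> ennreal (4 * pi)"
proof (rule perimeter_le)
  fix \<phi> assume \<phi>: "C1_compact_support \<phi>" "\<And>x. norm (\<phi> x) \<le> 1"
  have c: "C1_field \<phi>" using \<phi> by (simp add: C1_compact_support_iff)
  have [measurable]: "divergence \<phi> \<in> borel_measurable borel" "\<phi> \<in> borel_measurable borel"
    using divergence_measurable[OF c] c by (auto intro!: borel_measurable_continuous_onI C1_field_continuous)
  define h where "h n = 1 / real (Suc n)" for n
  have h: "0 < h n" for n by (auto simp: h_def)
  have h0: "h \<longlonglongrightarrow> 0" using LIMSEQ_inverse_real_of_nat by (simp add: h_def[abs_def] inverse_eq_divide)
  \<comment> \<open>Gradient bound \<open>2 * M * (1 + k)\<close> times the volume of the shell,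
    with the common factor \<open>k = h n\<close> cancelled; the limit is
    \<open>4 * pi\<close>.\<close>
  define u where "u n = (1 + h n)\<^sup>2 * 2 * (4/3 * pi) * (3 + 3 * h n + (h n)\<^sup>2) / (2 + h n)" for n
  have u: "u \<longlonglongrightarrow> (1 + 0)\<^sup>2 * 2 * (4/3 * pi) * (3 + 3 * 0 + 0\<^sup>2) / (2 + 0)"
    unfolding u_def by (intro tendsto_intros h0) auto
  define Q where "Q n \<theta> \<longleftrightarrow> \<theta> \<in> borel_measurable borel \<and> (\<forall>x. 0 \<le> \<theta> x \<and> \<theta> x \<le> 1)
    \<and> (\<forall>x. norm x \<le> 1 \<longrightarrow> \<theta> x = 1) \<and> (\<forall>x. 1 + h n \<le> norm x \<longrightarrow> \<theta> x = 0) \<and> (\<integral>x. \<theta> x * divergence \<phi> x \<partial>lborel) \<le> u n"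
    for n and \<theta> :: "real^3 \<Rightarrow> real"
  have "\<exists>\<theta>. Q n \<theta>" for n
  proof -
    \<comment> \<open>The slope in the variable \<open>x \<bullet> x\<close>, larger by the factor
      \<open>1 + k\<close> than the reciprocal of the ramp length, because
      \<open>smooth_ramp\<close> asks for a strict inequality.\<close>
    define k M where "k = h n" and "M = (1 + k) / ((1 + k)\<^sup>2 - 1)"
    have k: "0 < k" using h by (simp add: k_def)
    have sq: "(1 + k)\<^sup>2 - 1 = k * (2 + k)" by (simp add: power2_eq_square algebra_simps)
    have ab: "1 < (1 + k)\<^sup>2" "1 < M * ((1 + k)\<^sup>2 - 1)" 
    proof -
      have pos: "0 < k * (2 + k)" using k by simp
      then show "1 < (1 + k)\<^sup>2" using sq by linarith
      show "1 < M * ((1 + k)\<^sup>2 - 1)" using pos k unfolding M_def sq by simp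
    qed
    obtain \<eta> \<eta>' where \<eta>: "\<And>t. (\<eta> has_real_derivative \<eta>' t) (at t)" "continuous_on UNIV \<eta>'"
      "\<And>t. 0 \<le> \<eta> t" "\<And>t. \<eta> t \<le> 1" "\<And>t. t \<le> 1 \<Longrightarrow> \<eta> t = 0" "\<And>t. (1 + k)\<^sup>2 \<le> t \<Longrightarrow> \<eta> t = 1"
      "\<And>t. 0 \<le> \<eta>' t" "\<And>t. \<eta>' t \<le> M * indicator {1<..<(1 + k)\<^sup>2} t"
      using smooth_ramp[OF ab] by metis
    have [measurable]: "\<eta> \<in> borel_measurable borel" "\<eta>' \<in> borel_measurable borel"
      using \<eta>(1,2) by (auto intro!: borel_measurable_continuous_onI DERIV_continuous_on[of UNIV])
    define \<theta> where "\<theta> x = 1 - \<eta> (x \<bullet> x)" for x :: "real^3"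
    define g where "g x = (- 2 * \<eta>' (x \<bullet> x)) *\<^sub>R x" for x :: "real^3"
    have [measurable]: "\<theta> \<in> borel_measurable borel" unfolding \<theta>_def by measurable
    have d: "(\<theta> has_derivative (\<lambda>v. g x \<bullet> v)) (at x)" for x
    proof -
      have "((\<lambda>x. x \<bullet> x) has_derivative (\<lambda>v. 2 * (x \<bullet> v))) (at x)"
        by (rule has_derivative_eq_rhs[OF has_derivative_inner[OF has_derivative_ident has_derivative_ident]]) (auto simp: inner_commute)
      then have "((\<lambda>x. \<eta> (x \<bullet> x)) has_derivative (\<lambda>v. \<eta>' (x \<bullet> x) * (2 * (x \<bullet> v)))) (at x)"
        using has_derivative_compose[of "\<lambda>x. x \<bullet> x" "\<lambda>v. 2 * (x \<bullet> v)" x UNIV \<eta> "\<lambda>t. \<eta>' (x \<bullet> x) * t"] \<eta>(1)[of "x \<bullet> x"]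
        by (auto simp: has_field_derivative_def)
      from has_derivative_diff[OF has_derivative_const[of 1] this]
      show ?thesis unfolding \<theta>_def g_def by (rule has_derivative_eq_rhs) auto
    qed
    have gc: "continuous_on UNIV g"
    proof -
      have "continuous_on UNIV (\<lambda>x::real^3. x \<bullet> x)" by (intro continuous_intros)
      then have "continuous_on UNIV (\<lambda>x::real^3. \<eta>' (x \<bullet> x))" by (rule continuous_on_compose2[OF \<eta>(2)]) simp
      then show ?thesis unfolding g_def by (intro continuous_intros)
    qed
    have [measurable]: "g \<in> borel_measurable borel" using gc by (rule borel_measurable_continuous_onI)
    note sc = C1_field_scale[OF d gc c]
    obtain R where R: "\<And>x. R < norm x \<Longrightarrow> \<phi> x = 0" using \<phi>(1) by (auto simp: C1_compact_support_iff)
    have cs: "C1_compact_support (\<lambda>x. \<theta> x *\<^sub>R \<phi> x)"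
      unfolding C1_compact_support_iff using sc(1) R by (intro conjI exI[of _ R]) auto
    have \<theta>01: "0 \<le> \<theta> x" "\<theta> x \<le> 1" for x using \<eta>(3,4) by (auto simp: \<theta>_def)
    have \<theta>1: "\<theta> x = 1" if "norm x \<le> 1" for x
      using \<eta>(5)[of "x \<bullet> x"] power_le_one[OF norm_ge_zero that, of 2] by (simp add: \<theta>_def power2_norm_eq_inner)
    have \<theta>0: "\<theta> x = 0" if "1 + k \<le> norm x" for x
      using \<eta>(6)[of "x \<bullet> x"] power_mono[OF that, of 2] k by (simp add: \<theta>_def power2_norm_eq_inner)
    let ?S = "cball (0::real^3) (1 + k) - cball 0 1"
    have gb: "- (g x \<bullet> \<phi> x) \<le> 2 * M * (1 + k) * indicator ?S x" for x
    proof -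
      have *: "- (g x \<bullet> \<phi> x) = 2 * \<eta>' (x \<bullet> x) * (x \<bullet> \<phi> x)" by (simp add: g_def)
      have M: "0 \<le> M" using k unfolding M_def sq by simp
      show ?thesis
      proof (cases "x \<bullet> x \<in> {1<..<(1 + k)\<^sup>2}")
        case True
        then have "1 < (norm x)\<^sup>2" "(norm x)\<^sup>2 < (1 + k)\<^sup>2" by (auto simp: power2_norm_eq_inner)
        then have n: "1 < norm x" "norm x < 1 + k"
          using power2_less_imp_less[of 1 "norm x"] power2_less_imp_less[of "norm x" "1 + k"] k by auto
        have "x \<bullet> \<phi> x \<le> norm x * norm (\<phi> x)" by (rule norm_cauchy_schwarz)
        also have "\<dots> \<le> (1 + k) * 1" using n \<phi>(2) k by (intro mult_mono) auto
        finally have "x \<bullet> \<phi> x \<le> 1 + k" by simp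
        then have "\<eta>' (x \<bullet> x) * (x \<bullet> \<phi> x) \<le> \<eta>' (x \<bullet> x) * (1 + k)" using \<eta>(7) by (intro mult_left_mono)
        also have "\<dots> \<le> M * (1 + k)" using \<eta>(8)[of "x \<bullet> x"] True k by (intro mult_right_mono) auto
        finally show ?thesis unfolding * using n by simp
      next
        case False
        then have "\<eta>' (x \<bullet> x) = 0" using \<eta>(7)[of "x \<bullet> x"] \<eta>(8)[of "x \<bullet> x"] by simp
        then show ?thesis unfolding * using M k by (simp add: indicator_def)
      qed
    qed
    have fS: "emeasure lborel ?S < \<infinity>"
      using emeasure_lborel_cball_finite[of "0::real^3" "1 + k"] by (rule le_less_trans[rotated]) (intro emeasure_mono; auto)
    have i1: "integrable lborel (\<lambda>x. \<theta> x * divergence \<phi> x)"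
      using divergence_integrable[OF \<phi>(1)] \<theta>01
      by (intro Bochner_Integration.integrable_bound[OF divergence_integrable[OF \<phi>(1)]]) (auto simp: abs_mult intro!: AE_I2 mult_left_le_one_le)
    have i2: "integrable lborel (\<lambda>x. 2 * M * (1 + k) * indicator ?S x)"
      using fS by (intro integrable_mult_right integrable_real_indicator) auto
    have "(\<integral>x. \<theta> x * divergence \<phi> x \<partial>lborel) - (\<integral>x. 2 * M * (1 + k) * indicator ?S x \<partial>lborel)
        = (\<integral>x. \<theta> x * divergence \<phi> x - 2 * M * (1 + k) * indicator ?S x \<partial>lborel)"
      using i1 i2 by simp
    also have "\<dots> \<le> (\<integral>x. divergence (\<lambda>x. \<theta> x *\<^sub>R \<phi> x) x \<partial>lborel)"
    proof (rule integral_mono[OF Bochner_Integration.integrable_diff[OF i1 i2] divergence_integrable[OF cs]])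
      show "\<theta> x * divergence \<phi> x - 2 * M * (1 + k) * indicator ?S x \<le> divergence (\<lambda>x. \<theta> x *\<^sub>R \<phi> x) x" for x
        unfolding sc(2) using gb[of x] by linarith
    qed
    also have "\<dots> = 0" by (rule integral_divergence_eq_0[OF cs])
    finally have "(\<integral>x. \<theta> x * divergence \<phi> x \<partial>lborel) \<le> 2 * M * (1 + k) * measure lborel ?S" by simp
    also have "measure lborel ?S = 4/3 * pi * (1 + k) ^ 3 - 4/3 * pi * 1 ^ 3"
    proof -
      have "measure lborel (cball (0::real^3) r) = 4/3 * pi * r ^ 3" if "0 \<le> r" for r
        using emeasure_ball3[OF that, of 0] that by (simp add: measure_def)
      from this[of "1 + k"] this[of 1] show ?thesis
        using k emeasure_lborel_cball_finite[of "0::real^3" "1 + k"] by (subst measure_Diff) auto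
    qed
    also have "2 * M * (1 + k) * (4/3 * pi * (1 + k) ^ 3 - 4/3 * pi * 1 ^ 3) = u n"
    proof -
      define Z where "Z = 3 + 3 * k + k\<^sup>2"
      have "4/3 * pi * (1 + k) ^ 3 - 4/3 * pi * 1 ^ 3 = 4/3 * pi * (k * Z)"
        by (simp add: Z_def power2_eq_square power3_eq_cube algebra_simps)
      moreover have "2 * (a / (k * c)) * a * (w * (k * Z)) = a\<^sup>2 * 2 * w * Z / c" if "c \<noteq> 0" for a c w
        using that k by (simp add: field_simps power2_eq_square)
      from this[of "2 + k" "1 + k" "4/3 * pi"] have "2 * ((1 + k) / (k * (2 + k))) * (1 + k) * (4/3 * pi * (k * Z)) = (1 + k)\<^sup>2 * 2 * (4/3 * pi) * Z / (2 + k)"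
        using k by simp
      ultimately show ?thesis unfolding M_def sq u_def k_def[symmetric] Z_def[symmetric] by (simp only:)
    qed
    finally show ?thesis using \<theta>01 \<theta>1 \<theta>0 by (intro exI[of _ \<theta>]) (simp add: Q_def k_def)
  qed
  then obtain \<theta> where Q: "\<And>n. Q n (\<theta> n)" by metis
  then have [measurable]: "\<And>n. \<theta> n \<in> borel_measurable borel" by (simp add: Q_def)
  have "(\<lambda>n. (\<integral>x. \<theta> n x * divergence \<phi> x \<partial>lborel)) \<longlonglongrightarrow> (\<integral>x. indicator (cball 0 1) x * divergence \<phi> x \<partial>lborel)"
  proof (rule integral_dominated_convergence[where w="\<lambda>x. \<bar>divergence \<phi> x\<bar>"])
    show "integrable lborel (\<lambda>x. \<bar>divergence \<phi> x\<bar>)" using divergence_integrable[OF \<phi>(1)] by simp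
    have "(\<lambda>n. \<theta> n x * divergence \<phi> x) \<longlonglongrightarrow> indicator (cball 0 1) x * divergence \<phi> x" for x
    proof (rule tendsto_eventually, cases "norm x \<le> 1")
      case True
      then show "\<forall>\<^sub>F n in sequentially. \<theta> n x * divergence \<phi> x = indicator (cball 0 1) x * divergence \<phi> x"
        using Q by (simp add: Q_def)
    next
      case False
      then have "\<forall>\<^sub>F n in sequentially. h n < norm x - 1" using h0 by (intro order_tendstoD(2)) auto
      then show "\<forall>\<^sub>F n in sequentially. \<theta> n x * divergence \<phi> x = indicator (cball 0 1) x * divergence \<phi> x"
        by eventually_elim (use False Q in \<open>auto simp: Q_def\<close>)
    qed
    then show "AE x in lborel. (\<lambda>n. \<theta> n x * divergence \<phi> x) \<longlonglongrightarrow> indicator (cball 0 1) x * divergence \<phi> x" by simp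
    show "AE x in lborel. norm (\<theta> n x * divergence \<phi> x) \<le> \<bar>divergence \<phi> x\<bar>" for n
      using Q[of n] by (auto simp: Q_def abs_mult intro!: AE_I2 mult_left_le_one_le)
  qed (auto intro!: borel_measurable_times borel_measurable_indicator)
  then have "flux (cball 0 1) \<phi> \<le> (1 + 0)\<^sup>2 * 2 * (4/3 * pi) * (3 + 3 * 0 + 0\<^sup>2) / (2 + 0)"
    unfolding flux_def by (rule LIMSEQ_le[OF _ u]) (use Q in \<open>auto simp: Q_def\<close>)
  then show "flux (cball 0 1) \<phi> \<le> 4 * pi" by simp
qed auto

lemma zero_field: "C1_compact_support (\<lambda>x. 0)" "flux X (\<lambda>x. 0) = 0"
proof -
  have "C1_field (\<lambda>x. 0)" "divergence (\<lambda>x. 0) = trace_field (\<lambda>x h. 0)"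
    by (rule C1_fieldI[of "\<lambda>x. 0" "\<lambda>x h. 0"]; simp)+
  then show "C1_compact_support (\<lambda>x. 0)" "flux X (\<lambda>x. 0) = 0"
    by (auto simp: C1_compact_support_iff flux_def trace_field_def)
qed

text \<open>The two fields vary independently, so the joint bound holds for the sum of the two
  suprema. With \<open>q\<close> the perimeter of \<open>G\<close>, the remainder
  \<open>s - q\<close> bounds every flux out of \<open>F\<close>.\<close>

lemma perimeter_sum_bound:
  assumes "F \<in> sets borel" "G \<in> sets borel"
    and le: "\<And>\<phi> \<psi>. C1_compact_support \<phi> \<Longrightarrow> (\<And>x. norm (\<phi> x) \<le> 1) \<Longrightarrow> C1_compact_support \<psi> \<Longrightarrow> (\<And>x. norm (\<psi> x) \<le> 1)
      \<Longrightarrow> flux F \<phi> + flux G \<psi> \<le> s"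
  obtains p q where "0 \<le> p" "0 \<le> q" "perimeter F \<le> ennreal p" "perimeter G \<le> ennreal q" "p + q \<le> s"
proof -
  note z = zero_field
  have G: "perimeter G \<le> ennreal (s - flux F \<phi>)" if "C1_compact_support \<phi>" "\<And>x. norm (\<phi> x) \<le> 1" for \<phi>
  proof (rule perimeter_le[OF assms(2)])
    show "0 \<le> s - flux F \<phi>" using le[OF that z(1)] z(2) by simp
    show "flux G \<psi> \<le> s - flux F \<phi>" if "C1_compact_support \<psi>" "\<And>x. norm (\<psi> x) \<le> 1" for \<psi>
      using le[OF \<open>C1_compact_support \<phi>\<close> \<open>\<And>x. norm (\<phi> x) \<le> 1\<close> that] by linarith
  qed
  have s0: "0 \<le> s" using le[OF z(1) _ z(1)] z(2) by simp
  define q where "q = enn2real (perimeter G)"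
  have "perimeter G \<noteq> \<infinity>" using G[OF z(1)] by (auto simp: top_unique)
  then have Gq: "perimeter G = ennreal q" by (simp add: q_def less_top)
  have q0: "0 \<le> q" by (simp add: q_def)
  have qF: "q \<le> s - flux F \<phi>" if "C1_compact_support \<phi>" "\<And>x. norm (\<phi> x) \<le> 1" for \<phi>
  proof -
    have "0 \<le> s - flux F \<phi>" using le[OF that z(1)] z(2) by simp
    then show ?thesis using G[OF that] unfolding Gq by (simp add: ennreal_le_iff)
  qed
  have "perimeter F \<le> ennreal (s - q)"
  proof (rule perimeter_le[OF assms(1)])
    show "0 \<le> s - q" using qF[OF z(1)] z(2) by simp
    show "flux F \<phi> \<le> s - q" if "C1_compact_support \<phi>" "\<And>x. norm (\<phi> x) \<le> 1" for \<phi>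
      using qF[OF that] by linarith
  qed
  then show thesis using that[of "s - q" q] q0 Gq qF[OF z(1)] z(2) by simp
qed

lemma coulomb_cong_AE:
  assumes "AE x in lborel. x \<in> F \<longleftrightarrow> x \<in> F'" "AE x in lborel. x \<in> G \<longleftrightarrow> x \<in> G'"
  shows "coulomb F G = coulomb F' G'"
  unfolding coulomb_def
proof (rule nn_integral_cong_AE)
  show "AE x in lborel. (\<integral>\<^sup>+y. indicator F x * indicator G y * ennreal (1 / norm (x - y)) \<partial>lborel) = (\<integral>\<^sup>+y. indicator F' x * indicator G' y * ennreal (1 / norm (x - y)) \<partial>lborel)"
    using assms(1)
  proof eventually_elim
    case (elim x)
    show ?case
      by (rule nn_integral_cong_AE) (use assms(2) in \<open>eventually_elim, simp add: elim indicator_def\<close>)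
  qed
qed

text \<open>For a fixed height \<open>t\<close> the points \<open>l\<close> with
  \<open>q l < t \<le> q (l - h)\<close> lie in an interval of length \<open>h\<close>; Fubini over
  the heights gives the bound. Together with Fatou's lemma it replaces the integration of a
  derivative for functions that are merely monotone.\<close>

lemma nn_integral_antimono_increment:
  fixes q :: "real \<Rightarrow> real"
  assumes q: "antimono q" and b: "\<And>l. 0 \<le> q l" "\<And>l. q l \<le> C" and h: "0 < h"
  shows "(\<integral>\<^sup>+l. ennreal (q (l - h) - q l) \<partial>lborel) \<le> ennreal (C * h)"
proof -
  have C: "0 \<le> C" using b[of 0] by linarith
  have "mono (\<lambda>l. - q l)" using q by (auto simp: mono_def antimono_def)
  then have "(\<lambda>l. - (- q l)) \<in> borel_measurable borel" by (intro borel_measurable_uminus borel_measurable_mono)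
  then have [measurable]: "q \<in> borel_measurable borel" by simp
  have "(\<integral>\<^sup>+l. ennreal (q (l - h) - q l) \<partial>lborel) = (\<integral>\<^sup>+l. (\<integral>\<^sup>+t. (if q l < t \<and> t \<le> q (l - h) then 1 else 0) \<partial>lborel) \<partial>lborel)"
  proof (rule nn_integral_cong)
    fix l :: real
    have "(\<integral>\<^sup>+t. (if q l < t \<and> t \<le> q (l - h) then 1 else 0) \<partial>lborel) = (\<integral>\<^sup>+t. indicator {q l<..q (l - h)} t \<partial>lborel)"
      by (intro nn_integral_cong) (auto simp: indicator_def)
    then show "ennreal (q (l - h) - q l) = (\<integral>\<^sup>+t. (if q l < t \<and> t \<le> q (l - h) then 1 else 0) \<partial>lborel)"
      using antimonoD[OF q, of "l - h" l] h by simp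
  qed
  also have "\<dots> = (\<integral>\<^sup>+t. (\<integral>\<^sup>+l. (if q l < t \<and> t \<le> q (l - h) then 1 else 0) \<partial>lborel) \<partial>lborel)"
    by (rule lborel_pair.Fubini'[symmetric]) measurable
  also have "\<dots> \<le> (\<integral>\<^sup>+t. ennreal h * indicator {0..C} t \<partial>lborel)"
  proof (rule nn_integral_mono)
    fix t :: real
    let ?S = "{l. q l < t \<and> t \<le> q (l - h)}"
    have S[measurable]: "?S \<in> sets borel" by measurable
    have "(\<integral>\<^sup>+l. (if q l < t \<and> t \<le> q (l - h) then 1 else 0) \<partial>lborel) = (\<integral>\<^sup>+l. indicator ?S l \<partial>lborel)"
      by (intro nn_integral_cong) (auto simp: indicator_def)
    also have "\<dots> = emeasure lborel ?S" using S by simp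
    also have "\<dots> \<le> ennreal h * indicator {0..C} t"
    proof (cases "?S = {}")
      case False
      then obtain l0 where l0: "l0 \<in> ?S" by blast
      then have t: "t \<in> {0..C}" using b(1)[of l0] b(2)[of "l0 - h"] by auto
      have close: "l' - h < l" if "l \<in> ?S" "l' \<in> ?S" for l l'
      proof (rule ccontr)
        assume "\<not> l' - h < l"
        then have "q (l' - h) \<le> q l" using antimonoD[OF q, of l "l' - h"] by simp
        then show False using that by auto
      qed
      have bb: "bdd_below ?S" using close[OF _ l0] by (intro bdd_belowI[of _ "l0 - h"]) (auto simp: less_imp_le)
      have "?S \<subseteq> {Inf ?S..Inf ?S + h}"
      proof
        fix l assume l: "l \<in> ?S"
        have "Inf ?S \<le> l" using bb l by (rule cInf_lower[rotated])
        moreover have "l - h \<le> Inf ?S" using close[OF _ l] False by (intro cInf_greatest) (auto simp: less_imp_le)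
        ultimately show "l \<in> {Inf ?S..Inf ?S + h}" by auto
      qed
      then have "emeasure lborel ?S \<le> emeasure lborel {Inf ?S..Inf ?S + h}" by (intro emeasure_mono) auto
      then show ?thesis using t h by simp
    next
      case True
      show ?thesis unfolding True by simp
    qed
    finally show "(\<integral>\<^sup>+l. (if q l < t \<and> t \<le> q (l - h) then 1 else 0) \<partial>lborel) \<le> ennreal h * indicator {0..C} t" .
  qed
  also have "\<dots> = ennreal (C * h)" using C h by (simp add: nn_integral_cmult_indicator ennreal_mult mult.commute)
  finally show ?thesis .
qed

section \<open>Planar cuts of a minimizer\<close>

locale minimizer =
  fixes \<Omega> :: "(real^3) set" and A P D :: real
  assumes borel[measurable]: "\<Omega> \<in> sets borel" and volume: "emeasure lborel \<Omega> = ennreal A" and A: "0 < A"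
    and P: "perimeter \<Omega> = ennreal P" "0 \<le> P" and D: "coulomb \<Omega> \<Omega> = ennreal (2 * D)" "0 \<le> D"
    and min: "ennreal (P + D) \<le> min_energy A"
begin

definition V :: "real^3 \<Rightarrow> real \<Rightarrow> real" where
  "V \<nu> l = measure lborel (\<Omega> \<inter> upper \<nu> l)"

definition I :: "real^3 \<Rightarrow> real \<Rightarrow> ennreal" where
  "I \<nu> l = coulomb (\<Omega> \<inter> upper \<nu> l) (\<Omega> - upper \<nu> l)"

text \<open>The area of the section as a lower left derivative of \<open>- V\<close>, defined at
  every \<open>l\<close> with infinity as a possible value. A lower limit fits Fatou's lemma, and a
  value below \<open>c\<close> yields infinitely many quotients below \<open>c\<close>, as
  \<open>flux_cut\<close> demands.\<close>

definition b :: "real^3 \<Rightarrow> real \<Rightarrow> ennreal" where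
  "b \<nu> l = liminf (\<lambda>n. ennreal (real (Suc n) * (V \<nu> (l - 1 / real (Suc n)) - V \<nu> l)))"

lemma finite_volume: "emeasure lborel \<Omega> < \<infinity>" using volume by simp

lemma finite_sub: "X \<in> sets borel \<Longrightarrow> X \<subseteq> \<Omega> \<Longrightarrow> emeasure lborel X < \<infinity>"
  using finite_volume emeasure_mono[of X \<Omega> lborel] by (auto intro: le_less_trans)

lemma measure_\<Omega>: "measure lborel \<Omega> = A" using volume A by (simp add: measure_def)

lemma emeasure_upper: "emeasure lborel (\<Omega> \<inter> upper \<nu> l) = ennreal (V \<nu> l)"
  unfolding V_def using finite_sub[of "\<Omega> \<inter> upper \<nu> l"] by (intro emeasure_eq_ennreal_measure) auto

lemma V_bounds: "0 \<le> V \<nu> l" "V \<nu> l \<le> A"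
proof -
  show "0 \<le> V \<nu> l" by (simp add: V_def)
  show "V \<nu> l \<le> A" unfolding V_def measure_\<Omega>[symmetric]
    using finite_volume by (intro measure_mono_fmeasurable) (auto simp: fmeasurable_def)
qed

lemma emeasure_lower: "emeasure lborel (\<Omega> - upper \<nu> l) = ennreal (A - V \<nu> l)"
proof -
  have "measure lborel (\<Omega> - \<Omega> \<inter> upper \<nu> l) = A - V \<nu> l"
    unfolding V_def measure_\<Omega>[symmetric] using finite_volume by (intro measure_Diff) auto
  moreover have "\<Omega> - \<Omega> \<inter> upper \<nu> l = \<Omega> - upper \<nu> l" by auto
  ultimately have "measure lborel (\<Omega> - upper \<nu> l) = A - V \<nu> l" by simp
  then show ?thesis using finite_sub[of "\<Omega> - upper \<nu> l"] by (subst emeasure_eq_ennreal_measure) auto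
qed

lemma V_antimono: "antimono (V \<nu>)"
  unfolding V_def antimono_def
proof (intro allI impI)
  fix l l' :: real assume "l \<le> l'"
  then show "measure lborel (\<Omega> \<inter> upper \<nu> l') \<le> measure lborel (\<Omega> \<inter> upper \<nu> l)"
    using finite_sub[of "\<Omega> \<inter> upper \<nu> l"] by (intro measure_mono_fmeasurable) (auto simp: fmeasurable_def upper_def)
qed

lemma coulomb_parts:
  "\<exists>d e. 0 \<le> d \<and> 0 \<le> e \<and> coulomb (\<Omega> \<inter> upper \<nu> l) (\<Omega> \<inter> upper \<nu> l) = ennreal (2 * d)
    \<and> coulomb (\<Omega> - upper \<nu> l) (\<Omega> - upper \<nu> l) = ennreal (2 * e) \<and> I \<nu> l = ennreal (enn2real (I \<nu> l))
    \<and> D = d + e + enn2real (I \<nu> l)"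
proof -
  let ?U = "\<Omega> \<inter> upper \<nu> l" and ?L = "\<Omega> - upper \<nu> l"
  have "?U \<union> ?L = \<Omega>" by auto
  then have eq: "ennreal (2 * D) = coulomb ?U ?U + coulomb ?L ?L + 2 * I \<nu> l"
    using coulomb_Un[of ?U ?L] D by (simp add: I_def) (metis Diff_disjoint Int_Diff inf_commute borel)
  have fin: "coulomb ?U ?U \<noteq> \<infinity>" "coulomb ?L ?L \<noteq> \<infinity>" "I \<nu> l \<noteq> \<infinity>"
    using eq by (auto simp: ennreal_add_eq_top ennreal_mult_eq_top_iff)
  define d e i where "d = enn2real (coulomb ?U ?U) / 2" and "e = enn2real (coulomb ?L ?L) / 2" and "i = enn2real (I \<nu> l)"
  have r: "coulomb ?U ?U = ennreal (2 * d)" "coulomb ?L ?L = ennreal (2 * e)" "I \<nu> l = ennreal i" "0 \<le> d" "0 \<le> e" "0 \<le> i"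
    using fin by (auto simp: d_def e_def i_def less_top)
  have "ennreal (2 * D) = ennreal (2 * d + 2 * e + 2 * i)"
    unfolding eq r(1-3) using r(4-6) by (simp add: ennreal_mult ennreal_plus)
  then have "2 * D = 2 * d + 2 * e + 2 * i" using D r by (subst (asm) ennreal_inj) auto
  then have "D = d + e + i" by simp
  then show ?thesis using r unfolding i_def by blast
qed

lemma frequently_quotient:
  assumes "b \<nu> l < ennreal c"
  shows "\<exists>\<^sub>F n in sequentially. real (Suc n) * (measure lborel (\<Omega> \<inter> upper \<nu> (l - 1 / real (Suc n))) - measure lborel (\<Omega> \<inter> upper \<nu> l)) \<le> c"
proof (rule ccontr)
  assume "\<not> ?thesis"
  then have "\<forall>\<^sub>F n in sequentially. c < real (Suc n) * (V \<nu> (l - 1 / real (Suc n)) - V \<nu> l)"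
    by (simp add: frequently_def V_def not_le)
  then have "\<forall>\<^sub>F n in sequentially. ennreal c \<le> ennreal (real (Suc n) * (V \<nu> (l - 1 / real (Suc n)) - V \<nu> l))"
    by eventually_elim (auto intro: ennreal_leI less_imp_le)
  then have "ennreal c \<le> b \<nu> l" unfolding b_def by (rule Liminf_bounded)
  then show False using assms by simp
qed

lemma cut:
  assumes "norm \<nu> = 1" "b \<nu> l < ennreal c" "bounded_divergence \<phi>" "\<And>x. norm (\<phi> x) \<le> 1" "\<And>x. - \<beta> \<le> \<nu> \<bullet> \<phi> x"
    "bounded_divergence \<psi>" "\<And>x. norm (\<psi> x) \<le> 1" "-1 \<le> \<beta>"
  shows "flux (\<Omega> \<inter> upper \<nu> l) \<phi> + flux (\<Omega> - upper \<nu> l) \<psi> \<le> P + (1 + \<beta>) * c"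
  using assms P finite_volume by (intro flux_cut frequently_quotient) auto

lemma le_of_all_larger:
  fixes x :: ennreal
  assumes "\<And>c. 0 \<le> c \<Longrightarrow> b \<nu> l < ennreal c \<Longrightarrow> x \<le> ennreal (k * c)" and k: "0 < k"
  shows "x \<le> ennreal k * b \<nu> l"
proof (cases "b \<nu> l = \<infinity>")
  case True
  then show ?thesis using k by (simp add: ennreal_mult_top)
next
  case False
  then obtain r where r: "b \<nu> l = ennreal r" "0 \<le> r" by (cases "b \<nu> l") auto
  show ?thesis
  proof (rule ennreal_le_epsilon)
    fix e :: real assume e: "0 < e"
    have "x \<le> ennreal (k * (r + e / k))" using r e k by (intro assms(1)) (auto simp: ennreal_less_iff add_nonneg_pos)
    also have "k * (r + e / k) = k * r + e" using k by (simp add: distrib_left)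
    finally show "x \<le> ennreal k * b \<nu> l + ennreal e" using r e k by (simp add: ennreal_plus ennreal_mult)
  qed
qed

text \<open>For \<open>\<beta> = 1\<close> the constraint in \<open>cut\<close> holds for every
  field of norm at most 1, and the section counts twice, once for each part. Separating the parts
  infinitely far then gives energy at most \<open>P + 2 * c + D\<close> minus the
  interaction.\<close>

lemma I_le_2b:
  assumes \<nu>: "norm \<nu> = 1"
  shows "I \<nu> l \<le> ennreal 2 * b \<nu> l"
proof (rule le_of_all_larger)
  fix c :: real assume c: "0 \<le> c" "b \<nu> l < ennreal c"
  let ?U = "\<Omega> \<inter> upper \<nu> l" and ?L = "\<Omega> - upper \<nu> l"
  obtain d e where de: "0 \<le> d" "0 \<le> e" "coulomb ?U ?U = ennreal (2 * d)" "coulomb ?L ?L = ennreal (2 * e)"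
    "I \<nu> l = ennreal (enn2real (I \<nu> l))" "D = d + e + enn2real (I \<nu> l)" using coulomb_parts by blast
  have le: "flux ?U \<phi> + flux ?L \<psi> \<le> P + 2 * c"
    if "C1_compact_support \<phi>" "\<And>x. norm (\<phi> x) \<le> 1" "C1_compact_support \<psi>" "\<And>x. norm (\<psi> x) \<le> 1" for \<phi> \<psi>
  proof -
    have "- 1 \<le> \<nu> \<bullet> \<phi> x" for x
      using Cauchy_Schwarz_ineq2[of \<nu> "\<phi> x"] that(2)[of x] \<nu> by (simp add: abs_le_iff)
    then have "flux ?U \<phi> + flux ?L \<psi> \<le> P + (1 + 1) * c"
      using that by (intro cut \<nu> c(2) C1_compact_support_bounded_divergence) auto
    then show ?thesis by simp
  qed
  obtain p q where pq: "0 \<le> p" "0 \<le> q" "perimeter ?U \<le> ennreal p" "perimeter ?L \<le> ennreal q" "p + q \<le> P + 2 * c"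
    by (rule perimeter_sum_bound[OF _ _ le]) auto
  have "min_energy (V \<nu> l + (A - V \<nu> l)) \<le> ennreal (p + q + d + e)"
    using de pq V_bounds by (intro min_energy_split[OF _ _ \<nu>, of ?U ?L l] emeasure_upper emeasure_lower) (auto simp: upper_def)
  then have "ennreal (P + D) \<le> ennreal (p + q + d + e)" using min by simp
  then have "P + D \<le> p + q + d + e" using pq de by (subst (asm) ennreal_le_iff) auto
  then have "enn2real (I \<nu> l) \<le> 2 * c" using pq de by linarith
  then show "I \<nu> l \<le> ennreal (2 * c)" using de(5) by (metis ennreal_leI)
qed simp

lemma V_measurable[measurable]: "V \<nu> \<in> borel_measurable borel"
proof -
  have "mono (\<lambda>l. - V \<nu> l)" using V_antimono by (auto simp: mono_def antimono_def)
  then have "(\<lambda>l. - (- V \<nu> l)) \<in> borel_measurable borel" by (intro borel_measurable_uminus borel_measurable_mono)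
  then show ?thesis by simp
qed

lemma nn_integral_b: "(\<integral>\<^sup>+l. b \<nu> l \<partial>lborel) \<le> ennreal A"
proof -
  have "(\<integral>\<^sup>+l. b \<nu> l \<partial>lborel) \<le> liminf (\<lambda>n. \<integral>\<^sup>+l. ennreal (real (Suc n) * (V \<nu> (l - 1 / real (Suc n)) - V \<nu> l)) \<partial>lborel)"
    unfolding b_def by (rule nn_integral_liminf) measurable
  also have "\<dots> \<le> ennreal A"
  proof (rule Liminf_le)
    show "\<forall>\<^sub>F n in sequentially. (\<integral>\<^sup>+l. ennreal (real (Suc n) * (V \<nu> (l - 1 / real (Suc n)) - V \<nu> l)) \<partial>lborel) \<le> ennreal A"
    proof (intro always_eventually allI)
      fix n
      have "(\<integral>\<^sup>+l. ennreal (real (Suc n) * (V \<nu> (l - 1 / real (Suc n)) - V \<nu> l)) \<partial>lborel)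
          = ennreal (real (Suc n)) * (\<integral>\<^sup>+l. ennreal (V \<nu> (l - 1 / real (Suc n)) - V \<nu> l) \<partial>lborel)"
        by (subst nn_integral_cmult[symmetric]) (auto simp: ennreal_mult')
      also have "\<dots> \<le> ennreal (real (Suc n)) * ennreal (A * (1 / real (Suc n)))"
        using V_bounds by (intro mult_left_mono nn_integral_antimono_increment V_antimono) auto
      also have "\<dots> = ennreal A" using A by (subst ennreal_mult[symmetric]) (auto simp del: of_nat_Suc)
      finally show "(\<integral>\<^sup>+l. ennreal (real (Suc n) * (V \<nu> (l - 1 / real (Suc n)) - V \<nu> l)) \<partial>lborel) \<le> ennreal A" .
    qed
  qed simp
  finally show ?thesis .
qed

lemma V_tendsto_0: "((V \<nu>) \<longlongrightarrow> 0) at_top"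
proof -
  have "(\<lambda>n. measure lborel (\<Omega> \<inter> upper \<nu> (real n))) \<longlonglongrightarrow> measure lborel (\<Inter>n. \<Omega> \<inter> upper \<nu> (real n))"
    using finite_sub[of "\<Omega> \<inter> upper \<nu> (real _)"]
    by (intro Lim_measure_decseq) (auto simp: decseq_def upper_def less_top[symmetric])
  moreover have "(\<Inter>n. \<Omega> \<inter> upper \<nu> (real n)) = {}"
    by (auto simp: upper_def) (metis not_le reals_Archimedean2)
  ultimately have lim: "(\<lambda>n. V \<nu> (real n)) \<longlonglongrightarrow> 0" by (simp add: V_def)
  show ?thesis
  proof (rule order_tendstoI)
    fix a :: real assume "a < 0"
    then show "\<forall>\<^sub>F l in at_top. a < V \<nu> l" using V_bounds(1) by (intro always_eventually) (auto intro: less_le_trans)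
  next
    fix a :: real assume "0 < a"
    then obtain n where "V \<nu> (real n) < a" using order_tendstoD(2)[OF lim] by (auto simp: eventually_sequentially)
    then have "V \<nu> l < a" if "real n \<le> l" for l using antimonoD[OF V_antimono that, of \<nu>] by linarith
    then show "\<forall>\<^sub>F l in at_top. V \<nu> l < a" by (auto simp: eventually_at_top_linorder)
  qed
qed

text \<open>The integral of \<open>b\<close> is at most \<open>A\<close>, so \<open>b\<close> cannot
  stay above \<open>e\<close> on a half-line. Such cuts remove a far end of a possibly unbounded
  \<open>\<Omega>\<close>.\<close>

lemma small_cut:
  assumes "0 < e"
  obtains l where "V \<nu> l < e" "b \<nu> l < ennreal e"
proof -
  obtain L where L: "\<And>l. L \<le> l \<Longrightarrow> V \<nu> l < e"
    using order_tendstoD(2)[OF V_tendsto_0 assms] by (auto simp: eventually_at_top_linorder)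
  have "\<exists>l\<ge>L. b \<nu> l < ennreal e"
  proof (rule ccontr)
    assume "\<not> ?thesis"
    then have n: "ennreal e \<le> b \<nu> l" if "L \<le> l" for l using that by (simp add: not_less)
    define T where "T = A / e + 1"
    have T: "0 \<le> T" using A assms by (simp add: T_def)
    have "ennreal (e * T) = (\<integral>\<^sup>+l. ennreal e * indicator {L..L + T} l \<partial>lborel)"
      using T assms by (simp add: nn_integral_cmult_indicator ennreal_mult)
    also have "\<dots> \<le> (\<integral>\<^sup>+l. b \<nu> l \<partial>lborel)" using n by (intro nn_integral_mono) (auto simp: indicator_def)
    also have "\<dots> \<le> ennreal A" by (rule nn_integral_b)
    finally have "e * T \<le> A" using A by (simp add: ennreal_le_iff)
    then show False using assms by (simp add: T_def distrib_left)
  qed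
  then show thesis using L that by blast
qed

definition p0 :: real where "p0 = 3 * root 3 (4 / 3 * pi) * (root 3 A)\<^sup>2"

lemma p0_pos: "0 < p0" using A by (simp add: p0_def)

lemma ex_unit: obtains \<nu> :: "real^3" where "norm \<nu> = 1"
  using norm_axis_1 by blast

text \<open>The cap for \<open>\<beta> = 1\<close> is the whole unit ball, and the field obtained
  for it is tested on \<open>\<Omega>\<close> itself.\<close>

lemma isoperimetric: "p0 \<le> P"
proof (rule field_le_epsilon)
  fix e :: real assume e: "0 < e"
  obtain \<nu> :: "real^3" where \<nu>: "norm \<nu> = 1" by (rule ex_unit)
  have cap: "measure lborel (cap \<nu> 1) = 4 / 3 * pi" using measure_cap[OF \<nu>, of 1] by simp
  have 1: "0 < measure lborel \<Omega>" "-1 \<le> (1::real)" "0 < measure lborel (cap \<nu> 1)" using measure_\<Omega> A by (simp_all add: cap)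
  obtain \<phi> where \<phi>: "bounded_divergence \<phi>" "\<And>x. norm (\<phi> x) \<le> 1"
    "3 * root 3 (measure lborel (cap \<nu> 1)) * (root 3 (measure lborel \<Omega>))\<^sup>2 - e \<le> flux \<Omega> \<phi>"
    using capillary_isoperimetric[OF borel finite_volume 1(1) \<nu> 1(2,3) e] by metis
  have "flux \<Omega> \<phi> \<le> P" using P finite_volume \<phi> by (intro flux_le_bounded_divergence) auto
  then show "p0 \<le> P + e" using \<phi>(3) unfolding cap measure_\<Omega> p0_def by linarith
qed

end

section \<open>The cost of restoring volume by dilation\<close>

lemma affine_piece:
  fixes t :: real
  assumes F[measurable]: "F \<in> sets borel" and vol: "emeasure lborel F = ennreal a" "0 \<le> a"
    and per: "perimeter F \<le> ennreal p" "0 \<le> p" and cou: "coulomb F F \<le> ennreal (2 * e)" "0 \<le> e" and t: "0 < t"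
  shows "\<exists>F'. F' \<in> sets borel \<and> emeasure lborel F' = ennreal (t ^ 3 * a) \<and> perimeter F' \<le> ennreal (t\<^sup>2 * p)
    \<and> coulomb F' F' \<le> ennreal (2 * (t ^ 5 * e)) \<and> (\<forall>y. y \<in> F' \<longleftrightarrow> (y - c) /\<^sub>R t \<in> F)"
proof -
  obtain F' where F': "F' \<in> sets borel" "\<And>x. c + t *\<^sub>R x \<in> F' \<longleftrightarrow> x \<in> F" "\<And>y. y \<in> F' \<longleftrightarrow> (y - c) /\<^sub>R t \<in> F"
    "emeasure lborel F' = ennreal (t ^ 3) * emeasure lborel F"
    using affine_image_borel[OF F t, of c] by blast
  have "perimeter F' \<le> ennreal (t\<^sup>2 * p)" by (rule perimeter_affine[OF F F'(1) per(2,1) t F'(2)])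
  moreover have "coulomb F' F' = ennreal (t ^ 5) * coulomb F F"
    by (rule coulomb_affine[OF F F F'(1) F'(1) t F'(2) F'(2)])
  then have "coulomb F' F' \<le> ennreal (t ^ 5) * ennreal (2 * e)" using cou by (simp add: mult_left_mono)
  then have "coulomb F' F' \<le> ennreal (2 * (t ^ 5 * e))" using cou t by (simp add: ennreal_mult[symmetric] mult_ac)
  moreover have "emeasure lborel F' = ennreal (t ^ 3 * a)" using F'(4) vol t by (simp add: ennreal_mult)
  ultimately show ?thesis using F' by blast
qed

text \<open>As a function of the volume \<open>v = s ^ 3\<close> the right-hand side is the convex
  power v^(5/3), and the left-hand side is its tangent at 1. The difference has a double root at
  \<open>s = 1\<close>.\<close>

lemma fifth_power_ge_tangent:
  fixes s :: real
  assumes "0 \<le> s"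
  shows "1 - 5 / 3 * (1 - s ^ 3) \<le> s ^ 5"
proof -
  have "0 \<le> (1 - s)\<^sup>2 * (3 * s ^ 3 + 6 * s\<^sup>2 + 4 * s + 2)" using assms by simp
  also have "\<dots> = 3 * s ^ 5 - 5 * s ^ 3 + 2" by (simp add: power2_eq_square power3_eq_cube eval_nat_numeral algebra_simps)
  finally have "5 * s ^ 3 \<le> 3 * s ^ 5 + 2" by simp
  then have "5 * s ^ 3 / 3 \<le> (3 * s ^ 5 + 2) / 3" by (rule divide_right_mono) simp
  then show ?thesis by (simp add: field_simps)
qed

context minimizer
begin

lemma lower_perimeter:
  assumes "\<And>\<psi>. C1_compact_support \<psi> \<Longrightarrow> (\<And>x. norm (\<psi> x) \<le> 1) \<Longrightarrow> flux (\<Omega> - upper \<nu> l) \<psi> \<le> q"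
  shows "perimeter (\<Omega> - upper \<nu> l) \<le> ennreal q" "0 \<le> q"
proof -
  show 0: "0 \<le> q" using assms[OF zero_field(1)] by (simp add: zero_field)
  show "perimeter (\<Omega> - upper \<nu> l) \<le> ennreal q" using assms by (intro perimeter_le 0) auto
qed

text \<open>Room for the ball has to be made first, as \<open>\<Omega>\<close> may be unbounded: an
  end of volume below \<open>e\<close> is discarded with perimeter cost at most \<open>e\<close>,
  and the rest is scaled to volume \<open>3 / 4 * A\<close>.\<close>

lemma shrink:
  assumes t: "0 < t" "V \<nu> l < e" "e < A" "b \<nu> l < ennreal e" "t ^ 3 = 3 / 4 * A / (A - V \<nu> l)" and \<nu>: "norm \<nu> = 1"
    and r: "0 < r" "4 / 3 * pi * r ^ 3 = A / 4"
  shows "P + D \<le> t\<^sup>2 * (P + e) + t ^ 5 * D + 4 * pi * r\<^sup>2 + 16 / 15 * pi\<^sup>2 * r ^ 5"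
proof -
  let ?L = "\<Omega> - upper \<nu> l"
  have e: "0 < e" using t V_bounds[of \<nu> l] by linarith
  have fl: "flux ?L \<psi> \<le> P + e" if "C1_compact_support \<psi>" "\<And>x. norm (\<psi> x) \<le> 1" for \<psi>
  proof -
    \<comment> \<open>The zero field on the discarded end permits \<open>\<beta> = 0\<close>, so the
      section counts once.\<close>
    have "flux (\<Omega> \<inter> upper \<nu> l) (\<lambda>x. 0) + flux ?L \<psi> \<le> P + (1 + 0) * e"
      using that zero_field(1) t \<nu> by (intro cut C1_compact_support_bounded_divergence) auto
    then show ?thesis by (simp add: zero_field)
  qed
  have per: "perimeter ?L \<le> ennreal (P + e)" "0 \<le> P + e"
    by (rule lower_perimeter, rule fl, assumption, blast)+
  obtain d g where dg: "0 \<le> d" "0 \<le> g" "coulomb ?L ?L = ennreal (2 * g)" "D = d + g + enn2real (I \<nu> l)"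
    using coulomb_parts[of \<nu> l] by blast
  have gD: "g \<le> D" using dg by simp
  obtain G where G: "G \<in> sets borel" "emeasure lborel G = ennreal (t ^ 3 * (A - V \<nu> l))" "perimeter G \<le> ennreal (t\<^sup>2 * (P + e))"
    "coulomb G G \<le> ennreal (2 * (t ^ 5 * g))" "\<And>y. y \<in> G \<longleftrightarrow> (y - 0) /\<^sub>R t \<in> ?L"
    using affine_piece[of ?L "A - V \<nu> l" "P + e" g t 0] per dg t V_bounds emeasure_lower by auto
  \<comment> \<open>The centre is chosen such that the ball touches from above the plane
    \<open>\<nu> \<bullet> x = t * l\<close>, the image of the cutting plane. The constant
    \<open>16 / 15 * pi\<^sup>2\<close> is half of the one in
    \<open>coulomb_unit_ball\<close>.\<close>
  obtain F where F: "F \<in> sets borel" "emeasure lborel F = ennreal (r ^ 3 * (4 / 3 * pi))" "perimeter F \<le> ennreal (r\<^sup>2 * (4 * pi))"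
    "coulomb F F \<le> ennreal (2 * (r ^ 5 * (16 / 15 * pi\<^sup>2)))" "\<And>y. y \<in> F \<longleftrightarrow> (y - (t * l + r) *\<^sub>R \<nu>) /\<^sub>R r \<in> cball 0 1"
    using affine_piece[of "cball 0 1" "4 / 3 * pi" "4 * pi" "16 / 15 * pi\<^sup>2" r "(t * l + r) *\<^sub>R \<nu>"]
      perimeter_unit_ball coulomb_unit_ball r emeasure_ball3[of 1 0] by auto
  have \<nu>\<nu>: "\<nu> \<bullet> \<nu> = 1" using \<nu> by (simp add: power2_norm_eq_inner[symmetric])
  have sepF: "t * l \<le> \<nu> \<bullet> y" if "y \<in> F" for y
  proof -
    have "norm ((y - (t * l + r) *\<^sub>R \<nu>) /\<^sub>R r) \<le> 1" using F(5)[of y] that by (simp only: mem_cball_0)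
    then have "norm (y - (t * l + r) *\<^sub>R \<nu>) \<le> r" using r by (simp only: norm_scaleR) (simp add: field_simps)
    then have "\<bar>\<nu> \<bullet> (y - (t * l + r) *\<^sub>R \<nu>)\<bar> \<le> r" using Cauchy_Schwarz_ineq2[of \<nu> "y - (t * l + r) *\<^sub>R \<nu>"] \<nu> by simp
    then show ?thesis using \<nu>\<nu> by (simp add: inner_diff_right abs_le_iff)
  qed
  have sepG: "\<nu> \<bullet> y \<le> t * l" if "y \<in> G" for y
  proof -
    have "\<nu> \<bullet> (y /\<^sub>R t) < l" using G(5)[of y] that by (simp add: upper_def)
    then show ?thesis using t by (simp add: field_simps)
  qed
  have vol: "t ^ 3 * (A - V \<nu> l) = 3 / 4 * A" 
  proof -
    have "A - V \<nu> l \<noteq> 0" using t by linarith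
    then show ?thesis unfolding t(5) by (metis nonzero_eq_divide_eq)
  qed
  have volF: "emeasure lborel F = ennreal (A / 4)" unfolding F(2) using r(2) by (simp only: mult.commute)
  have "min_energy (A / 4 + 3 / 4 * A) \<le> ennreal (r\<^sup>2 * (4 * pi) + t\<^sup>2 * (P + e) + r ^ 5 * (16 / 15 * pi\<^sup>2) + t ^ 5 * g)"
    using A t(1) per(2) dg(2)
    by (intro min_energy_split[OF F(1) G(1) \<nu> sepF sepG volF G(2)[unfolded vol] _ _ F(3) G(3) _ _ F(4) G(4)] mult_nonneg_nonneg zero_le_power) (use r in simp_all)
  then have "ennreal (P + D) \<le> ennreal (r\<^sup>2 * (4 * pi) + t\<^sup>2 * (P + e) + r ^ 5 * (16 / 15 * pi\<^sup>2) + t ^ 5 * g)"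
    using min by simp
  then have "P + D \<le> r\<^sup>2 * (4 * pi) + t\<^sup>2 * (P + e) + r ^ 5 * (16 / 15 * pi\<^sup>2) + t ^ 5 * g"
    using per(2) dg(2) t(1) r(1) by (subst (asm) ennreal_le_iff) simp_all
  moreover have "t ^ 5 * g \<le> t ^ 5 * D" using gD t by simp
  ultimately show ?thesis by (simp add: mult.commute)
qed

text \<open>The limit of \<open>shrink\<close> for \<open>e\<close> tending to 0. A ball of volume
  \<open>v\<close> has Coulomb energy \<open>v / 5\<close> times its perimeter, hence the factor
  \<open>1 + A / 20\<close> for volume \<open>A / 4\<close>.\<close>

lemma shrink_bound:
  "P + D \<le> (root 3 (3/4))\<^sup>2 * P + root 3 (3/4) ^ 5 * D + p0 * (root 3 (1/4))\<^sup>2 * (1 + A / 20)"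
proof -
  obtain \<nu> :: "real^3" where \<nu>: "norm \<nu> = 1" by (rule ex_unit)
  define \<delta> w \<alpha> r where "\<delta> = root 3 (1/4)" and "w = root 3 (4 / 3 * pi)" and "\<alpha> = root 3 A" and "r = \<delta> * \<alpha> / w"
  have pos: "0 < \<delta>" "0 < w" "0 < \<alpha>" "0 < r" using A by (simp_all add: \<delta>_def w_def \<alpha>_def r_def)
  have cubes: "\<delta> ^ 3 = 1/4" "w ^ 3 = 4 / 3 * pi" "\<alpha> ^ 3 = A" using A by (simp_all add: \<delta>_def w_def \<alpha>_def real_root_pow_pos2)
  have p0: "p0 = 3 * w * \<alpha>\<^sup>2" by (simp add: p0_def w_def \<alpha>_def)
  have r: "4 / 3 * pi * r ^ 3 = A / 4"
    unfolding r_def power_divide power_mult_distrib cubes by simp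
  have S: "4 * pi * r\<^sup>2 = p0 * \<delta>\<^sup>2"
  proof -
    have "4 * pi * r\<^sup>2 = 3 * w ^ 3 * (\<delta> * \<alpha> / w)\<^sup>2" unfolding cubes r_def by simp
    then show ?thesis unfolding p0 using pos by (simp add: field_simps power2_eq_square power3_eq_cube)
  qed
  have T: "16 / 15 * pi\<^sup>2 * r ^ 5 = p0 * \<delta>\<^sup>2 * (A / 20)"
  proof -
    have "16 / 15 * pi\<^sup>2 = 3 / 5 * (w ^ 3)\<^sup>2" unfolding cubes by (simp add: power2_eq_square)
    then have "16 / 15 * pi\<^sup>2 * r ^ 5 = 3 / 5 * (w ^ 3)\<^sup>2 * (\<delta> * \<alpha> / w) ^ 5" by (simp add: r_def)
    also have "\<dots> = 3 * w * \<alpha>\<^sup>2 * \<delta>\<^sup>2 * (\<delta> ^ 3 * \<alpha> ^ 3 / 5)" using pos by (simp add: field_simps eval_nat_numeral)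
    finally show ?thesis unfolding cubes p0 by simp
  qed
  define e where "e n = A / 2 * (1 / real (Suc n))" for n
  define t where "t n = root 3 (3 / 4 * A / (A - e n))" for n
  have e0: "e \<longlonglongrightarrow> A / 2 * 0"
    unfolding e_def using LIMSEQ_inverse_real_of_nat by (intro tendsto_intros) (simp add: inverse_eq_divide)
  have e: "0 < e n" "e n < A" for n
  proof -
    have "1 / real (Suc n) \<le> 1" by simp
    then have "e n \<le> A / 2 * 1" unfolding e_def using A by (intro mult_left_mono) auto
    then show "e n < A" using A by linarith
    show "0 < e n" using A by (simp add: e_def)
  qed
  have t0: "t \<longlonglongrightarrow> root 3 (3 / 4 * A / (A - A / 2 * 0))" unfolding t_def using A by (intro tendsto_intros e0) auto
  have lim: "(\<lambda>n. (t n)\<^sup>2 * (P + e n) + (t n) ^ 5 * D + p0 * \<delta>\<^sup>2 * (1 + A / 20))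
    \<longlonglongrightarrow> (root 3 (3/4))\<^sup>2 * (P + 0) + root 3 (3/4) ^ 5 * D + p0 * \<delta>\<^sup>2 * (1 + A / 20)"
    using t0 e0 A by (intro tendsto_intros) simp_all
  have "P + D \<le> (t n)\<^sup>2 * (P + e n) + (t n) ^ 5 * D + p0 * \<delta>\<^sup>2 * (1 + A / 20)" for n
  proof -
    obtain l where l: "V \<nu> l < e n" "b \<nu> l < ennreal (e n)" using small_cut[OF e(1)] by blast
    define s where "s = root 3 (3 / 4 * A / (A - V \<nu> l))"
    have pos': "0 < 3 / 4 * A / (A - V \<nu> l)" using l e[of n] A by simp
    have s: "0 < s" "s ^ 3 = 3 / 4 * A / (A - V \<nu> l)" using pos' by (simp_all add: s_def real_root_pow_pos2)
    \<comment> \<open>The dilation factor \<open>s\<close> depends on the cut found;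
      \<open>t n\<close> is an upper bound for it that depends on \<open>n\<close> only and
      converges.\<close>
    have st: "s \<le> t n" unfolding s_def t_def
      using l e[of n] A by (intro real_root_le_mono divide_left_mono mult_pos_pos) auto
    have "P + D \<le> s\<^sup>2 * (P + e n) + s ^ 5 * D + 4 * pi * r\<^sup>2 + 16 / 15 * pi\<^sup>2 * r ^ 5"
      by (rule shrink[OF s(1) l(1) e(2) l(2) s(2) \<nu> pos(4) r])
    also have "\<dots> = s\<^sup>2 * (P + e n) + s ^ 5 * D + p0 * \<delta>\<^sup>2 * (1 + A / 20)" unfolding S T by (simp add: algebra_simps)
    also have "\<dots> \<le> (t n)\<^sup>2 * (P + e n) + (t n) ^ 5 * D + p0 * \<delta>\<^sup>2 * (1 + A / 20)"
      using s(1) st P(2) D(2) e(1)[of n] by (intro add_mono mult_right_mono power_mono order_refl) auto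
    finally show ?thesis .
  qed
  then show ?thesis using LIMSEQ_le_const[OF lim] by (auto simp: \<delta>_def)
qed

text \<open>Rounded up from \<open>(7 * S - 3 + 3.5 * T) / (3 * (1 - 3/4 * T))\<close> with S =
  (1/4)^(2/3) and T = (3/4)^(2/3), the value that results from \<open>shrink_bound\<close> at
  \<open>A = 8\<close>.\<close>

definition \<Lambda> :: real where "\<Lambda> = 2.3342"

text \<open>\<open>shrink_bound\<close> controls \<open>D\<close> by \<open>P\<close> and
  \<open>p0\<close>. When it is used to bound \<open>2 * P + 5 * D\<close>, the perimeter is left
  with the negative coefficient \<open>- (3 - 3.5 * T)\<close>, so the lower bound
  \<open>isoperimetric\<close> eliminates it.\<close>

lemma multiplier_bound:
  assumes "A \<le> 8"
  shows "(2 * P + 5 * D) / 3 \<le> \<Lambda> * p0"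
proof -
  define T S where "T = (root 3 (3/4))\<^sup>2" and "S = (root 3 (1/4))\<^sup>2"
  have S: "S \<le> 0.396851"
  proof (rule power_le_imp_le_base[of _ 2])
    have "S ^ 3 = (root 3 (1/4) ^ 3)\<^sup>2" unfolding S_def by (simp only: power_mult[symmetric] mult.commute)
    also have "\<dots> = 1/16" by (simp add: real_root_pow_pos2 power2_eq_square)
    finally show "S ^ Suc 2 \<le> 0.396851 ^ Suc 2" by (simp add: eval_nat_numeral)
  qed simp
  have T: "T \<le> 0.825482"
  proof (rule power_le_imp_le_base[of _ 2])
    have "T ^ 3 = (root 3 (3/4) ^ 3)\<^sup>2" unfolding T_def by (simp only: power_mult[symmetric] mult.commute)
    also have "\<dots> = 9/16" by (simp add: real_root_pow_pos2 power2_eq_square)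
    finally show "T ^ Suc 2 \<le> 0.825482 ^ Suc 2" by (simp add: eval_nat_numeral)
  qed simp
  have "root 3 (3/4) ^ 5 = root 3 (3/4) ^ 3 * T" unfolding T_def power_add[symmetric] by simp
  then have T5: "root 3 (3/4) ^ 5 = 3/4 * T" by (simp add: real_root_pow_pos2)
  have "P + D \<le> T * P + 3/4 * T * D + p0 * S * (1 + A / 20)" using shrink_bound unfolding T5 T_def S_def by simp
  \<comment> \<open>The number \<open>1.4\<close> is \<open>1 + A / 20\<close> at
    \<open>A = 8\<close>.\<close>
  also have "p0 * S * (1 + A / 20) \<le> p0 * S * 1.4" using assms p0_pos by (intro mult_left_mono) (auto simp: S_def)
  finally have "5 * (1 - 3/4 * T) * D \<le> 7 * S * p0 - 5 * (1 - T) * P" by (simp add: algebra_simps)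
  then have "(1 - 3/4 * T) * (2 * P + 5 * D) \<le> 7 * S * p0 - (3 - 3.5 * T) * P" by (simp add: algebra_simps)
  also have "(3 - 3.5 * T) * p0 \<le> (3 - 3.5 * T) * P" using T isoperimetric by (intro mult_left_mono) auto
  then have "7 * S * p0 - (3 - 3.5 * T) * P \<le> (7 * S - 3 + 3.5 * T) * p0" by (simp add: algebra_simps)
  also have "\<dots> \<le> ((1 - 3/4 * T) * (3 * \<Lambda>)) * p0" using S T p0_pos by (intro mult_right_mono) (auto simp: \<Lambda>_def)
  finally have "(1 - 3/4 * T) * (2 * P + 5 * D) \<le> (1 - 3/4 * T) * (3 * \<Lambda> * p0)" by (simp add: mult_ac)
  then have "2 * P + 5 * D \<le> 3 * \<Lambda> * p0" using T by (subst (asm) mult_le_cancel_left_pos) auto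
  then show ?thesis by simp
qed

section \<open>Cuts with a small upper part\<close>

lemma I_null:
  assumes "V \<nu> l = 0"
  shows "I \<nu> l = 0"
proof -
  have "\<Omega> \<inter> upper \<nu> l \<in> null_sets lborel" using assms emeasure_upper[of \<nu> l] by (intro null_setsI) auto
  then have "AE x in lborel. x \<in> \<Omega> \<inter> upper \<nu> l \<longleftrightarrow> x \<in> {}" by (rule AE_mp[OF AE_not_in]) simp
  then have "I \<nu> l = coulomb {} (\<Omega> - upper \<nu> l)" unfolding I_def by (rule coulomb_cong_AE) simp
  then show ?thesis by (simp add: coulomb_def)
qed

text \<open>Here \<open>k\<close> is the volume of the cap relative to that of the unit ball.\<close>

lemma dilated_cut:
  assumes \<nu>: "norm \<nu> = 1" and \<beta>: "-1 < \<beta>" "\<beta> \<le> 1" and c: "0 \<le> c" "b \<nu> l < ennreal c" and e: "0 < e"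
    and x: "0 < x" "x < 1" "V \<nu> l = x * A" and k: "k = (2 + 3 * \<beta> - \<beta> ^ 3) / 4" "0 < k"
  shows "enn2real (I \<nu> l) \<le> x * (2 * P + 5 * D) / 3 + (1 - x) * ((1 + \<beta>) * c + e - p0 * root 3 k * (root 3 x)\<^sup>2)"
proof -
  let ?U = "\<Omega> \<inter> upper \<nu> l" and ?L = "\<Omega> - upper \<nu> l"
  have cap: "measure lborel (cap \<nu> \<beta>) = 4 / 3 * pi * k"
    using measure_cap[OF \<nu>, of \<beta>] \<beta> by (simp add: k field_simps)
  have vol: "measure lborel ?U = x * A" using x by (simp add: V_def)
  have pre: "?U \<in> sets borel" "emeasure lborel ?U < \<infinity>" "0 < measure lborel ?U" "-1 \<le> \<beta>" "0 < measure lborel (cap \<nu> \<beta>)"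
    using finite_sub[of ?U] x A k \<beta> by (auto simp: vol cap)
  obtain \<phi> where \<phi>: "bounded_divergence \<phi>" "\<And>x. norm (\<phi> x) \<le> 1" "\<And>x. - \<beta> \<le> \<nu> \<bullet> \<phi> x"
    "3 * root 3 (measure lborel (cap \<nu> \<beta>)) * (root 3 (measure lborel ?U))\<^sup>2 - e \<le> flux ?U \<phi>"
    using capillary_isoperimetric[OF pre(1-3) \<nu> pre(4,5) e] by metis
  define g where "g = p0 * root 3 k * (root 3 x)\<^sup>2"
  have g: "g - e \<le> flux ?U \<phi>"
    using \<phi>(4) unfolding cap vol g_def p0_def real_root_mult power_mult_distrib by (simp add: mult_ac)
  \<comment> \<open>The lower part inherits the bound of the glued pair minus the flux
    \<open>g - e\<close> already produced by the upper part.\<close>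
  define Q where "Q = P + (1 + \<beta>) * c - (g - e)"
  have fl: "flux ?L \<psi> \<le> Q" if "C1_compact_support \<psi>" "\<And>x. norm (\<psi> x) \<le> 1" for \<psi>
  proof -
    have "flux ?U \<phi> + flux ?L \<psi> \<le> P + (1 + \<beta>) * c"
      using that(2) \<beta> by (intro cut[OF \<nu> c(2) \<phi>(1-3) C1_compact_support_bounded_divergence[OF that(1)]]) auto
    then show ?thesis using g by (simp add: Q_def)
  qed
  have per: "perimeter ?L \<le> ennreal Q" "0 \<le> Q"
    by (rule lower_perimeter, rule fl, assumption, blast)+
  obtain d f where df: "0 \<le> d" "0 \<le> f" "coulomb ?L ?L = ennreal (2 * f)" "D = d + f + enn2real (I \<nu> l)"
    using coulomb_parts[of \<nu> l] by blast
  define s where "s = root 3 (1 - x)"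
  have s: "0 < s" "s ^ 3 = 1 - x" using x by (simp_all add: s_def real_root_pow_pos2)
  have t: "0 < 1 / s" using s by simp
  have AV: "A - V \<nu> l = s ^ 3 * A" unfolding s x by (simp add: algebra_simps)
  obtain G where G: "G \<in> sets borel" "emeasure lborel G = ennreal ((1 / s) ^ 3 * (s ^ 3 * A))" "perimeter G \<le> ennreal ((1 / s)\<^sup>2 * Q)"
    "coulomb G G \<le> ennreal (2 * ((1 / s) ^ 5 * f))"
    using affine_piece[OF _ emeasure_lower[of \<nu> l, unfolded AV] _ per eq_refl[OF df(3)] df(2) t, of 0] s(1) A by auto
  have "ennreal (P + D) \<le> perimeter G + (1/2) * coulomb G G"
    using G s by (intro order_trans[OF min] min_energy_le) (auto simp: power_divide)
  also have "\<dots> \<le> ennreal ((1 / s)\<^sup>2 * Q) + (1/2) * ennreal (2 * ((1 / s) ^ 5 * f))"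
    using G by (intro add_mono mult_left_mono) auto
  also have "\<dots> = ennreal ((1 / s)\<^sup>2 * Q + (1 / s) ^ 5 * f)"
    using s(1) df(2) per(2) by (subst half_ennreal) (simp_all add: ennreal_plus)
  finally have "P + D \<le> (1 / s)\<^sup>2 * Q + (1 / s) ^ 5 * f" using s(1) df(2) per(2) by (subst (asm) ennreal_le_iff) simp_all
  then have "s ^ 5 * (P + D) \<le> s ^ 5 * ((1 / s)\<^sup>2 * Q + (1 / s) ^ 5 * f)" using s by (intro mult_left_mono) auto
  also have "\<dots> = s ^ 3 * Q + f" using s by (simp add: field_simps eval_nat_numeral)
  also have "\<dots> \<le> (1 - x) * Q + (D - enn2real (I \<nu> l))" using df s by simp
  finally have 1: "s ^ 5 * (P + D) \<le> (1 - x) * Q + (D - enn2real (I \<nu> l))" .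
  \<comment> \<open>The tangent bound makes the cost linear in \<open>x\<close>: together with the
    term \<open>(1 - x) * Q\<close> it leaves \<open>2 / 3 * x\<close> of \<open>P\<close> and
    \<open>5 / 3 * x\<close> of \<open>D\<close>.\<close>
  have "(1 - 5 / 3 * x) * (P + D) \<le> s ^ 5 * (P + D)"
    using fifth_power_ge_tangent[of s] s P D by (intro mult_right_mono) auto
  then have "enn2real (I \<nu> l) \<le> (1 - x) * Q + D - (1 - 5 / 3 * x) * (P + D)" using 1 by linarith
  also have "\<dots> = x * (2 * P + 5 * D) / 3 + (1 - x) * ((1 + \<beta>) * c + e - g)" by (simp add: Q_def algebra_simps)
  finally show ?thesis unfolding g_def .
qed

text \<open>In \<open>dilated_cut\<close> the cost \<open>x * \<Lambda> * p0\<close> of restoring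
  the volume must not exceed the gain \<open>(1 - x) * p0 * root 3 k * (root 3 x)\<^sup>2\<close>.
  After division and cubing this is \<open>\<Lambda> ^ 3 * x \<le> (1 - x) ^ 3 * k\<close>, which
  gets easier as \<open>x\<close> decreases, so it is needed only at the threshold
  \<open>X\<close>.\<close>

lemma I_le_capillary:
  assumes "A \<le> 8" and \<nu>: "norm \<nu> = 1" and \<beta>: "-1 < \<beta>" "\<beta> \<le> 1" and X: "V \<nu> l < A * X" "X < 1"
    and k: "k = (2 + 3 * \<beta> - \<beta> ^ 3) / 4" and le: "\<Lambda> ^ 3 * X \<le> (1 - X) ^ 3 * k"
  shows "I \<nu> l \<le> ennreal (1 + \<beta>) * b \<nu> l"
proof (cases "V \<nu> l = 0")
  case True
  then show ?thesis by (simp add: I_null)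
next
  case False
  define x where "x = V \<nu> l / A"
  have x: "0 < x" "x < X" "V \<nu> l = x * A" using False V_bounds(1)[of \<nu> l] X A by (auto simp: x_def field_simps)
  have kpos: "0 < k"
  proof -
    have "0 < (1 - X) ^ 3 * k" using le x X by (intro less_le_trans[OF _ le] mult_pos_pos) (auto simp: \<Lambda>_def)
    then show ?thesis using X by (simp add: zero_less_mult_iff)
  qed
  have "\<Lambda> ^ 3 * x \<le> \<Lambda> ^ 3 * X" using x by (simp add: \<Lambda>_def)
  also note le
  also have "(1 - X) ^ 3 * k \<le> (1 - x) ^ 3 * k" using x X kpos by (intro mult_right_mono power_mono) auto
  finally have "root 3 (\<Lambda> ^ 3 * x) \<le> root 3 ((1 - x) ^ 3 * k)" by simp
  then have root: "\<Lambda> * root 3 x \<le> (1 - x) * root 3 k"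
    using x X by (simp add: real_root_mult real_root_power_cancel \<Lambda>_def)
  have main: "x * (2 * P + 5 * D) / 3 \<le> (1 - x) * (p0 * root 3 k * (root 3 x)\<^sup>2)"
  proof -
    have "x * ((2 * P + 5 * D) / 3) \<le> x * (\<Lambda> * p0)" using x multiplier_bound[OF assms(1)] by (intro mult_left_mono) auto
    also have "\<dots> = (root 3 x) ^ 3 * (\<Lambda> * p0)" using x by (simp add: real_root_pow_pos2)
    also have "\<dots> = (\<Lambda> * root 3 x) * ((root 3 x)\<^sup>2 * p0)" by (simp add: power2_eq_square power3_eq_cube)
    also have "\<dots> \<le> ((1 - x) * root 3 k) * ((root 3 x)\<^sup>2 * p0)" using root p0_pos by (intro mult_right_mono) auto
    finally show ?thesis by (simp add: mult_ac)
  qed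
  show ?thesis
  proof (rule le_of_all_larger)
    fix c :: real assume c: "0 \<le> c" "b \<nu> l < ennreal c"
    have "enn2real (I \<nu> l) \<le> (1 + \<beta>) * c"
    proof (rule field_le_epsilon)
      fix e :: real assume e: "0 < e"
      have "enn2real (I \<nu> l) \<le> x * (2 * P + 5 * D) / 3 + (1 - x) * ((1 + \<beta>) * c + e - p0 * root 3 k * (root 3 x)\<^sup>2)"
        using x X by (intro dilated_cut \<nu> \<beta> c e k kpos) auto
      also have "\<dots> \<le> (1 - x) * ((1 + \<beta>) * c + e)" using main by (simp add: right_diff_distrib)
      also have "\<dots> \<le> 1 * ((1 + \<beta>) * c + e)" using x X \<beta> c e by (intro mult_right_mono) auto
      finally show "enn2real (I \<nu> l) \<le> (1 + \<beta>) * c + e" by simp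
    qed
    moreover have "I \<nu> l = ennreal (enn2real (I \<nu> l))" using coulomb_parts by blast
    ultimately show "I \<nu> l \<le> ennreal ((1 + \<beta>) * c)" by (metis ennreal_leI)
  qed (use \<beta> in simp)
qed

text \<open>Rational lower approximations to the solutions \<open>x\<close> of \<open>\<Lambda>\<^sup>3 x = (1 - x)\<^sup>3 k(\<beta>)\<close> at \<open>\<beta> = 1 - (m + 1)/8\<close>.\<close>

definition steps :: "real list" where
  "steps = [0.0637, 0.0620, 0.0593, 0.0558, 0.0515, 0.0465, 0.0411, 0.0352, 0.0292, 0.0231, 0.0173, 0.0118, 0.0071, 0.0033, 0.0008]"

lemma steps:
  assumes "m < 15"
  shows "0 \<le> steps ! m" "steps ! m < 1/2" "\<Lambda> ^ 3 * steps ! m \<le> (1 - steps ! m) ^ 3 * ((2 + 3 * (1 - real (Suc m) / 8) - (1 - real (Suc m) / 8) ^ 3) / 4)"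
proof -
  have "\<forall>m<15. 0 \<le> steps ! m \<and> steps ! m < 1/2 \<and> \<Lambda> ^ 3 * steps ! m \<le> (1 - steps ! m) ^ 3 * ((2 + 3 * (1 - real (Suc m) / 8) - (1 - real (Suc m) / 8) ^ 3) / 4)"
    unfolding steps_def \<Lambda>_def by (simp add: eval_nat_numeral All_less_Suc power3_eq_cube)
  then show "0 \<le> steps ! m" "steps ! m < 1/2" "\<Lambda> ^ 3 * steps ! m \<le> (1 - steps ! m) ^ 3 * ((2 + 3 * (1 - real (Suc m) / 8) - (1 - real (Suc m) / 8) ^ 3) / 4)"
    using assms by blast+
qed

lemma sum_steps: "(\<Sum>m<15. steps ! m) = 0.5077"
  by (simp add: steps_def numeral_eq_Suc)

end

lemma cmult_liminf_le:
  fixes f :: "nat \<Rightarrow> ennreal"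
  assumes "0 < c"
  shows "ennreal c * liminf f \<le> liminf (\<lambda>n. ennreal c * f n)"
proof -
  have "ennreal c * (SUP n. INF m\<in>{n..}. f m) = (SUP n. ennreal c * (INF m\<in>{n..}. f m))"
    by (rule SUP_mult_left_ennreal)
  also have "\<dots> \<le> (SUP n. INF m\<in>{n..}. ennreal c * f m)"
    by (intro SUP_mono' INF_greatest mult_left_mono INF_lower) auto
  finally show ?thesis by (simp add: liminf_SUP_INF)
qed

lemma AE_not_hyperplane:
  fixes \<nu> :: "real^3"
  assumes "norm \<nu> = 1"
  shows "AE x in lborel. \<nu> \<bullet> x \<noteq> l"
proof -
  have "{x. \<nu> \<bullet> x = l} \<in> null_sets lebesgue"
    unfolding negligible_iff_null_sets[symmetric] using assms by (intro negligible_hyperplane) auto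
  moreover have "{x. \<nu> \<bullet> x = l} \<in> sets lborel" by simp
  ultimately have "{x. \<nu> \<bullet> x = l} \<in> null_sets lborel" by (simp add: null_sets_completion_iff)
  from AE_not_in[OF this] show ?thesis by simp
qed

context minimizer
begin

section \<open>Averaging over all planes\<close>

lemma V_left_continuous: "(\<lambda>n. V \<nu> (l - 1 / real (Suc n))) \<longlonglongrightarrow> V \<nu> l"
proof -
  have "(\<lambda>n. measure lborel (\<Omega> \<inter> upper \<nu> (l - 1 / real (Suc n)))) \<longlonglongrightarrow> measure lborel (\<Inter>n. \<Omega> \<inter> upper \<nu> (l - 1 / real (Suc n)))"
  proof (rule Lim_measure_decseq)
    show "range (\<lambda>n. \<Omega> \<inter> upper \<nu> (l - 1 / real (Suc n))) \<subseteq> sets lborel" by auto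
    show "decseq (\<lambda>n. \<Omega> \<inter> upper \<nu> (l - 1 / real (Suc n)))"
    proof (rule decseq_SucI)
      fix n
      have "l - 1 / real (Suc n) \<le> l - 1 / real (Suc (Suc n))" by (intro diff_left_mono divide_left_mono) auto
      then show "\<Omega> \<inter> upper \<nu> (l - 1 / real (Suc (Suc n))) \<subseteq> \<Omega> \<inter> upper \<nu> (l - 1 / real (Suc n))"
        unfolding upper_def by force
    qed
    show "emeasure lborel (\<Omega> \<inter> upper \<nu> (l - 1 / real (Suc n))) \<noteq> \<infinity>" for n
      using finite_sub[of "\<Omega> \<inter> upper \<nu> (l - 1 / real (Suc n))"] by auto
  qed
  moreover have "(\<Inter>n. \<Omega> \<inter> upper \<nu> (l - 1 / real (Suc n))) = \<Omega> \<inter> upper \<nu> l"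
  proof -
    have "l \<le> \<nu> \<bullet> x" if "\<And>n. l - 1 / real (Suc n) \<le> \<nu> \<bullet> x" for x
    proof (rule ccontr)
      assume "\<not> l \<le> \<nu> \<bullet> x"
      then obtain n where "inverse (real (Suc n)) < l - \<nu> \<bullet> x" using reals_Archimedean[of "l - \<nu> \<bullet> x"] by auto
      then show False using that[of n] by (simp add: inverse_eq_divide)
    qed
    moreover have "l - 1 / real (Suc n) \<le> \<nu> \<bullet> x" if "l \<le> \<nu> \<bullet> x" for n x
      using that by (rule order_trans[rotated]) simp
    ultimately show ?thesis by (auto simp: upper_def)
  qed
  ultimately show ?thesis by (simp add: V_def)
qed

lemma I_eq:
  "I \<nu> l = (\<integral>\<^sup>+x. \<integral>\<^sup>+y. indicator \<Omega> x * indicator \<Omega> y * ennreal (1 / norm (x - y)) * (if \<nu> \<bullet> y < l \<and> l \<le> \<nu> \<bullet> x then 1 else 0) \<partial>lborel \<partial>lborel)"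
  unfolding I_def coulomb_def by (intro nn_integral_cong) (auto simp: indicator_def upper_def)

lemma I_measurable[measurable]: "I \<nu> \<in> borel_measurable borel"
  unfolding I_eq[abs_def] by measurable

text \<open>The integral of \<open>I \<nu>\<close> over all levels, extended from unit vectors to a
  function homogeneous of degree 1, so that directions can be averaged over the ball.\<close>

definition H :: "real^3 \<Rightarrow> ennreal" where
  "H z = (\<integral>\<^sup>+x. \<integral>\<^sup>+y. indicator \<Omega> x * indicator \<Omega> y * ennreal (1 / norm (x - y)) * ennreal (max 0 (z \<bullet> (x - y))) \<partial>lborel \<partial>lborel)"

text \<open>A pair of points \<open>x\<close>, \<open>y\<close> is separated, with \<open>x\<close>
  above, exactly by the levels between \<open>\<nu> \<bullet> y\<close> and
  \<open>\<nu> \<bullet> x\<close>; the length of this interval is the weight in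
  \<open>H\<close>.\<close>

lemma nn_integral_I: "(\<integral>\<^sup>+l. I \<nu> l \<partial>lborel) = H \<nu>"
proof -
  let ?k = "\<lambda>x y. indicator \<Omega> x * indicator \<Omega> y * ennreal (1 / norm (x - y))"
  let ?c = "\<lambda>x y l. if \<nu> \<bullet> y < l \<and> l \<le> \<nu> \<bullet> x then 1 else 0 :: ennreal"
  have "(\<integral>\<^sup>+l. I \<nu> l \<partial>lborel) = (\<integral>\<^sup>+x. \<integral>\<^sup>+l. \<integral>\<^sup>+y. ?k x y * ?c x y l \<partial>lborel \<partial>lborel \<partial>lborel)"
    unfolding I_eq by (rule lborel_pair.Fubini') measurable
  also have "\<dots> = (\<integral>\<^sup>+x. \<integral>\<^sup>+y. \<integral>\<^sup>+l. ?k x y * ?c x y l \<partial>lborel \<partial>lborel \<partial>lborel)"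
    by (rule nn_integral_cong, rule lborel_pair.Fubini') measurable
  also have "\<dots> = H \<nu>"
    unfolding H_def
  proof (rule nn_integral_cong, rule nn_integral_cong)
    fix x y
    have "(\<integral>\<^sup>+l. ?k x y * ?c x y l \<partial>lborel) = ?k x y * (\<integral>\<^sup>+l. indicator {\<nu> \<bullet> y<..\<nu> \<bullet> x} l \<partial>lborel)"
      by (subst nn_integral_cmult[symmetric]) (auto intro!: nn_integral_cong simp: indicator_def)
    also have "(\<integral>\<^sup>+l. indicator {\<nu> \<bullet> y<..\<nu> \<bullet> x} l \<partial>lborel) = ennreal (max 0 (\<nu> \<bullet> (x - y)))"
      by (cases "\<nu> \<bullet> y \<le> \<nu> \<bullet> x") (auto simp: inner_diff_right max_def)
    finally show "(\<integral>\<^sup>+l. ?k x y * ?c x y l \<partial>lborel) = ?k x y * ennreal (max 0 (\<nu> \<bullet> (x - y)))" .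
  qed
  finally show ?thesis .
qed

lemma H_scale: "0 \<le> r \<Longrightarrow> H (r *\<^sub>R z) = ennreal r * H z"
proof -
  assume r: "0 \<le> r"
  have m: "max 0 (r * a) = r * max 0 a" for a using r by (simp add: max_mult_distrib_left)
  have "H (r *\<^sub>R z) = (\<integral>\<^sup>+x. \<integral>\<^sup>+y. ennreal r * (indicator \<Omega> x * indicator \<Omega> y * ennreal (1 / norm (x - y)) * ennreal (max 0 (z \<bullet> (x - y)))) \<partial>lborel \<partial>lborel)"
    unfolding H_def inner_scaleR_left m using r by (intro nn_integral_cong) (simp add: ennreal_mult mult_ac)
  also have "\<dots> = ennreal r * H z"
    unfolding H_def by (subst nn_integral_cmult, measurable, subst nn_integral_cmult, measurable)
  finally show ?thesis .
qed

text \<open>Averaging the weight over directions produces \<open>norm (x - y)\<close>, which cancels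
  the Coulomb kernel and leaves a multiple of the volume of the set of pairs.\<close>

lemma nn_integral_H_ball: "(\<integral>\<^sup>+z. indicator (cball 0 1) z * H z \<partial>lborel) = ennreal (pi / 4 * A\<^sup>2)"
proof -
  let ?k = "\<lambda>x y. indicator \<Omega> x * indicator \<Omega> y * ennreal (1 / norm (x - y))"
  have [measurable]: "cball 0 1 \<in> sets (borel :: (real^3) measure)" by simp
  let ?m = "\<lambda>x y z. indicator (cball 0 1) z * ennreal (max 0 (z \<bullet> (x - y)))"
  have "(\<integral>\<^sup>+z. indicator (cball 0 1) z * H z \<partial>lborel) = (\<integral>\<^sup>+z. \<integral>\<^sup>+x. \<integral>\<^sup>+y. ?k x y * ?m x y z \<partial>lborel \<partial>lborel \<partial>lborel)"
  proof (rule nn_integral_cong)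
    fix z :: "real^3"
    have "indicator (cball 0 1) z * H z = (\<integral>\<^sup>+x. \<integral>\<^sup>+y. indicator (cball 0 1) z * (?k x y * ennreal (max 0 (z \<bullet> (x - y)))) \<partial>lborel \<partial>lborel)"
      unfolding H_def by (subst nn_integral_cmult, measurable, subst nn_integral_cmult, measurable)
    then show "indicator (cball 0 1) z * H z = (\<integral>\<^sup>+x. \<integral>\<^sup>+y. ?k x y * ?m x y z \<partial>lborel \<partial>lborel)" by (simp add: mult_ac)
  qed
  also have "\<dots> = (\<integral>\<^sup>+x. \<integral>\<^sup>+z. \<integral>\<^sup>+y. ?k x y * ?m x y z \<partial>lborel \<partial>lborel \<partial>lborel)"
    by (rule lborel_pair.Fubini') measurable
  also have "\<dots> = (\<integral>\<^sup>+x. \<integral>\<^sup>+y. \<integral>\<^sup>+z. ?k x y * ?m x y z \<partial>lborel \<partial>lborel \<partial>lborel)"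
    by (rule nn_integral_cong, rule lborel_pair.Fubini') measurable
  also have "\<dots> = (\<integral>\<^sup>+x. \<integral>\<^sup>+y. ?k x y * ennreal (pi / 4 * norm (x - y)) \<partial>lborel \<partial>lborel)"
  proof (rule nn_integral_cong, rule nn_integral_cong)
    fix x y :: "real^3"
    have "(\<integral>\<^sup>+z. ?k x y * ?m x y z \<partial>lborel) = ?k x y * (\<integral>\<^sup>+z. ?m x y z \<partial>lborel)" by (rule nn_integral_cmult) measurable
    also have "(\<integral>\<^sup>+z. ?m x y z \<partial>lborel) = ennreal (pi / 4 * norm (x - y))"
      using nn_integral_inner_pos_part_ball[of "x - y"] by (simp add: mult.commute)
    finally show "(\<integral>\<^sup>+z. ?k x y * ?m x y z \<partial>lborel) = ?k x y * ennreal (pi / 4 * norm (x - y))" .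
  qed
  also have "\<dots> = (\<integral>\<^sup>+x. \<integral>\<^sup>+y. ennreal (pi / 4) * (indicator \<Omega> x * indicator \<Omega> y) \<partial>lborel \<partial>lborel)"
  proof (rule nn_integral_cong, rule nn_integral_cong_AE)
    fix x :: "real^3"
    show "AE y in lborel. ?k x y * ennreal (pi / 4 * norm (x - y)) = ennreal (pi / 4) * (indicator \<Omega> x * indicator \<Omega> y)"
      using AE_lborel_singleton[of x]
    proof eventually_elim
      case (elim y)
      then have "ennreal (1 / norm (x - y)) * ennreal (pi / 4 * norm (x - y)) = ennreal (pi / 4)"
        by (subst ennreal_mult[symmetric]) auto
      then show ?case by (simp add: indicator_def)
    qed
  qed
  also have "\<dots> = (\<integral>\<^sup>+x. ennreal (pi / 4) * (indicator \<Omega> x * ennreal A) \<partial>lborel)"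
    by (intro nn_integral_cong) (simp add: nn_integral_cmult volume)
  also have "\<dots> = ennreal (pi / 4) * (ennreal A * ennreal A)"
    by (simp add: nn_integral_cmult nn_integral_multc volume)
  also have "\<dots> = ennreal (pi / 4 * A\<^sup>2)" using A by (simp add: ennreal_mult[symmetric] power2_eq_square)
  finally show ?thesis .
qed

text \<open>Homogeneity turns the hypothesis into \<open>H z \<le> C * norm z\<close>. Integrated
  over the ball, the right-hand side is \<open>C * pi\<close> and the left-hand side is
  \<open>nn_integral_H_ball\<close>.\<close>

lemma average:
  assumes "\<And>\<nu>. norm \<nu> = 1 \<Longrightarrow> (\<integral>\<^sup>+l. I \<nu> l \<partial>lborel) \<le> ennreal C" and C: "0 \<le> C"
  shows "A\<^sup>2 / 4 \<le> C"
proof -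
  have H: "H z \<le> ennreal (norm z) * ennreal C" for z
  proof (cases "z = 0")
    case True
    then show ?thesis using H_scale[of 0 0] by simp
  next
    case False
    have "H z = ennreal (norm z) * H (z /\<^sub>R norm z)" using H_scale[of "norm z" "z /\<^sub>R norm z"] False by simp
    also have "\<dots> \<le> ennreal (norm z) * ennreal C"
      using assms(1)[of "z /\<^sub>R norm z"] False by (intro mult_left_mono) (simp_all add: nn_integral_I)
    finally show ?thesis .
  qed
  have [measurable]: "cball 0 1 \<in> sets (borel :: (real^3) measure)" by simp
  have "ennreal (pi / 4 * A\<^sup>2) \<le> (\<integral>\<^sup>+z. ennreal C * (ennreal (norm z) * indicator (cball (0::real^3) 1) z) \<partial>lborel)"
    unfolding nn_integral_H_ball[symmetric] using H by (intro nn_integral_mono) (auto simp: indicator_def mult.commute)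
  also have "\<dots> = ennreal C * (\<integral>\<^sup>+z. ennreal (norm z) * indicator (cball (0::real^3) 1) z \<partial>lborel)"
    by (rule nn_integral_cmult) measurable
  also have "\<dots> = ennreal (C * pi)" using C by (simp add: nn_integral_norm_ball ennreal_mult)
  finally have "pi / 4 * A\<^sup>2 \<le> C * pi" using C by (subst (asm) ennreal_le_iff) auto
  then show ?thesis by (simp add: field_simps)
qed

text \<open>The two closed half-spaces overlap in the cutting plane, a null set, so reversing the
  direction exchanges the parts almost everywhere.\<close>

lemma reflect:
  assumes \<nu>: "norm \<nu> = 1"
  shows "V (- \<nu>) (- l) = A - V \<nu> l" "I (- \<nu>) (- l) = I \<nu> l"
proof -
  have u: "AE x in lborel. x \<in> \<Omega> \<inter> upper (- \<nu>) (- l) \<longleftrightarrow> x \<in> \<Omega> - upper \<nu> l"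
    "AE x in lborel. x \<in> \<Omega> - upper (- \<nu>) (- l) \<longleftrightarrow> x \<in> \<Omega> \<inter> upper \<nu> l"
    using AE_not_hyperplane[OF \<nu>, of l] by (eventually_elim, auto simp: upper_def)+
  have "emeasure lborel (\<Omega> \<inter> upper (- \<nu>) (- l)) = emeasure lborel (\<Omega> - upper \<nu> l)"
    using u(1) by (intro emeasure_eq_AE) auto
  then have "ennreal (V (- \<nu>) (- l)) = ennreal (A - V \<nu> l)" by (simp add: emeasure_upper emeasure_lower)
  then show "V (- \<nu>) (- l) = A - V \<nu> l" using V_bounds by (subst (asm) ennreal_inj) auto
  have "I (- \<nu>) (- l) = coulomb (\<Omega> - upper \<nu> l) (\<Omega> \<inter> upper \<nu> l)"
    unfolding I_def by (rule coulomb_cong_AE[OF u])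
  then show "I (- \<nu>) (- l) = I \<nu> l" unfolding I_def by (subst coulomb_commute) auto
qed

text \<open>The pointwise bound reads \<open>I \<le> w(V) b\<close> with a step function \<open>w\<close>. With \<open>W\<close> a primitive of \<open>w\<close> the right-hand side
  is the derivative of \<open>- W(V)\<close>, which is integrated by Fatou's lemma since \<open>V\<close> is merely monotone and left continuous.\<close>

lemma half_integral:
  fixes X :: "nat \<Rightarrow> real"
  assumes n: "n \<le> 15" and X: "\<And>m. m < n \<Longrightarrow> 0 \<le> X m" "\<And>m. m < n \<Longrightarrow> X m < 1/2" and \<nu>: "norm \<nu> = 1"
    and I_le: "\<And>m l. m < n \<Longrightarrow> V \<nu> l < A * X m \<Longrightarrow> I \<nu> l \<le> ennreal (2 - real (Suc m) / 8) * b \<nu> l"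
  shows "(\<integral>\<^sup>+l. (if V \<nu> l \<le> A / 2 then I \<nu> l else 0) \<partial>lborel) \<le> ennreal (A - A / 8 * (\<Sum>m<n. X m))"
proof -
  \<comment> \<open>\<open>J v\<close> collects the indices whose bound is available at volume
    \<open>v\<close>; each lowers the weight by 1/8. In \<open>W\<close> the term
    \<open>min v (A * X m)\<close> is the primitive of the indicator of
    \<open>v < A * X m\<close>.\<close>
  define J where "J v = {m. m < n \<and> v < A * X m}" for v
  define w where "w v = 2 - real (card (J v)) / 8" for v
  define W where "W v = 2 * v - (\<Sum>m<n. min v (A * X m)) / 8" for v
  have fin: "finite (J v)" for v by (simp add: J_def)
  have cardJ: "card (J v) \<le> n" for v using card_mono[of "{..<n}" "J v"] by (auto simp: J_def)
  have wpos: "0 < w v" for v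
  proof -
    have "real (card (J v)) \<le> 15" using cardJ[of v] n by linarith
    then show ?thesis by (simp add: w_def)
  qed
  have Iw: "I \<nu> l \<le> ennreal (w (V \<nu> l)) * b \<nu> l" for l
  proof (cases "J (V \<nu> l) = {}")
    case True
    then show ?thesis using I_le_2b[OF \<nu>, of l] by (simp add: w_def)
  next
    case False
    define M where "M = Max (J (V \<nu> l))"
    have M: "M \<in> J (V \<nu> l)" unfolding M_def using fin False by (rule Max_in)
    have "J (V \<nu> l) \<subseteq> {..M}" unfolding M_def using fin by (auto intro: Max_ge)
    \<comment> \<open>The largest available index gives the strongest bound, and
      \<open>Suc M\<close> is at least the number of available indices, whatever the order of the
      thresholds.\<close>
    then have "card (J (V \<nu> l)) \<le> Suc M" using card_mono[of "{..M}" "J (V \<nu> l)"] by simp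
    then have "2 - real (Suc M) / 8 \<le> w (V \<nu> l)" by (simp add: w_def)
    then have "ennreal (2 - real (Suc M) / 8) * b \<nu> l \<le> ennreal (w (V \<nu> l)) * b \<nu> l"
      by (intro mult_right_mono ennreal_leI) auto
    moreover have "I \<nu> l \<le> ennreal (2 - real (Suc M) / 8) * b \<nu> l" using M by (intro I_le) (auto simp: J_def)
    ultimately show ?thesis by (rule order_trans[rotated])
  qed
  have W_diff: "W v' - W v = 2 * (v' - v) - (\<Sum>m<n. min v' (A * X m) - min v (A * X m)) / 8" for v v'
    by (simp add: W_def sum_subtractf diff_divide_distrib algebra_simps)
  \<comment> \<open>No threshold active at \<open>v\<close> is reached before \<open>v'\<close>, so
    \<open>W\<close> has constant slope between the two.\<close>
  have W_linear: "W v' - W v = w v * (v' - v)" if "v \<le> v'" "\<And>m. m \<in> J v \<Longrightarrow> v' < A * X m" for v v'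
  proof -
    have "(\<Sum>m<n. min v' (A * X m) - min v (A * X m)) = (\<Sum>m<n. if m \<in> J v then v' - v else 0)"
      using that by (intro sum.cong) (auto simp: J_def min_def less_imp_le not_less dest: that(2)[unfolded J_def])
    also have "\<dots> = real (card (J v)) * (v' - v)"
    proof -
      have "{..<n} \<inter> J v = J v" by (auto simp: J_def)
      then show ?thesis by (simp add: sum.If_cases)
    qed
    finally show ?thesis unfolding W_diff w_def by (simp add: algebra_simps)
  qed
  have W_lip: "0 \<le> W v' - W v" "W v' - W v \<le> 2 * (v' - v)" if "v \<le> v'" for v v'
  proof -
    have "(\<Sum>m<n. min v' (A * X m) - min v (A * X m)) \<le> (\<Sum>m<n. v' - v)"
      using that by (intro sum_mono) (auto simp: min_def)
    also have "\<dots> = real n * (v' - v)" by simp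
    \<comment> \<open>At most fifteen reductions by 1/8 leave \<open>W\<close> with a slope of at
      least 1/8, hence increasing.\<close>
    also have "\<dots> \<le> 15 * (v' - v)" using that n by (intro mult_right_mono) auto
    finally show "0 \<le> W v' - W v" unfolding W_diff using that by simp
    have "0 \<le> (\<Sum>m<n. min v' (A * X m) - min v (A * X m))" using that by (intro sum_nonneg) (auto simp: min_def)
    then show "W v' - W v \<le> 2 * (v' - v)" unfolding W_diff by simp
  qed
  have W0: "W 0 = 0" using X A by (simp add: W_def min_def)
  have W_half: "W (A / 2) = A - A / 8 * (\<Sum>m<n. X m)"
  proof -
    have "(\<Sum>m<n. min (A / 2) (A * X m)) = (\<Sum>m<n. A * X m)"
    proof (intro sum.cong refl)
      fix m assume "m \<in> {..<n}"
      then have "A * X m \<le> A * (1/2)" using X A by (intro mult_left_mono) (auto intro: less_imp_le)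
      then show "min (A / 2) (A * X m) = A * X m" by simp
    qed
    then show ?thesis by (simp add: W_def sum_distrib_left[symmetric])
  qed
  \<comment> \<open>Just left of a point with \<open>V \<nu> l \<le> A / 2\<close> the volume may
    exceed \<open>A / 2\<close>, but by left continuity it stays below any \<open>\<theta>\<close>
    larger than \<open>A / 2\<close>. Truncation at \<open>\<theta>\<close> thus leaves the relevant
    increments intact and bounds the total variation by \<open>W \<theta>\<close>; at the end
    \<open>\<theta>\<close> approaches \<open>A / 2\<close>.\<close>
  have bound: "(\<integral>\<^sup>+l. (if V \<nu> l \<le> A / 2 then I \<nu> l else 0) \<partial>lborel) \<le> ennreal (W \<theta>)" if \<theta>: "A / 2 < \<theta>" for \<theta>
  proof -
    define U where "U l = W (min (V \<nu> l) \<theta>)" for l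
    define h where "h k = 1 / real (Suc k)" for k
    have h: "0 < h k" for k by (simp add: h_def)
    have U_bounds: "0 \<le> U l" "U l \<le> W \<theta>" for l
    proof -
      have "0 \<le> min (V \<nu> l) \<theta>" using V_bounds(1)[of \<nu> l] \<theta> A by (simp add: min_def)
      then show "0 \<le> U l" using W_lip(1)[of 0 "min (V \<nu> l) \<theta>"] W0 by (simp add: U_def)
      show "U l \<le> W \<theta>" using W_lip(1)[of "min (V \<nu> l) \<theta>" \<theta>] by (simp add: U_def)
    qed
    have U_antimono: "antimono U"
    proof (rule antimonoI)
      fix l l' :: real assume "l \<le> l'"
      then have "min (V \<nu> l') \<theta> \<le> min (V \<nu> l) \<theta>" using antimonoD[OF V_antimono, of l l' \<nu>] by (simp add: min_def)
      then show "U l' \<le> U l" using W_lip(1) by (simp add: U_def)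
    qed
    have [measurable]: "W \<in> borel_measurable borel" unfolding W_def[abs_def] by measurable
    have [measurable]: "U \<in> borel_measurable borel" unfolding U_def[abs_def] by measurable
    have "(if V \<nu> l \<le> A / 2 then I \<nu> l else 0) \<le> liminf (\<lambda>k. ennreal (real (Suc k) * (U (l - h k) - U l)))" for l
    proof (cases "V \<nu> l \<le> A / 2")
      case True
      have ev: "\<forall>\<^sub>F k in sequentially. V \<nu> (l - h k) < a" if "V \<nu> l < a" for a
        unfolding h_def using V_left_continuous that by (rule order_tendstoD(2))
      have 1: "\<forall>\<^sub>F k in sequentially. V \<nu> (l - h k) < \<theta>" using True \<theta> by (intro ev) simp
      have 2: "\<forall>\<^sub>F k in sequentially. \<forall>m\<in>J (V \<nu> l). V \<nu> (l - h k) < A * X m"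
        using fin by (intro eventually_ball_finite ballI ev) (auto simp: J_def)
      have 3: "\<forall>\<^sub>F k in sequentially. ennreal (w (V \<nu> l)) * ennreal (real (Suc k) * (V \<nu> (l - h k) - V \<nu> l)) \<le> ennreal (real (Suc k) * (U (l - h k) - U l))"
        using 1 2
      proof eventually_elim
        case (elim k)
        have le: "V \<nu> l \<le> V \<nu> (l - h k)" using h[of k] by (intro antimonoD[OF V_antimono]) simp
        have "U (l - h k) - U l = w (V \<nu> l) * (V \<nu> (l - h k) - V \<nu> l)"
          using elim le True \<theta> W_linear[OF le] by (simp add: U_def min_def)
        then have "real (Suc k) * (U (l - h k) - U l) = w (V \<nu> l) * (real (Suc k) * (V \<nu> (l - h k) - V \<nu> l))"
          by (simp only: mult.left_commute)
        then show ?case using wpos[of "V \<nu> l"] by (simp only: ennreal_mult'[OF less_imp_le] order_refl)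
      qed
      have "I \<nu> l \<le> ennreal (w (V \<nu> l)) * b \<nu> l" by (rule Iw)
      also have "\<dots> \<le> liminf (\<lambda>k. ennreal (w (V \<nu> l)) * ennreal (real (Suc k) * (V \<nu> (l - h k) - V \<nu> l)))"
        unfolding b_def h_def by (rule cmult_liminf_le[OF wpos])
      also have "\<dots> \<le> liminf (\<lambda>k. ennreal (real (Suc k) * (U (l - h k) - U l)))" by (rule Liminf_mono[OF 3])
      finally show ?thesis using True by simp
    qed simp
    then have "(\<integral>\<^sup>+l. (if V \<nu> l \<le> A / 2 then I \<nu> l else 0) \<partial>lborel) \<le> (\<integral>\<^sup>+l. liminf (\<lambda>k. ennreal (real (Suc k) * (U (l - h k) - U l))) \<partial>lborel)"
      by (rule nn_integral_mono)
    also have "\<dots> \<le> liminf (\<lambda>k. \<integral>\<^sup>+l. ennreal (real (Suc k) * (U (l - h k) - U l)) \<partial>lborel)"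
      by (rule nn_integral_liminf) measurable
    also have "\<dots> \<le> ennreal (W \<theta>)"
    proof (rule Liminf_le)
      show "\<forall>\<^sub>F k in sequentially. (\<integral>\<^sup>+l. ennreal (real (Suc k) * (U (l - h k) - U l)) \<partial>lborel) \<le> ennreal (W \<theta>)"
      proof (intro always_eventually allI)
        fix k
        have "(\<integral>\<^sup>+l. ennreal (real (Suc k) * (U (l - h k) - U l)) \<partial>lborel) = ennreal (real (Suc k)) * (\<integral>\<^sup>+l. ennreal (U (l - h k) - U l) \<partial>lborel)"
          by (subst nn_integral_cmult[symmetric]) (auto simp: ennreal_mult')
        also have "\<dots> \<le> ennreal (real (Suc k)) * ennreal (W \<theta> * h k)"
          by (intro mult_left_mono nn_integral_antimono_increment U_antimono U_bounds h) auto
        also have "\<dots> = ennreal (W \<theta>)"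
          using U_bounds(1)[of 0] U_bounds(2)[of 0] by (subst ennreal_mult[symmetric]) (auto simp: h_def simp del: of_nat_Suc)
        finally show "(\<integral>\<^sup>+l. ennreal (real (Suc k) * (U (l - h k) - U l)) \<partial>lborel) \<le> ennreal (W \<theta>)" .
      qed
    qed simp
    finally show ?thesis .
  qed
  show ?thesis unfolding W_half[symmetric]
  proof (rule ennreal_le_epsilon)
    fix e :: real assume e: "0 < e"
    have 0: "0 \<le> W (A / 2)" using W_lip(1)[of 0 "A / 2"] W0 A by simp
    have "W (A / 2 + e / 2) \<le> W (A / 2) + e" using W_lip(2)[of "A / 2" "A / 2 + e / 2"] e by simp
    then have "ennreal (W (A / 2 + e / 2)) \<le> ennreal (W (A / 2)) + ennreal e"
      using 0 e by (simp add: ennreal_leI flip: ennreal_plus)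
    then show "(\<integral>\<^sup>+l. (if V \<nu> l \<le> A / 2 then I \<nu> l else 0) \<partial>lborel) \<le> ennreal (W (A / 2)) + ennreal e"
      using bound[of "A / 2 + e / 2"] e by (intro order_trans[OF bound]) auto
  qed
qed

text \<open>At every level one of the two parts has volume at most \<open>A / 2\<close>. It is the
  upper part for \<open>\<nu>\<close> or, after reflection, for \<open>- \<nu>\<close>, so two
  applications of \<open>half_integral\<close> bound the full integral by
  \<open>2 * C\<close>.\<close>

lemma volume_bound:
  fixes X :: "nat \<Rightarrow> real"
  assumes n: "n \<le> 15" and X: "\<And>m. m < n \<Longrightarrow> 0 \<le> X m" "\<And>m. m < n \<Longrightarrow> X m < 1/2"
    and I_le: "\<And>m \<nu> l. m < n \<Longrightarrow> norm \<nu> = 1 \<Longrightarrow> V \<nu> l < A * X m \<Longrightarrow> I \<nu> l \<le> ennreal (2 - real (Suc m) / 8) * b \<nu> l"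
  shows "A \<le> 8 - (\<Sum>m<n. X m)"
proof -
  define C where "C = A - A / 8 * (\<Sum>m<n. X m)"
  have "(\<Sum>m<n. X m) \<le> (\<Sum>m<n. 1/2)" using X(2) by (intro sum_mono) (simp add: less_imp_le)
  then have "(\<Sum>m<n. X m) \<le> 8" using n by simp
  then have "A / 8 * (\<Sum>m<n. X m) \<le> A / 8 * 8" using A by (intro mult_left_mono) auto
  then have C: "0 \<le> C" by (simp add: C_def)
  let ?h = "\<lambda>\<nu> l. if V \<nu> l \<le> A / 2 then I \<nu> l else 0"
  have half: "(\<integral>\<^sup>+l. ?h \<nu> l \<partial>lborel) \<le> ennreal C" if "norm \<nu> = 1" for \<nu>
    unfolding C_def using that I_le by (intro half_integral n X) auto
  have "(\<integral>\<^sup>+l. I \<nu> l \<partial>lborel) \<le> ennreal (2 * C)" if \<nu>: "norm \<nu> = 1" for \<nu>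
  proof -
    have "(\<integral>\<^sup>+l. I \<nu> l \<partial>lborel) \<le> (\<integral>\<^sup>+l. ?h \<nu> l + ?h (- \<nu>) (- l) \<partial>lborel)"
      by (intro nn_integral_mono) (auto simp: reflect[OF \<nu>])
    also have "\<dots> = (\<integral>\<^sup>+l. ?h \<nu> l \<partial>lborel) + (\<integral>\<^sup>+l. ?h (- \<nu>) (- l) \<partial>lborel)" by (rule nn_integral_add) measurable
    also have "(\<integral>\<^sup>+l. ?h (- \<nu>) (- l) \<partial>lborel) = (\<integral>\<^sup>+l. ?h (- \<nu>) l \<partial>lborel)"
      using nn_integral_real_affine[of "?h (- \<nu>)" "-1" 0] by (simp cong: if_cong)
    also have "(\<integral>\<^sup>+l. ?h \<nu> l \<partial>lborel) + (\<integral>\<^sup>+l. ?h (- \<nu>) l \<partial>lborel) \<le> ennreal C + ennreal C"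
      using \<nu> by (intro add_mono half) auto
    also have "\<dots> = ennreal (2 * C)" using C by (simp flip: ennreal_plus)
    finally show ?thesis .
  qed
  then have "A\<^sup>2 / 4 \<le> 2 * C" using C by (intro average) auto
  then have "A * A \<le> A * (8 - (\<Sum>m<n. X m))" by (simp add: C_def power2_eq_square algebra_simps)
  then show ?thesis using A by (simp add: mult_le_cancel_left_pos)
qed

theorem volume_less: "A < 7.5"
proof -
  \<comment> \<open>With no thresholds the argument yields the bound under which
    \<open>\<Lambda>\<close> was computed.\<close>
  have A8: "A \<le> 8" using volume_bound[of 0 "\<lambda>_. 0"] by simp
  have "A \<le> 8 - (\<Sum>m<15. steps ! m)"
  proof (rule volume_bound[OF order_refl steps(1,2)])
    fix m \<nu> l assume *: "m < 15" "norm \<nu> = 1" "V \<nu> l < A * steps ! m"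
    have "I \<nu> l \<le> ennreal (1 + (1 - real (Suc m) / 8)) * b \<nu> l"
      using *(1) steps[OF *(1)] by (intro I_le_capillary[OF A8 *(2) _ _ *(3) _ refl]) auto
    then show "I \<nu> l \<le> ennreal (2 - real (Suc m) / 8) * b \<nu> l" by simp
  qed
  then show ?thesis unfolding sum_steps by simp
qed

end

section \<open>Conclusion for Lebesgue measurable minimizers\<close>

lemma min_energy_finite:
  assumes "0 < A"
  shows "min_energy A < \<infinity>"
proof -
  define r where "r = root 3 (A / (4 / 3 * pi))"
  have r: "0 < r" "r ^ 3 * (4 / 3 * pi) = A" using assms by (simp_all add: r_def real_root_pow_pos2)
  obtain F where F: "F \<in> sets borel" "emeasure lborel F = ennreal (r ^ 3 * (4 / 3 * pi))" "perimeter F \<le> ennreal (r\<^sup>2 * (4 * pi))"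
    "coulomb F F \<le> ennreal (2 * (r ^ 5 * (16 / 15 * pi\<^sup>2)))"
    using affine_piece[of "cball 0 1" "4 / 3 * pi" "4 * pi" "16 / 15 * pi\<^sup>2" r 0]
      perimeter_unit_ball coulomb_unit_ball r emeasure_ball3[of 1 0] by auto
  have "min_energy A \<le> perimeter F + (1/2) * coulomb F F" using F r by (intro min_energy_le) auto
  also have "\<dots> \<le> ennreal (r\<^sup>2 * (4 * pi)) + (1/2) * ennreal (2 * (r ^ 5 * (16 / 15 * pi\<^sup>2)))"
    using F by (intro add_mono mult_left_mono) auto
  also have "\<dots> = ennreal (r\<^sup>2 * (4 * pi)) + ennreal (r ^ 5 * (16 / 15 * pi\<^sup>2))" using r by (subst half_ennreal) auto
  also have "\<dots> < \<infinity>" by simp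
  finally show ?thesis .
qed

theorem theorem1p1:
  fixes A :: real
  assumes "A > 0"
    and "\<exists>\<Omega>::(real^3) set. \<Omega> \<in> sets lebesgue \<and> emeasure lebesgue \<Omega> = ennreal A \<and>
           liquid_drop_energy \<Omega> = min_energy A"
  shows "A < 7.5"
proof -
  obtain \<Omega> :: "(real^3) set" where \<Omega>: "\<Omega> \<in> sets lebesgue" "emeasure lebesgue \<Omega> = ennreal A"
    "liquid_drop_energy \<Omega> = min_energy A"
    using assms(2) by blast
  obtain S where S: "S \<in> sets borel" "emeasure lborel S = ennreal A" "min_energy A = perimeter S + (1/2) * coulomb S S"
    using borel_representative[OF \<Omega>(1)] \<Omega>(2,3) by metis
  have half: "(1/2 :: ennreal) \<noteq> 0" by (simp add: ennreal_divide_eq_0_iff)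
  \<comment> \<open>Comparison with a ball makes the infimum finite, so perimeter and Coulomb energy
    of the minimizer are real numbers, as the locale \<open>minimizer\<close> requires.\<close>
  have "perimeter S + (1/2) * coulomb S S \<noteq> \<infinity>" using min_energy_finite[OF assms(1)] unfolding S(3) by auto
  then have fin: "perimeter S \<noteq> \<infinity>" "coulomb S S \<noteq> \<infinity>" using half by (auto simp: ennreal_mult_eq_top_iff)
  define P D where "P = enn2real (perimeter S)" and "D = enn2real (coulomb S S) / 2"
  have P: "perimeter S = ennreal P" "0 \<le> P" and D: "coulomb S S = ennreal (2 * D)" "0 \<le> D"
    using fin by (simp_all add: P_def D_def less_top)
  have "min_energy A = ennreal (P + D)" unfolding S(3) P(1) D(1) using P D by (subst half_ennreal) auto
  then interpret minimizer S A P D using S P D assms(1) by unfold_locales auto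
  show ?thesis by (rule volume_less)
qed

end
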